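(* Suppose $\mathbf{u}$ has coefficients in $\mathbb{Z}$, and that $$ \mathcal{B}_1(\mathbf{u}_1) > 2 r_1 \left( \max \Big\{ \ 4 (r_1 + 1) \left( \sum_{j = 2}^d 4^{j- 2} \gamma_j \right) , \ \frac{1}{4(R+1)} \ \Big\} \right)^{-1}. $$ Let $$ 0 < \Omega < \min \Big\{ \ \frac{1}{ 8r_1 + 9} \left( \sum_{j = 2}^d 4^{j- 2} \gamma_j \right)^{-1}, \ \left( \frac{1}{2 (R + 1)} + \sum_{j = 2}^d 4^{j- 2} \gamma_j \right)^{-1} \ \Big\}. $$ Let $0 < \Delta \leq 1$, and let $P$ be sufficiently large with respect to $n$, $d$, $r_d, \ldots, r_1$, $\Delta$, $\Omega$, and $\mathbf{u}$. Then one of the following two alternatives must hold: $(i)$ $|S(\boldsymbol{\alpha})| \leq P^{n - \Delta \Omega}$. $(ii)$ There exists $q \in \mathbb{N}$ such that $$ q \leq P^{\Delta} \ \ \text{ and } \ \ \| q \boldsymbol{\alpha}_{\ell} \| \leq P^{ - \ell + \Delta} \ \ (1 \leq \ell \leq d). $$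
   Context: Let $\mathbf{u} = ( \mathbf{u}_{d}, \ldots, \mathbf{u}_{1} )$ be a system of polynomials in $x_1,\ldots,x_n$, where $\mathbf{u}_{\ell} = ( u_{\ell,1}, \ldots, u_{\ell, r_{\ell}} )$ consists of the degree $\ell$ polynomials of $\mathbf{u}$ $(1 \leq \ell \leq d)$, and let $R = r_1 + \cdots + r_d$. Let $\mathbf{U} = ( \mathbf{U}_{d}, \ldots, \mathbf{U}_{1} )$ with $\mathbf{U}_{\ell} = ( U_{\ell,1}, \ldots, U_{\ell, r_{\ell}} )$, where $U_{\ell, r}$ is the degree $\ell$ homogeneous part of $u_{\ell, r}$. Write $e(x) = e^{2\pi i x}$. For $\boldsymbol{\alpha} = (\boldsymbol{\alpha}_d, \ldots, \boldsymbol{\alpha}_1) \in \mathbb{R}^R$ with $\boldsymbol{\alpha}_{\ell} = (\alpha_{\ell,1},\ldots,\alpha_{\ell,r_\ell})$, define $$S(\boldsymbol{\alpha}) = \sum_{\mathbf{x} \in P [0,1]^n \cap \mathbb{Z}^n} e\Big( \sum_{1 \leq \ell \leq d} \sum_{1 \leq r \leq r_{\ell}} \alpha_{\ell, r}\, u_{\ell, r}(\mathbf{x}) \Big).$$ For real $\alpha$, $\|\alpha\|$ is the distance from $\alpha$ to the nearest integer, and $\|\boldsymbol{\alpha}_\ell\| = \max_{1\le r\le r_\ell} \|\alpha_{\ell,r}\|$. For a function $G$ on $\mathbb{C}^n$ let $\Gamma_{\ell, G} (\mathbf{x}_1, \ldots, \mathbf{x}_{\ell}) = \sum_{t_1=0}^1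 \cdots \sum_{t_{\ell}=0}^1 (-1)^{t_1 + \cdots + t_{\ell}} G( t_1 \mathbf{x}_1 + \cdots + t_{\ell} \mathbf{x}_{\ell} )$. Let $\mathbf{e}_1,\ldots,\mathbf{e}_n$ be the standard basis of $\mathbb{C}^n$. For $1 < \ell \leq d$ with $r_\ell > 0$, let $\mathbb{M}_{\ell}$ be the set of $(\mathbf{x}_1, \ldots, \mathbf{x}_{\ell-1}) \in (\mathbb{C}^n)^{\ell-1}$ for which the $r_\ell \times n$ matrix $[\Gamma_{\ell, U_{\ell, r}}(\mathbf{x}_1, \ldots, \mathbf{x}_{\ell-1}, \mathbf{e}_i)]$ $(1 \leq r \leq r_{\ell},\ 1 \leq i \leq n)$ has rank strictly less than $r_{\ell}$. For $R_0 > 0$, $z_{R_0}(\mathbb{M}_\ell)$ denotes the number of integer points $(\mathbf{x}_1,\ldots,\mathbf{x}_{\ell-1})$ on $\mathbb{M}_\ell$ with all coordinates of absolute value at most $R_0$. Let $g_{\ell}(\mathbf{U}_{\ell})$ be the largest real number such that $z_P(\mathbb{M}_{\ell}) \ll P^{n(\ell-1) - g_{\ell}(\mathbf{U}_{\ell}) + \varepsilon}$ for each $\varepsilon > 0$. Set $\gamma_{\ell} = 2^{\ell-1} (\ell-1) r_{\ell} / g_{\ell}(\mathbf{U}_{\ell})$ if $r_\ell > 0$ and $g_\ell(\mathbf{U}_\ell) > 0$; $\gamma_\ell = 0$ if $r_\ell = 0$; and $\gamma_\ell = +\infty$ if $r_\ell > 0$ and $g_\ell(\mathbf{U}_\ell)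 = 0$. $\mathcal{B}_1(\mathbf{u}_1)$ is the minimum number of non-zero coefficients in a non-trivial linear combination $\lambda_1 U_{1,1} + \cdots + \lambda_{r_1} U_{1,r_1}$ with $(\lambda_1,\ldots,\lambda_{r_1}) \in \mathbb{Q}^{r_1} \setminus \{\mathbf{0}\}$ (it is positive iff these linear forms are linearly independent over $\mathbb{Q}$); if $r_1 = 0$ then $\mathcal{B}_1(\mathbf{u}_1) = +\infty$. *)

theory Defs
  imports "HOL-Analysis.Analysis" "HOL-Library.Poly_Mapping" "HOL-Library.Landau_Symbols"
begin

text \<open>Integer polynomials in the variables \<open>x\<^sub>i\<close> with \<open>i\<close> ranging over a finite type:
  finitely supported maps from exponent vectors to coefficients.\<close>

type_synonym 'n int_mpoly = "('n \<Rightarrow>\<^sub>0 nat) \<Rightarrow>\<^sub>0 int"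

definition mpoly_eval :: "'n::finite int_mpoly \<Rightarrow> 'a::comm_ring_1 ^ 'n \<Rightarrow> 'a" where
  "mpoly_eval p x = (\<Sum>m\<in>Poly_Mapping.keys p.
     of_int (Poly_Mapping.lookup p m) * (\<Prod>i\<in>UNIV. (x $ i) ^ Poly_Mapping.lookup m i))"

definition mon_degree :: "('n::finite \<Rightarrow>\<^sub>0 nat) \<Rightarrow> nat" where
  "mon_degree m = (\<Sum>i\<in>UNIV. Poly_Mapping.lookup m i)"

definition mpoly_degree :: "'n::finite int_mpoly \<Rightarrow> nat" where
  "mpoly_degree p = Max (insert 0 (mon_degree ` Poly_Mapping.keys p))"

definition hom_part :: "nat \<Rightarrow> 'n::finite int_mpoly \<Rightarrow> 'n int_mpoly" where
  "hom_part l p = (\<Sum>m | m \<in> Poly_Mapping.keys p \<and> mon_degree m = l.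
     Poly_Mapping.single m (Poly_Mapping.lookup p m))"

text \<open>A system is given by \<open>d\<close>, the numbers \<open>r l\<close> for \<open>1 \<le> l \<le> d\<close>, and the polynomials
  \<open>u l s\<close> for \<open>1 \<le> l \<le> d\<close> and \<open>1 \<le> s \<le> r l\<close>; values at other indices are irrelevant.
  The same indexing is used for the real coefficients \<open>\<alpha> l s\<close>.\<close>

definition is_system :: "nat \<Rightarrow> (nat \<Rightarrow> nat) \<Rightarrow> (nat \<Rightarrow> nat \<Rightarrow> 'n::finite int_mpoly) \<Rightarrow> bool" where
  "is_system d r u \<longleftrightarrow> (\<forall>l\<in>{1..d}. \<forall>s\<in>{1..r l}. mpoly_degree (u l s) = l)"

definition lead_forms :: "(nat \<Rightarrow> nat \<Rightarrow> 'n::finite int_mpoly) \<Rightarrow> nat \<Rightarrow> nat \<Rightarrow> 'n int_mpoly" where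
  "lead_forms u l s = hom_part l (u l s)"

definition e_fun :: "real \<Rightarrow> complex" where
  "e_fun x = exp (2 * of_real pi * \<i> * of_real x)"

definition exp_sum :: "nat \<Rightarrow> (nat \<Rightarrow> nat) \<Rightarrow> (nat \<Rightarrow> nat \<Rightarrow> 'n::finite int_mpoly) \<Rightarrow> real
    \<Rightarrow> (nat \<Rightarrow> nat \<Rightarrow> real) \<Rightarrow> complex" where
  "exp_sum d r u P \<alpha> =
     (\<Sum>x\<in>((*\<^sub>R) P ` cbox (0 :: real ^ 'n) 1) \<inter> {x. \<forall>i. x $ i \<in> \<int>}.
        e_fun (\<Sum>l=1..d. \<Sum>s=1..r l. \<alpha> l s * mpoly_eval (u l s) x))"

definition dist_int :: "real \<Rightarrow> real" where
  "dist_int x = \<bar>x - of_int (round x)\<bar>"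

text \<open>The maximum over the empty family is taken to be \<open>0\<close>.\<close>

definition dist_int_vec :: "nat \<Rightarrow> (nat \<Rightarrow> real) \<Rightarrow> real" where
  "dist_int_vec k a = Max (insert 0 ((\<lambda>s. dist_int (a s)) ` {1..k}))"

definition Gam :: "nat \<Rightarrow> (complex ^ 'n::finite \<Rightarrow> complex) \<Rightarrow> (nat \<Rightarrow> complex ^ 'n) \<Rightarrow> complex" where
  "Gam l G x = (\<Sum>t\<in>{1..l} \<rightarrow>\<^sub>E {0, 1::nat}.
     (-1) ^ (\<Sum>k=1..l. t k) * G (\<Sum>k=1..l. of_nat (t k) *s x k))"

text \<open>The set \<open>\<M>\<^sub>l\<close> for the forms \<open>U 1, \<dots>, U k\<close>. An \<open>(l-1)\<close>-tuple of vectors is an extensional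
  function on \<open>{1..l-1}\<close>. Since the number \<open>k\<close> of rows is not the size of a type, the rank of the
  matrix is written as the dimension of the span of its rows, which is how
  \<^const>\<open>rank\<close> is defined.\<close>

definition sing_locus :: "nat \<Rightarrow> nat \<Rightarrow> (nat \<Rightarrow> 'n::finite int_mpoly) \<Rightarrow> (nat \<Rightarrow> complex ^ 'n) set" where
  "sing_locus l k U = {x \<in> {1..l-1} \<rightarrow>\<^sub>E UNIV.
     vec.dim ((\<lambda>s. \<chi> i. Gam l (mpoly_eval (U s)) (x(l := axis i 1))) ` {1..k}) < k}"

definition count_int_points :: "nat \<Rightarrow> (nat \<Rightarrow> complex ^ 'n::finite) set \<Rightarrow> real \<Rightarrow> nat" where
  "count_int_points m M R\<^sub>0 =
     card {x \<in> M. \<forall>k\<in>{1..m}. \<forall>i. x k $ i \<in> \<int> \<and> norm (x k $ i) \<le> R\<^sub>0}"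

text \<open>If \<open>k > 0\<close> and \<open>l > 1\<close> the maximum exists and lies in \<open>[0, n(l-1)]\<close>: the defining
  condition is closed, holds for \<open>0\<close>, and \<open>\<M>\<^sub>l\<close> contains the origin.\<close>

definition g_inv :: "nat \<Rightarrow> nat \<Rightarrow> (nat \<Rightarrow> 'n::finite int_mpoly) \<Rightarrow> real" where
  "g_inv l k U = (GREATEST g::real. \<forall>\<epsilon>>0.
     (\<lambda>P::real. real (count_int_points (l - 1) (sing_locus l k U) P))
       \<in> O[at_top](\<lambda>P. P powr (real (CARD('n) * (l - 1)) - g + \<epsilon>)))"

definition gamma_inv :: "nat \<Rightarrow> nat \<Rightarrow> (nat \<Rightarrow> 'n::finite int_mpoly) \<Rightarrow> ereal" where
  "gamma_inv l k U =
     (if k = 0 then 0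
      else if g_inv l k U > 0 then ereal (2 ^ (l - 1) * real (l - 1) * real k / g_inv l k U)
      else \<infinity>)"

definition B1_inv :: "nat \<Rightarrow> (nat \<Rightarrow> 'n::finite int_mpoly) \<Rightarrow> ereal" where
  "B1_inv k U =
     (if k = 0 then \<infinity>
      else ereal (real (LEAST N. \<exists>c :: nat \<Rightarrow> rat. (\<exists>s\<in>{1..k}. c s \<noteq> 0) \<and>
             N = card {m. (\<Sum>s=1..k. c s * of_int (Poly_Mapping.lookup (U s) m)) \<noteq> 0})))"

definition gamma_sum :: "nat \<Rightarrow> (nat \<Rightarrow> nat) \<Rightarrow> (nat \<Rightarrow> nat \<Rightarrow> 'n::finite int_mpoly) \<Rightarrow> ereal" where
  "gamma_sum d r u = (\<Sum>j=2..d. ereal (4 ^ (j - 2)) * gamma_inv j (r j) (lead_forms u j))"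

end

theory Submission
  imports Defs "HOL-Number_Theory.Cong"
begin

text \<open>
  Suppose \<open>\<bar>S \<alpha>\<bar> > P powr (n - Q)\<close> with \<open>Q = \<Delta> * \<Omega>\<close>. We descend on the degree \<open>l\<close>. Let \<open>q \<le> P powr \<theta>\<close>
  approximate the coefficients of all degrees \<open>j > l\<close> to within \<open>P powr (\<theta> - j)\<close>. After \<open>l - 1\<close>
  differencing steps the degree \<open>l\<close> part of the phase is linear, and on residue classes modulo \<open>q\<close>
  inside boxes of side \<open>P powr (1 - \<theta>)\<close> the parts of higher degree are constant modulo \<open>1\<close> up to a
  perturbation of bounded size. Hence there are many tuples \<open>h\<close> of \<open>l - 1\<close> integer vectors of size \<open>P\<close>
  for which all \<open>q * \<lambda>\<^sub>i h\<close>, the coefficients of that linear form, are close to integers. As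
  \<open>\<lambda>\<close> is a symmetric linear form in each vector of \<open>h\<close>, these vectors can be contracted one by one to
  size \<open>P powr \<eta>\<close>, without loss of density and with a proportional contraction of the distances. By the
  definition of \<open>g_inv\<close> not all resulting tuples lie on the singular locus, and Cramer's rule for a
  nonvanishing minor turns one that does not into a denominator for the coefficients of degree \<open>l\<close>; the
  exponent \<open>\<theta>\<close> becomes \<open>4 * \<theta> + Q * \<gamma>\<^sub>l + \<epsilon>\<close>.

  In degree one the sum over a block is a product of geometric sums. Each coordinate in which the linear
  coefficient is not close to a rational with denominator \<open>q\<close> saves a factor \<open>P powr (\<Delta> / 4)\<close>, so there
  are fewer than \<open>B1_inv\<close> of them, and the linear forms remain independent on the other coordinates.
\<close>

subsection \<open>Mixed differences and polynomial degree\<close>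

text \<open>Taking l - 1 differences makes the degrees below l constant but not those above, which
  must therefore be approximated beforehand: hence the descent from the top degree. A degree j term
  with error P^(\<theta> - j) has slope P^(\<theta> - 1), so it moves by O(1) along P^(1 -
  \<theta>); this fixes the block size. The exponents come from one balance. Up to small powers of
  P, a large sum forces a proportion P^(- 2^(l-1) Q) of the tuples of size P^\<eta> to have small
  distances, while only a proportion P^(- \<eta> g) is singular; so \<eta> g must exceed 2^(l-1) Q.
  A minor of order r_l then has size P^(\<eta> (l-1) r_l), which for the critical \<eta> is P^(Q
  \<gamma>_l): this is the origin of \<gamma>_l. Iterating 4 \<theta> + Q \<gamma>_l from \<theta> =
  0 at degree d + 1 down to degree 2 produces Q times the sum of the 4^(j-2) \<gamma>_j, the sum in
  the hypotheses. They keep the result below \<Delta> / 8, and degree one, which replaces \<theta>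
  by slightly more than 2 \<theta> + \<Delta> / 4, stays below \<Delta>.\<close>

definition mixed_diff :: "'k set \<Rightarrow> ('k \<Rightarrow> 'a::ab_group_add) \<Rightarrow> ('a \<Rightarrow> 'b::comm_ring_1) \<Rightarrow> 'a \<Rightarrow> 'b" where
  "mixed_diff I h f x = (\<Sum>T\<in>Pow I. (-1) ^ card T * f (x + sum h T))"

lemma mixed_diff_empty [simp]: "mixed_diff {} h f = f"
  by (simp add: mixed_diff_def fun_eq_iff)

lemma mixed_diff_cong:
  assumes "\<And>k. k \<in> I \<Longrightarrow> h k = h' k"
  shows "mixed_diff I h f = mixed_diff I h' f"
proof -
  have "sum h T = sum h' T" if "T \<subseteq> I" for T
    using assms that by (intro sum.cong) auto
  then show ?thesis by (simp add: mixed_diff_def fun_eq_iff)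
qed

lemma sum_Pow_insert:
  assumes "finite I" "k \<notin> I"
  shows "(\<Sum>T\<in>Pow (insert k I). g T) = (\<Sum>T\<in>Pow I. g T) + (\<Sum>T\<in>Pow I. g (insert k T))"
proof -
  have "inj_on (insert k) (Pow I)" using assms(2) by (auto simp: inj_on_def)
  moreover have "Pow I \<inter> insert k ` Pow I = {}" using assms(2) by auto
  ultimately show ?thesis
    using assms(1) by (simp add: Pow_insert sum.union_disjoint sum.reindex)
qed

lemma mixed_diff_insert:
  assumes "finite I" "k \<notin> I"
  shows "mixed_diff (insert k I) h f x = mixed_diff I h f x - mixed_diff I h f (x + h k)"
proof -
  have "(-1) ^ card (insert k T) * f (x + sum h (insert k T))
      = - ((-1) ^ card T * f (x + h k + sum h T))" if "T \<in> Pow I" for T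
  proof -
    have "finite T" "k \<notin> T" using that assms by (auto intro: finite_subset)
    then show ?thesis by (simp add: add.assoc)
  qed
  then show ?thesis using assms by (simp add: mixed_diff_def sum_Pow_insert sum_negf)
qed

lemma mixed_diff_insert':
  assumes "finite I" "k \<notin> I"
  shows "mixed_diff (insert k I) h f = mixed_diff I h (\<lambda>x. f x - f (x + h k))"
  using mixed_diff_insert[OF assms, of h f]
  by (simp add: mixed_diff_def fun_eq_iff sum_subtractf algebra_simps)

lemma mixed_diff_sum:
  "mixed_diff I h (\<lambda>x. \<Sum>j\<in>J. f j x) x = (\<Sum>j\<in>J. mixed_diff I h (f j) x)"
  unfolding mixed_diff_def sum_distrib_left by (rule sum.swap)

lemma mixed_diff_mult: "mixed_diff I h (\<lambda>x. c * f x) x = c * mixed_diff I h f x"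
  by (simp add: mixed_diff_def sum_distrib_left algebra_simps)

lemma mixed_diff_diff: "mixed_diff I h (\<lambda>x. f x - g x) x = mixed_diff I h f x - mixed_diff I h g x"
  by (simp add: mixed_diff_def sum_subtractf algebra_simps)

lemma mixed_diff_of_int:
  "mixed_diff I h (\<lambda>x. of_int (f x)) x = of_int (mixed_diff I h f x)"
  by (simp add: mixed_diff_def)

text \<open>Both sides expand into the same four terms. This is the source of the symmetric matrices
  on which the contraction rests.\<close>

lemma mixed_diff_swap:
  assumes "finite I" "k \<notin> I" "l \<notin> I" "k \<noteq> l"
  shows "mixed_diff (insert k (insert l I)) (h(k := a, l := b)) f x
       = mixed_diff (insert k (insert l I)) (h(k := b, l := a)) f x"
proof -
  have "mixed_diff I (h(k := c, l := e)) f = mixed_diff I h f" for c e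
    using assms by (intro mixed_diff_cong) auto
  then show ?thesis using assms by (simp add: mixed_diff_insert algebra_simps)
qed

text \<open>Frechet's notion of degree: all (k + 1)-fold differences vanish. It makes sense for maps
  between abelian groups without any coefficients, and lowering the degree by differencing holds by
  definition.\<close>

primrec poly_deg_le :: "nat \<Rightarrow> ('a::ab_group_add \<Rightarrow> 'b::comm_ring_1) \<Rightarrow> bool" where
  "poly_deg_le 0 f \<longleftrightarrow> (\<forall>x y. f x = f y)"
| "poly_deg_le (Suc k) f \<longleftrightarrow> (\<forall>h. poly_deg_le k (\<lambda>x. f x - f (x + h)))"

lemma poly_deg_le_0_eq: "poly_deg_le 0 f \<Longrightarrow> f x = f y" by simp

lemma poly_deg_le_const [simp]: "poly_deg_le k (\<lambda>x. c)"
  by (induction k arbitrary: c) auto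

lemma poly_deg_le_shift: "poly_deg_le k f \<Longrightarrow> poly_deg_le k (\<lambda>x. f (x + a))"
proof (induction k arbitrary: f)
  case (Suc k)
  show ?case unfolding poly_deg_le.simps
  proof
    fix h
    from Suc.prems have "poly_deg_le k (\<lambda>x. f x - f (x + h))" by simp
    from Suc.IH[OF this] show "poly_deg_le k (\<lambda>x. f (x + a) - f (x + h + a))"
      by (simp add: algebra_simps)
  qed
qed simp

lemma poly_deg_le_Suc: "poly_deg_le k f \<Longrightarrow> poly_deg_le (Suc k) f"
proof (induction k arbitrary: f)
  case 0
  then have "f x - f (x + h) = 0" for x h using poly_deg_le_0_eq[of f x "x + h"] by (simp del: poly_deg_le.simps)
  then show ?case by simp
next
  case (Suc k)
  then show ?case unfolding poly_deg_le.simps(2)[of "Suc k"] poly_deg_le.simps(2)[of k] by blast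
qed

lemma poly_deg_le_mono:
  assumes "poly_deg_le k f" "k \<le> l"
  shows "poly_deg_le l f"
  using assms(2,1) by (induction l rule: dec_induct) (blast intro: poly_deg_le_Suc)+

lemma poly_deg_le_add: "poly_deg_le k f \<Longrightarrow> poly_deg_le k g \<Longrightarrow> poly_deg_le k (\<lambda>x. f x + g x)"
proof (induction k arbitrary: f g)
  case 0
  then have "f x = f y" "g x = g y" for x y by (auto dest: poly_deg_le_0_eq simp del: poly_deg_le.simps)
  then show ?case by simp metis
next
  case (Suc k)
  show ?case unfolding poly_deg_le.simps
  proof
    fix h
    have "poly_deg_le k (\<lambda>x. (f x - f (x + h)) + (g x - g (x + h)))"
      using Suc by (intro Suc.IH) auto
    then show "poly_deg_le k (\<lambda>x. f x + g x - (f (x + h) + g (x + h)))"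
      by (simp add: algebra_simps)
  qed
qed

lemma poly_deg_le_sum:
  "(\<And>j. j \<in> J \<Longrightarrow> poly_deg_le k (f j)) \<Longrightarrow> poly_deg_le k (\<lambda>x. \<Sum>j\<in>J. f j x)"
proof (induction J rule: infinite_finite_induct)
  case (insert j J)
  then show ?case by (simp add: poly_deg_le_add)
qed simp_all

text \<open>The discrete product rule writes the difference of f * g as (f x - f (x + h)) * g (x +
  h) + f x * (g x - g (x + h)). Either factor may be the one whose degree drops, hence the induction
  on a + b; a factor of degree 0 has difference 0.\<close>

lemma poly_deg_le_mult:
  "poly_deg_le a f \<Longrightarrow> poly_deg_le b g \<Longrightarrow> poly_deg_le (a + b) (\<lambda>x. f x * g x)"
proof (induction "a + b" arbitrary: a b f g)
  case 0
  then have ab: "a = 0" "b = 0" by auto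
  then have "f x = f y" "g x = g y" for x y using 0 by (auto dest: poly_deg_le_0_eq simp del: poly_deg_le.simps)
  then show ?case unfolding ab by simp metis
next
  case (Suc m)
  have "poly_deg_le m (\<lambda>x. f x * g x - f (x + h) * g (x + h))" for h
  proof -
    have 1: "poly_deg_le m (\<lambda>x. (f x - f (x + h)) * g (x + h))"
    proof (cases a)
      case 0
      then have "f x - f (x + h) = 0" for x using Suc.prems(1) poly_deg_le_0_eq[of f x "x + h"] by (simp del: poly_deg_le.simps)
      then show ?thesis by simp
    next
      case (Suc a')
      have "m = a' + b" using Suc Suc.hyps(2) by simp
      moreover have "poly_deg_le a' (\<lambda>x. f x - f (x + h))" using Suc Suc.prems(1) by simp
      moreover have "poly_deg_le b (\<lambda>x. g (x + h))" using Suc.prems(2) by (rule poly_deg_le_shift)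
      ultimately show ?thesis using Suc.hyps(1)[of a' b "\<lambda>x. f x - f (x + h)" "\<lambda>x. g (x + h)"] by blast
    qed
    have 2: "poly_deg_le m (\<lambda>x. f x * (g x - g (x + h)))"
    proof (cases b)
      case 0
      then have "g x - g (x + h) = 0" for x using Suc.prems(2) poly_deg_le_0_eq[of g x "x + h"] by (simp del: poly_deg_le.simps)
      then show ?thesis by simp
    next
      case (Suc b')
      have "m = a + b'" using Suc Suc.hyps(2) by simp
      moreover have "poly_deg_le b' (\<lambda>x. g x - g (x + h))" using Suc Suc.prems(2) by simp
      ultimately show ?thesis using Suc.prems(1) Suc.hyps(1)[of a b' f "\<lambda>x. g x - g (x + h)"] by blast
    qed
    have "(\<lambda>x. f x * g x - f (x + h) * g (x + h))
        = (\<lambda>x. (f x - f (x + h)) * g (x + h) + f x * (g x - g (x + h)))"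
      by (simp add: algebra_simps)
    then show ?thesis using poly_deg_le_add[OF 1 2] by simp
  qed
  then show ?case unfolding Suc.hyps(2)[symmetric] poly_deg_le.simps by blast
qed

lemma poly_deg_le_power: "poly_deg_le a f \<Longrightarrow> poly_deg_le (k * a) (\<lambda>x. f x ^ k)"
  by (induction k) (auto intro: poly_deg_le_mult)

lemma poly_deg_le_prod:
  assumes "finite J" "\<And>j. j \<in> J \<Longrightarrow> poly_deg_le (a j) (f j)"
  shows "poly_deg_le (\<Sum>j\<in>J. a j) (\<lambda>x. \<Prod>j\<in>J. f j x)"
  using assms
proof (induction J)
  case (insert j J)
  then show ?case by (simp add: poly_deg_le_mult)
qed simp

lemma poly_deg_le_mixed_diff:
  assumes "finite I" "poly_deg_le (card I + k) f"
  shows "poly_deg_le k (mixed_diff I h f)"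
  using assms
proof (induction I arbitrary: f)
  case (insert i I)
  then show ?case by (simp add: mixed_diff_insert')
qed simp

lemma poly_deg_le_coord: "poly_deg_le 1 (\<lambda>x::int^'n::finite. x $ i)"
  by simp

lemma additive_expand:
  fixes f :: "int ^ 'n::finite \<Rightarrow> 'b::ring_1"
  assumes add: "\<And>x y. f (x + y) = f x + f y"
  shows "f x = (\<Sum>i\<in>UNIV. of_int (x $ i) * f (axis i 1))"
proof -
  have zero: "f 0 = 0" using add[of 0 0] by simp
  have minus: "f (- y) = - f y" for y
    using add[of y "- y"] zero by (simp add: add_eq_0_iff)
  have nat: "f (of_nat k *s y) = of_nat k * f y" for k y
    by (induction k) (simp_all add: zero vector_sadd_rdistrib add algebra_simps)
  have int: "f (c *s y) = of_int c * f y" for c y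
  proof (cases c)
    case (nonneg k) then show ?thesis using nat[of k] by simp
  next
    case (neg k)
    have "c *s y = - (of_nat (Suc k) *s y)" unfolding neg by (simp add: vec_eq_iff)
    then show ?thesis using nat[of "Suc k" y] neg minus by (metis mult_minus_left of_int_minus of_int_of_nat_eq)
  qed
  have sum: "f (sum g S) = (\<Sum>i\<in>S. f (g i))" if "finite S" for S :: "'n set" and g
    using that by induction (simp_all add: zero add)
  have "f x = f (\<Sum>i\<in>UNIV. (x $ i) *s axis i 1)" by (simp add: basis_expansion)
  also have "\<dots> = (\<Sum>i\<in>UNIV. of_int (x $ i) * f (axis i 1))" by (subst sum) (simp_all add: int)
  finally show ?thesis .
qed

text \<open>In degree one g x - g (x + h) does not depend on x, so g 0 - g is additive and therefore
  linear over the integers.\<close>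

lemma poly_deg_le_1_affine:
  fixes g :: "int ^ 'n::finite \<Rightarrow> 'b::comm_ring_1"
  assumes "poly_deg_le 1 g"
  shows "g x = g 0 - (\<Sum>i\<in>UNIV. of_int (x $ i) * (g 0 - g (axis i 1)))"
proof -
  have c: "g x - g (x + h) = g 0 - g h" for x h
    using assms[unfolded One_nat_def poly_deg_le.simps] by (metis add_0)
  have "g 0 - g (x + y) = (g 0 - g x) + (g 0 - g y)" for x y using c[of x y] by (simp add: algebra_simps)
  from additive_expand[of "\<lambda>x. g 0 - g x", OF this] have "g 0 - g x = (\<Sum>i\<in>UNIV. of_int (x $ i) * (g 0 - g (axis i 1)))" .
  then show ?thesis by (simp add: algebra_simps)
qed

text \<open>Differencing in the other directions leaves degree at most one; its differences do not
  depend on the base point, so the step by a + b splits into a step by a and a step by b.\<close>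

lemma mixed_diff_additive:
  fixes f :: "'a::ab_group_add \<Rightarrow> 'b::comm_ring_1"
  assumes "finite I" "k \<in> I" "poly_deg_le (card I) f"
  shows "mixed_diff I (h(k := a + b)) f x = mixed_diff I (h(k := a)) f x + mixed_diff I (h(k := b)) f x"
proof -
  define J where "J = I - {k}"
  have I: "I = insert k J" "finite J" "k \<notin> J" "card I = card J + 1"
    using assms card_Suc_Diff1[of I k] by (auto simp: J_def simp del: card_Diff_insert)
  have J: "mixed_diff J (h(k := c)) f = mixed_diff J h f" for c
    by (rule mixed_diff_cong) (auto simp: J_def)
  define g where "g = mixed_diff J h f"
  have "poly_deg_le 1 g" unfolding g_def using I assms(3) by (intro poly_deg_le_mixed_diff) auto
  then have c: "g x - g (x + h) = g y - g (y + h)" for x y h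
    unfolding One_nat_def poly_deg_le.simps by blast
  show ?thesis unfolding I(1) using I(2,3) J c[of x b "x + a"]
    by (simp add: mixed_diff_insert g_def[symmetric] algebra_simps)
qed

lemma mixed_diff_const_x:
  assumes "finite I" "poly_deg_le (card I) f"
  shows "mixed_diff I h f x = mixed_diff I h f y"
  using poly_deg_le_mixed_diff[of I 0 f h] assms by (auto intro: poly_deg_le_0_eq)

lemma mixed_diff_eq_0:
  assumes "finite I" "poly_deg_le k f" "k < card I"
  shows "mixed_diff I h f x = 0"
proof -
  obtain i where i: "i \<in> I" using assms(3) by fastforce
  define J where "J = I - {i}"
  have I: "I = insert i J" "finite J" "i \<notin> J" "card I = card J + 1"
    using assms i card_Suc_Diff1[of I i] by (auto simp: J_def simp del: card_Diff_insert)
  have "poly_deg_le (card J) f" by (rule poly_deg_le_mono[OF assms(2)]) (use I assms in auto)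
  then show ?thesis unfolding I(1) using I(2,3) by (simp add: mixed_diff_insert mixed_diff_const_x[of J f h x "x + h i"])
qed

subsection \<open>Integer polynomials\<close>

lemma mpoly_eval_of_int:
  "mpoly_eval p (\<chi> i. of_int (x $ i)) = (of_int (mpoly_eval p x) :: 'a::comm_ring_1)"
  by (simp add: mpoly_eval_def)

lemma mon_degree_le_mpoly_degree: "m \<in> Poly_Mapping.keys p \<Longrightarrow> mon_degree m \<le> mpoly_degree p"
  by (simp add: mpoly_degree_def)

lemma poly_deg_le_monomial:
  "poly_deg_le (mon_degree m)
     (\<lambda>x::int^'n::finite. of_int c * (\<Prod>i\<in>UNIV. (x $ i) ^ Poly_Mapping.lookup m i))"
proof -
  have "poly_deg_le (Poly_Mapping.lookup m i * 1) (\<lambda>x::int^'n. (x $ i) ^ Poly_Mapping.lookup m i)" for i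
    by (intro poly_deg_le_power poly_deg_le_coord)
  then have "poly_deg_le (mon_degree m) (\<lambda>x::int^'n. \<Prod>i\<in>UNIV. (x $ i) ^ Poly_Mapping.lookup m i)"
    unfolding mon_degree_def by (intro poly_deg_le_prod) auto
  from poly_deg_le_mult[OF poly_deg_le_const[of 0 "of_int c"] this] show ?thesis by simp
qed

lemma poly_deg_le_mpoly_eval:
  fixes p :: "'n::finite int_mpoly"
  shows "poly_deg_le (mpoly_degree p) (mpoly_eval p :: int ^ 'n \<Rightarrow> int)"
proof -
  have "poly_deg_le (mpoly_degree p) (\<lambda>x::int^'n. mpoly_eval p x)"
    unfolding mpoly_eval_def
    by (intro poly_deg_le_sum poly_deg_le_mono[OF poly_deg_le_monomial]) (rule mon_degree_le_mpoly_degree)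
  then show ?thesis by simp
qed

lemma lookup_hom_part:
  "Poly_Mapping.lookup (hom_part l p) m = (if mon_degree m = l then Poly_Mapping.lookup p m else 0)"
proof -
  have "Poly_Mapping.lookup (hom_part l p) m
      = (\<Sum>k | k \<in> Poly_Mapping.keys p \<and> mon_degree k = l. if k = m then Poly_Mapping.lookup p k else 0)"
    by (simp add: hom_part_def lookup_sum lookup_single when_def)
  also have "\<dots> = (if mon_degree m = l then Poly_Mapping.lookup p m else 0)"
    by (simp add: sum.delta in_keys_iff)
  finally show ?thesis .
qed

lemma keys_hom_part: "Poly_Mapping.keys (hom_part l p) = {m \<in> Poly_Mapping.keys p. mon_degree m = l}"
  by (auto simp: in_keys_iff lookup_hom_part split: if_splits)

lemma mpoly_eval_hom_part:
  "mpoly_eval (hom_part l p) x = (\<Sum>m | m \<in> Poly_Mapping.keys p \<and> mon_degree m = l.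
     of_int (Poly_Mapping.lookup p m) * (\<Prod>i\<in>UNIV. (x $ i) ^ Poly_Mapping.lookup m i))"
  by (simp add: mpoly_eval_def keys_hom_part lookup_hom_part cong: sum.cong_simp)

lemma poly_deg_le_minus_hom_part:
  fixes p :: "'n::finite int_mpoly"
  assumes "mpoly_degree p \<le> Suc l"
  shows "poly_deg_le l (\<lambda>x::int^'n. (mpoly_eval p x - mpoly_eval (hom_part (Suc l) p) x :: int))"
proof -
  define K where "K = Poly_Mapping.keys p"
  define g :: "_ \<Rightarrow> int^'n \<Rightarrow> int" where "g m x = of_int (Poly_Mapping.lookup p m) * (\<Prod>i\<in>UNIV. (x $ i) ^ Poly_Mapping.lookup m i)" for m x
  have "mpoly_eval p x - mpoly_eval (hom_part (Suc l) p) x = (\<Sum>m\<in>K - {m \<in> K. mon_degree m = Suc l}. g m x)" for x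
    by (subst sum_diff) (auto simp: mpoly_eval_hom_part mpoly_eval_def[of p] g_def K_def)
  moreover have "poly_deg_le l (\<lambda>x. \<Sum>m\<in>K - {m \<in> K. mon_degree m = Suc l}. g m x)"
    unfolding g_def
  proof (intro poly_deg_le_sum poly_deg_le_mono[OF poly_deg_le_monomial])
    fix m assume "m \<in> K - {m \<in> K. mon_degree m = Suc l}"
    then show "mon_degree m \<le> l" using mon_degree_le_mpoly_degree[of m p] assms by (auto simp: K_def)
  qed
  ultimately show ?thesis by simp
qed

text \<open>The polynomial and its leading form differ by degree at most l - 1, which l differences
  annihilate. Thus the polarised leading forms are mixed differences of the polynomials
  themselves.\<close>

lemma mixed_diff_hom_part:
  fixes p :: "'n::finite int_mpoly" and h :: "nat \<Rightarrow> int ^ 'n"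
  assumes "mpoly_degree p = l" "1 \<le> l"
  shows "(mixed_diff {1..l} h (mpoly_eval (hom_part l p)) x :: int) = mixed_diff {1..l} h (mpoly_eval p) x"
proof -
  have "mixed_diff {1..l} h (\<lambda>x. mpoly_eval p x - mpoly_eval (hom_part l p) x) x = (0::int)"
    using poly_deg_le_minus_hom_part[of p "l - 1"] assms by (intro mixed_diff_eq_0[where k = "l - 1"]) auto
  then show ?thesis by (simp add: mixed_diff_diff)
qed

lemma dvd_mpoly_eval_diff:
  fixes x t :: "int ^ 'n::finite"
  shows "q dvd mpoly_eval p (x + q *s t) - (mpoly_eval p x :: int)"
proof -
  have "[mpoly_eval p (x + q *s t) = (mpoly_eval p x :: int)] (mod q)"
    unfolding mpoly_eval_def by (intro cong_sum cong_mult cong_prod cong_pow) (auto simp: cong_def)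
  then show ?thesis by (simp add: cong_iff_dvd_diff)
qed

text \<open>Integer polynomials respect congruences modulo q. Along a progression of step q the
  increments of the higher degree parts are thus divisible by q, which is what makes an
  approximation of q * \<alpha> useful.\<close>

lemma dvd_mixed_diff:
  fixes x t :: "int ^ 'n::finite"
  shows "q dvd mixed_diff I h (mpoly_eval p) (x + q *s t) - (mixed_diff I h (mpoly_eval p) x :: int)"
proof -
  have "q dvd (-1) ^ card T * (mpoly_eval p (x + q *s t + sum h T) - (mpoly_eval p (x + sum h T) :: int))" for T
    using dvd_mpoly_eval_diff[of q p "x + sum h T" t] by (simp add: add.commute add.left_commute)
  then show ?thesis
    unfolding mixed_diff_def sum_subtractf[symmetric] right_diff_distrib[symmetric] by (intro dvd_sum) auto
qed

definition cvec :: "int ^ 'n \<Rightarrow> complex ^ 'n::finite" where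
  "cvec x = (\<chi> i. of_int (x $ i))"

lemma inj_cvec: "inj cvec"
  by (auto simp: inj_def cvec_def vec_eq_iff)

lemma cvec_axis: "cvec (axis i 1) = axis i 1"
  by (simp add: cvec_def axis_def vec_eq_iff)

lemma cvec_sum: "cvec (sum h T) = (\<Sum>k\<in>T. cvec (h k))"
  by (induction T rule: infinite_finite_induct) (auto simp: cvec_def vec_eq_iff)

lemma Gam_eq_mixed_diff:
  fixes h :: "nat \<Rightarrow> int ^ 'n::finite"
  assumes "\<And>k. k \<in> {1..l} \<Longrightarrow> x k = cvec (h k)"
  shows "Gam l (mpoly_eval p) x = of_int (mixed_diff {1..l} h (mpoly_eval p) 0)"
proof -
  define \<tau> :: "nat set \<Rightarrow> nat \<Rightarrow> nat" where "\<tau> T = (\<lambda>k\<in>{1..l}. if k \<in> T then 1 else 0)" for T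
  have bij: "bij_betw \<tau> (Pow {1..l}) ({1..l} \<rightarrow>\<^sub>E {0, 1})"
  proof (rule bij_betwI[where g = "\<lambda>t. {k\<in>{1..l}. t k = 1}"])
    show "\<tau> \<in> Pow {1..l} \<rightarrow> ({1..l} \<rightarrow>\<^sub>E {0, 1})" by (auto simp: \<tau>_def)
    show "\<tau> {k \<in> {1..l}. t k = 1} = t" if "t \<in> {1..l} \<rightarrow>\<^sub>E {0, 1}" for t
      using that by (auto simp: \<tau>_def fun_eq_iff PiE_iff extensional_def)
  qed (auto simp: \<tau>_def split: if_splits)
  have "Gam l (mpoly_eval p) x = (\<Sum>T\<in>Pow {1..l}. (-1) ^ (\<Sum>k=1..l. \<tau> T k) *
      mpoly_eval p (\<Sum>k=1..l. of_nat (\<tau> T k) *s x k))"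
    unfolding Gam_def by (rule sum.reindex_bij_betw[OF bij, symmetric])
  also have "\<dots> = (\<Sum>T\<in>Pow {1..l}. of_int ((-1) ^ card T * mpoly_eval p (0 + sum h T)))"
  proof (rule sum.cong[OF refl])
    fix T assume T: "T \<in> Pow {1..l}"
    have "(\<Sum>k=1..l. \<tau> T k) = (\<Sum>k\<in>{1..l}. if k \<in> T then 1 else 0)" by (simp add: \<tau>_def)
    also have "\<dots> = card T" using T by (simp add: sum.If_cases Int_absorb1)
    finally have 1: "(\<Sum>k=1..l. \<tau> T k) = card T" .
    have "(\<Sum>k=1..l. of_nat (\<tau> T k) *s x k) = (\<Sum>k\<in>{1..l}. if k \<in> T then x k else 0)"
      by (intro sum.cong) (auto simp: \<tau>_def)
    also have "\<dots> = (\<Sum>k\<in>T. x k)" using T by (simp add: sum.If_cases Int_absorb1)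
    also have "\<dots> = cvec (sum h T)" unfolding cvec_sum using T assms by (intro sum.cong) auto
    finally show "(-1) ^ (\<Sum>k=1..l. \<tau> T k) * mpoly_eval p (\<Sum>k=1..l. of_nat (\<tau> T k) *s x k)
        = complex_of_int ((-1) ^ card T * mpoly_eval p (0 + sum h T))"
      unfolding 1 by (simp add: cvec_def mpoly_eval_of_int del: sum_component)
  qed
  finally show ?thesis by (simp add: mixed_diff_def)
qed

subsection \<open>Weyl differencing\<close>

lemma sum_PiE_insert:
  assumes "k \<notin> I"
  shows "(\<Sum>h\<in>PiE (insert k I) B. g h) = (\<Sum>h\<in>PiE I B. \<Sum>y\<in>B k. g (h(k := y)))"
proof -
  have "(\<Sum>h\<in>PiE (insert k I) B. g h) = (\<Sum>(y, h)\<in>B k \<times> PiE I B. g (h(k := y)))"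
    unfolding PiE_insert_eq using inj_combinator[OF assms, of B]
    by (subst sum.reindex) (simp_all add: case_prod_beta o_def)
  also have "\<dots> = (\<Sum>y\<in>B k. \<Sum>h\<in>PiE I B. g (h(k := y)))" by (rule sum.cartesian_product[symmetric])
  also have "\<dots> = (\<Sum>h\<in>PiE I B. \<Sum>y\<in>B k. g (h(k := y)))" by (rule sum.swap)
  finally show ?thesis .
qed

lemma vec_set_eq_image: "{x::'a^'n::finite. \<forall>i. x $ i \<in> X i} = vec_lambda ` PiE UNIV X"
proof -
  have "x \<in> vec_lambda ` PiE UNIV X" if "\<forall>i. x $ i \<in> X i" for x
    using that by (intro image_eqI[of _ _ "vec_nth x"]) auto
  then show ?thesis by auto
qed

lemma finite_vec_set: "(\<And>i. finite (X i)) \<Longrightarrow> finite {x::'a^'n::finite. \<forall>i. x $ i \<in> X i}"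
  unfolding vec_set_eq_image by (intro finite_imageI finite_PiE) auto

lemma sum_vec_set_prod:
  fixes f :: "'n::finite \<Rightarrow> 'a \<Rightarrow> 'b::comm_semiring_1"
  assumes "\<And>i. finite (X i)"
  shows "(\<Sum>x | \<forall>i. x $ i \<in> X i. \<Prod>i\<in>UNIV. f i (x $ i)) = (\<Prod>i\<in>UNIV. \<Sum>t\<in>X i. f i t)"
proof -
  have "inj_on vec_lambda (PiE UNIV X)" by (rule inj_onI) (metis vec_lambda_inverse UNIV_I)
  then show ?thesis unfolding vec_set_eq_image using assms
    by (simp add: sum.reindex prod_sum_PiE)
qed

lemma card_vec_set:
  assumes "\<And>i. finite (X i)"
  shows "card {x::'a^'n::finite. \<forall>i. x $ i \<in> X i} = (\<Prod>i\<in>UNIV. card (X i))"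
  using sum_vec_set_prod[OF assms, of "\<lambda>i t. 1::nat"] by simp

lemma box_eq_vec_set: "{a..b} = {x::int^'n::finite. \<forall>i. x $ i \<in> {a $ i..b $ i}}"
  by (auto simp: less_eq_vec_def)

lemma finite_box_int [simp]: "finite {a..b::int^'n::finite}"
  unfolding box_eq_vec_set by (rule finite_vec_set) simp

lemma e_fun_0 [simp]: "e_fun 0 = 1" by (simp add: e_fun_def)

lemma e_fun_add: "e_fun (x + y) = e_fun x * e_fun y"
  by (simp add: e_fun_def distrib_left exp_add)

lemma e_fun_sum: "finite J \<Longrightarrow> e_fun (\<Sum>j\<in>J. f j) = (\<Prod>j\<in>J. e_fun (f j))"
  by (induction J rule: finite_induct) (simp_all add: e_fun_add)

lemma e_fun_cis: "e_fun x = cis (2 * pi * x)"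
  by (simp add: e_fun_def cis_conv_exp mult_ac)

lemma norm_e_fun [simp]: "norm (e_fun x) = 1" by (simp add: e_fun_cis)

lemma cnj_e_fun: "cnj (e_fun x) = e_fun (- x)" by (simp add: e_fun_cis cis_cnj)

lemma e_fun_int [simp]: "e_fun (of_int k) = 1"
  by (metis cis_multiple_2pi e_fun_cis Ints_of_int mult.commute)

lemma e_fun_cong_int: "x - y \<in> \<int> \<Longrightarrow> e_fun x = e_fun y"
  by (metis Ints_cases add.commute diff_add_cancel e_fun_add e_fun_int mult_1)

text \<open>Opening the square and substituting y = x + h groups the pairs by their difference.
  \<open>H\<close> may be any finite set containing the differences, so that one cube can serve for
  all the boxes met in the iteration.\<close>

lemma weyl_step:
  fixes F :: "'a::ab_group_add \<Rightarrow> real"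
  assumes "finite B" "finite H" "\<And>x y. x \<in> B \<Longrightarrow> y \<in> B \<Longrightarrow> y - x \<in> H"
  shows "(norm (\<Sum>x\<in>B. e_fun (F x)))\<^sup>2
    \<le> (\<Sum>h\<in>H. norm (\<Sum>x | x \<in> B \<and> x + h \<in> B. e_fun (F x - F (x + h))))"
proof -
  let ?S = "\<Sum>x\<in>B. e_fun (F x)"
  have re: "(\<Sum>y\<in>B. g y) = (\<Sum>h | h \<in> H \<and> x + h \<in> B. g (x + h))" if "x \<in> B" for g :: "'a \<Rightarrow> complex" and x
    by (rule sum.reindex_bij_witness[of _ "\<lambda>h. x + h" "\<lambda>y. y - x"]) (use that assms(3) in auto)
  have "complex_of_real ((norm ?S)\<^sup>2) = ?S * cnj ?S" by (rule complex_norm_square)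
  also have "\<dots> = (\<Sum>x\<in>B. \<Sum>y\<in>B. e_fun (F x - F y))"
    by (simp add: sum_product cnj_e_fun flip: e_fun_add)
  also have "\<dots> = (\<Sum>x\<in>B. \<Sum>h | h \<in> H \<and> x + h \<in> B. e_fun (F x - F (x + h)))"
    by (rule sum.cong[OF refl], rule re)
  also have "\<dots> = (\<Sum>x\<in>B. \<Sum>h\<in>H. if x + h \<in> B then e_fun (F x - F (x + h)) else 0)"
    by (rule sum.cong[OF refl]) (rule sum.inter_filter[OF assms(2)])
  also have "\<dots> = (\<Sum>h\<in>H. \<Sum>x\<in>B. if x + h \<in> B then e_fun (F x - F (x + h)) else 0)" by (rule sum.swap)
  also have "\<dots> = (\<Sum>h\<in>H. \<Sum>x | x \<in> B \<and> x + h \<in> B. e_fun (F x - F (x + h)))"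
    by (rule sum.cong[OF refl]) (rule sum.inter_filter[OF assms(1), symmetric])
  finally have "(norm ?S)\<^sup>2 = norm (\<Sum>h\<in>H. \<Sum>x | x \<in> B \<and> x + h \<in> B. e_fun (F x - F (x + h)))"
    by (metis norm_of_real abs_power2 power2_abs)
  then show ?thesis by (simp add: norm_sum)
qed

text \<open>The power mean inequality for the exponent 2^c, by c applications of Cauchy-Schwarz. For
  \<open>card H = 0\<close> both sides are 0, since division by zero yields 0.\<close>

lemma mean_power_le:
  fixes a :: "'a \<Rightarrow> real"
  assumes "\<And>y. y \<in> H \<Longrightarrow> 0 \<le> a y"
  shows "((\<Sum>y\<in>H. a y) / card H) ^ (2 ^ c) \<le> (\<Sum>y\<in>H. a y ^ (2 ^ c)) / card H"
proof (induction c)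
  case (Suc c)
  define b where "b y = a y ^ (2 ^ c)" for y
  have "((\<Sum>y\<in>H. a y) / card H) ^ (2 ^ Suc c) = (((\<Sum>y\<in>H. a y) / card H) ^ (2 ^ c))\<^sup>2"
    by (simp add: mult.commute flip: power_mult)
  also have "\<dots> \<le> ((\<Sum>y\<in>H. b y) / card H)\<^sup>2"
    using Suc assms unfolding b_def by (intro power_mono zero_le_power divide_nonneg_nonneg sum_nonneg) auto
  also have "\<dots> \<le> (\<Sum>y\<in>H. (b y)\<^sup>2) / card H"
  proof (cases "card H = 0")
    case False
    have "(\<Sum>y\<in>H. b y * 1)\<^sup>2 \<le> (\<Sum>y\<in>H. (b y)\<^sup>2) * (\<Sum>y\<in>H. 1\<^sup>2)" by (rule Cauchy_Schwarz_ineq_sum)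
    then have "(\<Sum>y\<in>H. b y)\<^sup>2 / (real (card H))\<^sup>2 \<le> (\<Sum>y\<in>H. (b y)\<^sup>2) * card H / (real (card H))\<^sup>2"
      by (intro divide_right_mono) auto
    then show ?thesis using False by (simp add: power_divide power2_eq_square)
  qed simp
  also have "(\<Sum>y\<in>H. (b y)\<^sup>2) = (\<Sum>y\<in>H. a y ^ (2 ^ Suc c))"
    by (simp add: b_def power_mult mult.commute flip: power_mult)
  finally show ?case .
qed simp

text \<open>Dividing by \<open>card H\<close> turns each squaring step into a statement about means,
  so the induction closes without stray powers of \<open>card H\<close>. The range of x shrinks with
  every difference, in a way that depends on h; hence \<open>M h\<close> is required to bound the
  sums over all boxes inside {a..b}.\<close>

lemma weyl_differencing:
  fixes F :: "int ^ 'n::finite \<Rightarrow> real" and H :: "(int ^ 'n) set"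
  assumes "finite I" "finite H"
    and "\<And>x y. x \<in> {a..b} \<Longrightarrow> y \<in> {a..b} \<Longrightarrow> y - x \<in> H"
    and "\<And>h a' b'. h \<in> I \<rightarrow>\<^sub>E H \<Longrightarrow> {a'..b'} \<subseteq> {a..b} \<Longrightarrow>
      norm (\<Sum>x\<in>{a'..b'}. e_fun (mixed_diff I h F x)) \<le> M h"
  shows "(norm (\<Sum>x\<in>{a..b}. e_fun (F x)) / card H) ^ (2 ^ card I)
    \<le> (\<Sum>h\<in>I \<rightarrow>\<^sub>E H. M h) / real (card H) ^ (card I + 1)"
  using assms(1,3,4)
proof (induction I arbitrary: F M a b)
  case empty
  then show ?case by (simp add: divide_right_mono)
next
  case (insert k I)
  define S where "S y = norm (\<Sum>x | x \<in> {a..b} \<and> x + y \<in> {a..b}. e_fun (F x - F (x + y)))" for y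
  define c where "c = card I"
  have step: "(S y / card H) ^ (2 ^ c) \<le> (\<Sum>h\<in>I \<rightarrow>\<^sub>E H. M (h(k := y))) / real (card H) ^ (c + 1)" if y: "y \<in> H" for y
  proof -
    \<comment> \<open>The intersection of a box with its translate by - y is again a box, so the
      induction hypothesis applies to it.\<close>
    define a1 b1 where "a1 = (\<chi> i. max (a $ i) (a $ i - y $ i))" and "b1 = (\<chi> i. min (b $ i) (b $ i - y $ i))"
    have "x \<in> {a..b} \<and> x + y \<in> {a..b} \<longleftrightarrow> x \<in> {a1..b1}" for x
    proof -
      have "(a $ i \<le> x $ i \<and> x $ i \<le> b $ i) \<and> (a $ i \<le> x $ i + y $ i \<and> x $ i + y $ i \<le> b $ i)
         \<longleftrightarrow> (a1 $ i \<le> x $ i \<and> x $ i \<le> b1 $ i)" for i by (auto simp: a1_def b1_def)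
      then show ?thesis by (auto simp: less_eq_vec_def)
    qed
    then have B: "{x. x \<in> {a..b} \<and> x + y \<in> {a..b}} = {a1..b1}" by blast
    then have sub: "{a1..b1} \<subseteq> {a..b}" by blast
    show ?thesis unfolding S_def B c_def
    proof (rule insert.IH)
      show "v - u \<in> H" if "u \<in> {a1..b1}" "v \<in> {a1..b1}" for u v using that sub insert.prems(1) by blast
    next
      fix h a' b' assume h: "h \<in> I \<rightarrow>\<^sub>E H" and ab: "{a'..b'} \<subseteq> {a1..b1}"
      have 1: "h(k := y) \<in> insert k I \<rightarrow>\<^sub>E H" using h y by (auto simp: PiE_iff extensional_def)
      have "mixed_diff I (h(k := y)) g = mixed_diff I h g" for g :: "_ \<Rightarrow> real"
        using insert.hyps by (intro mixed_diff_cong) auto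
      then have 2: "mixed_diff (insert k I) (h(k := y)) F = mixed_diff I h (\<lambda>x. F x - F (x + y))"
        using insert.hyps by (simp add: mixed_diff_insert')
      have "{a'..b'} \<subseteq> {a..b}" using sub ab by (rule order.trans[rotated])
      from insert.prems(2)[OF 1 this]
      show "norm (\<Sum>x\<in>{a'..b'}. e_fun (mixed_diff I h (\<lambda>x. F x - F (x + y)) x)) \<le> M (h(k := y))"
        unfolding 2 .
    qed
  qed
  have card: "card (insert k I) = c + 1" using insert.hyps by (simp add: c_def)
  have "(norm (\<Sum>x\<in>{a..b}. e_fun (F x)) / card H)\<^sup>2 \<le> (\<Sum>y\<in>H. S y) / (real (card H))\<^sup>2"
    unfolding power_divide S_def using weyl_step[of "{a..b}" H F] insert.prems(1) assms(2)
    by (intro divide_right_mono) auto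
  also have "\<dots> = (\<Sum>y\<in>H. S y / card H) / card H"
    by (simp add: power2_eq_square sum_divide_distrib)
  finally have "((norm (\<Sum>x\<in>{a..b}. e_fun (F x)) / card H)\<^sup>2) ^ (2 ^ c) \<le> ((\<Sum>y\<in>H. S y / card H) / card H) ^ (2 ^ c)"
    by (intro power_mono) auto
  also have "\<dots> \<le> (\<Sum>y\<in>H. (S y / card H) ^ (2 ^ c)) / card H"
    by (rule mean_power_le) (simp add: S_def)
  also have "\<dots> \<le> (\<Sum>y\<in>H. (\<Sum>h\<in>I \<rightarrow>\<^sub>E H. M (h(k := y))) / real (card H) ^ (c + 1)) / card H"
    by (intro divide_right_mono sum_mono step) auto
  also have "\<dots> = (\<Sum>h\<in>insert k I \<rightarrow>\<^sub>E H. M h) / real (card H) ^ (c + 1 + 1)"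
    using insert.hyps by (simp add: sum_PiE_insert sum.swap[of _ H] sum_divide_distrib mult_ac)
  finally show ?case unfolding card by (simp add: power_mult[symmetric])
qed

subsection \<open>Exponential sums over boxes\<close>

lemma dist_int_nonneg [simp]: "0 \<le> dist_int x" by (simp add: dist_int_def)

lemma dist_int_le: "dist_int x \<le> \<bar>x - of_int k\<bar>"
  using round_diff_minimal[of x k] by (simp add: dist_int_def abs_minus_commute)

lemma dist_int_le_half: "dist_int x \<le> 1 / 2"
  using of_int_round_abs_le[of x] by (simp add: dist_int_def abs_minus_commute)

lemma dist_int_minus [simp]: "dist_int (- x) = dist_int x"
proof -
  have "dist_int (- y) \<le> dist_int y" for y
    using dist_int_le[of "- y" "- round y"] by (simp add: dist_int_def)
  from this[of x] this[of "- x"] show ?thesis by simp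
qed

lemma dist_int_mult_le: "dist_int (of_int k * x) \<le> \<bar>of_int k\<bar> * dist_int x"
proof -
  have "dist_int (of_int k * x) \<le> \<bar>of_int k * x - of_int (k * round x)\<bar>" by (rule dist_int_le)
  also have "\<dots> = \<bar>of_int k\<bar> * dist_int x" by (simp add: dist_int_def algebra_simps flip: abs_mult)
  finally show ?thesis .
qed

text \<open>For \<open>T > 0\<close> this is \<open>min T (1 / (2 * dist_int x))\<close>, read as \<open>T\<close> if \<open>dist_int x = 0\<close>.\<close>

definition geom_bound :: "nat \<Rightarrow> real \<Rightarrow> real" where
  "geom_bound T x = (if 2 * real T * dist_int x \<le> 1 then real T else 1 / (2 * dist_int x))"

lemma geom_bound_nonneg [simp]: "0 \<le> geom_bound T x" by (simp add: geom_bound_def)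

lemma geom_bound_minus [simp]: "geom_bound T (- x) = geom_bound T x" by (simp add: geom_bound_def)

lemma geom_bound_le: "geom_bound T x \<le> T"
proof (cases "2 * real T * dist_int x \<le> 1")
  case False
  then have "dist_int x > 0" by (metis dist_int_nonneg less_eq_real_def mult_zero_right zero_le_one)
  with False show ?thesis by (simp add: geom_bound_def field_simps)
qed (simp add: geom_bound_def)

lemma geom_bound_le_inverse:
  assumes "0 < w" "w \<le> dist_int x"
  shows "geom_bound T x \<le> 1 / (2 * w)"
proof (cases "2 * real T * dist_int x \<le> 1")
  case True
  have "2 * real T * w \<le> 2 * real T * dist_int x" using assms by (intro mult_left_mono) auto
  with True have "2 * real T * w \<le> 1" by linarith
  with True assms show ?thesis by (simp add: geom_bound_def field_simps)
next
  case False
  with assms show ?thesis by (simp add: geom_bound_def frac_le)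
qed

text \<open>The chord is 2 sin t with t = pi * dist_int x. As t \<le> 2, the cubic Taylor bound
  gives sin t \<ge> t - t^3 / 6 \<ge> t / 3, and pi > 3 finishes. The best factor is 4; with factor
  2 a telescoped geometric sum is at most 2 / (2 * dist_int x), twice the value of
  \<open>geom_bound\<close>.\<close>

lemma norm_one_minus_e_fun: "2 * dist_int x \<le> norm (1 - e_fun x)"
proof -
  define y where "y = x - of_int (round x)"
  define t where "t = pi * \<bar>y\<bar>"
  have y: "\<bar>y\<bar> = dist_int x" by (simp add: y_def dist_int_def)
  have e: "e_fun x = e_fun y" by (rule e_fun_cong_int) (simp add: y_def)
  have "norm (e_fun y - 1) = norm (exp (\<i> * of_real (2 * pi * y)) - 1)"
    by (simp add: e_fun_cis cis_conv_exp)
  also have "\<dots> = 2 * \<bar>sin (2 * pi * y / 2)\<bar>" by (rule dist_exp_i_1)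
  also have "\<dots> = 2 * \<bar>sin t\<bar>" by (cases "y \<ge> 0") (auto simp: t_def abs_if)
  finally have n: "norm (1 - e_fun x) = 2 * \<bar>sin t\<bar>" by (simp add: e norm_minus_commute)
  have t: "0 \<le> t" "t \<le> 2"
  proof -
    have "t \<le> 4 * (1 / 2)" unfolding t_def y using pi_less_4 dist_int_le_half[of x]
      by (intro mult_mono) auto
    then show "t \<le> 2" by simp
  qed (simp add: t_def)
  have "t - t ^ 3 / 6 \<le> sin t"
  proof -
    have "\<bar>sin t - (\<Sum>m<3. sin_coeff m * t ^ m)\<bar> \<le> inverse (fact 3) * \<bar>t\<bar> ^ 3"
      by (rule Maclaurin_sin_bound)
    then have "\<bar>sin t - t\<bar> \<le> t ^ 3 / 6" using t by (simp add: numeral_3_eq_3 sin_coeff_def)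
    then show ?thesis by linarith
  qed
  moreover have "t ^ 3 \<le> 4 * t"
  proof -
    have "t * t\<^sup>2 \<le> t * 2\<^sup>2" using t by (intro mult_left_mono power_mono) auto
    then show ?thesis by (simp add: power3_eq_cube power2_eq_square)
  qed
  ultimately have "t / 3 \<le> sin t" by linarith
  moreover have "dist_int x \<le> t / 3" unfolding t_def y using pi_gt3 mult_right_mono[of 3 pi "dist_int x"] by simp
  ultimately show ?thesis using n t by linarith
qed

text \<open>Multiplying by 1 - e(x) telescopes the sum to its two ends; close to an integer the
  trivial bound T takes over. All subintervals of 0..T-1 get the same bound, as Abel summation calls
  for all tails.\<close>

lemma geometric_sum_bound:
  assumes "{lo..hi} \<subseteq> {0..<int T}"
  shows "norm (\<Sum>t\<in>{lo..hi}. e_fun (x * of_int t)) \<le> 2 * geom_bound T x"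
proof -
  let ?S = "\<Sum>t\<in>{lo..hi}. e_fun (x * of_int t)"
  have T: "norm ?S \<le> real T"
  proof -
    have "norm ?S \<le> (\<Sum>t\<in>{lo..hi}. 1)" by (rule sum_norm_le) simp
    also have "\<dots> \<le> real (card {0..<int T})" using card_mono[OF _ assms] by simp
    finally show ?thesis by simp
  qed
  show ?thesis
  proof (cases "2 * real T * dist_int x \<le> 1")
    case True
    then show ?thesis using T by (simp add: geom_bound_def)
  next
    case False
    then have pos: "dist_int x > 0" by (metis dist_int_nonneg less_eq_real_def mult_zero_right zero_le_one)
    have tel: "(1 - e_fun x) * (\<Sum>t\<in>{lo..lo + int k - 1}. e_fun (x * of_int t))
        = e_fun (x * of_int lo) - e_fun (x * of_int (lo + int k))" for k
    proof (induction k)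
      case (Suc k)
      have "{lo..lo + int (Suc k) - 1} = insert (lo + int k) {lo..lo + int k - 1}" by auto
      then have "(1 - e_fun x) * (\<Sum>t\<in>{lo..lo + int (Suc k) - 1}. e_fun (x * of_int t))
          = (1 - e_fun x) * e_fun (x * of_int (lo + int k)) + (1 - e_fun x) * (\<Sum>t\<in>{lo..lo + int k - 1}. e_fun (x * of_int t))"
        by (simp add: distrib_left)
      also have "\<dots> = e_fun (x * of_int lo) - e_fun x * e_fun (x * of_int (lo + int k))"
        unfolding Suc by (simp add: algebra_simps)
      also have "e_fun x * e_fun (x * of_int (lo + int k)) = e_fun (x * of_int (lo + int (Suc k)))"
        by (simp add: algebra_simps flip: e_fun_add)
      finally show ?case .
    qed simp
    have "norm ((1 - e_fun x) * ?S) \<le> 2"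
    proof (cases "lo \<le> hi")
      case True
      have "(1 - e_fun x) * ?S = e_fun (x * of_int lo) - e_fun (x * of_int (hi + 1))"
        using tel[of "nat (hi + 1 - lo)"] True by simp
      then show ?thesis using norm_triangle_ineq4[of "e_fun (x * of_int lo)" "e_fun (x * of_int (hi + 1))"] by simp
    qed simp
    then have "2 * dist_int x * norm ?S \<le> 2"
      using mult_right_mono[OF norm_one_minus_e_fun[of x], of "norm ?S"] by (simp add: norm_mult)
    then show ?thesis using False pos by (simp add: geom_bound_def field_simps)
  qed
qed

text \<open>Peeling off the constant \<open>f lo\<close> leaves the weight
  \<open>f t - f lo\<close>, again nonnegative and increasing, which vanishes at \<open>lo\<close>
  and so shortens the range by one. For increasing weights it is the tails, not the initial
  segments, that have to be bounded.\<close>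

lemma abel_summation_bound:
  fixes z :: "int \<Rightarrow> complex" and f :: "int \<Rightarrow> real"
  assumes "lo \<le> hi" "0 \<le> f lo"
    and "\<And>s t. lo \<le> s \<Longrightarrow> s \<le> t \<Longrightarrow> t \<le> hi \<Longrightarrow> f s \<le> f t"
    and "\<And>s. lo \<le> s \<Longrightarrow> norm (\<Sum>t\<in>{s..hi}. z t) \<le> K"
  shows "norm (\<Sum>t\<in>{lo..hi}. of_real (f t) * z t) \<le> f hi * K"
  using assms
proof (induction "nat (hi - lo)" arbitrary: lo f)
  case 0
  then have "lo = hi" by simp
  then show ?case using 0(3) 0(5)[of lo] by (simp add: norm_mult mult_left_mono)
next
  case (Suc k)
  then have lt: "lo < hi" by simp
  then have split: "{lo..hi} = insert lo {lo + 1..hi}" by auto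
  have mono: "f lo \<le> f (lo + 1)" using Suc.prems(3)[of lo "lo + 1"] lt by simp
  have "norm (\<Sum>t\<in>{lo + 1..hi}. of_real (f t - f lo) * z t) \<le> (f hi - f lo) * K"
  proof (rule Suc.hyps(1))
    show "k = nat (hi - (lo + 1))" using Suc.hyps(2) by simp
    show "lo + 1 \<le> hi" "0 \<le> f (lo + 1) - f lo" using lt mono by auto
  next
    fix s t assume "lo + 1 \<le> s" "s \<le> t" "t \<le> hi"
    then show "f s - f lo \<le> f t - f lo" using Suc.prems(3)[of s t] by simp
  next
    fix s assume "lo + 1 \<le> s"
    then show "norm (\<Sum>t\<in>{s..hi}. z t) \<le> K" using Suc.prems(4)[of s] by simp
  qed
  moreover have "norm (of_real (f lo) * (\<Sum>t\<in>{lo..hi}. z t)) \<le> f lo * K"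
    using Suc.prems(2) Suc.prems(4)[of lo] by (simp add: norm_mult mult_left_mono)
  moreover have "(\<Sum>t\<in>{lo..hi}. of_real (f t) * z t)
      = of_real (f lo) * (\<Sum>t\<in>{lo..hi}. z t) + (\<Sum>t\<in>{lo + 1..hi}. of_real (f t - f lo) * z t)"
    unfolding split by (simp add: algebra_simps sum_subtractf sum_distrib_left)
  ultimately show ?case
    using norm_triangle_ineq[of "of_real (f lo) * (\<Sum>t\<in>{lo..hi}. z t)" "\<Sum>t\<in>{lo + 1..hi}. of_real (f t - f lo) * z t"]
    by (simp add: algebra_simps)
qed

text \<open>A factor \<open>exp (\<phi> t)\<close> with \<open>\<phi>\<close> a polynomial of bounded size is removed by separating the
  variables: the weights \<open>w\<close> are controlled together with all their monomial multiples, for which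
  one-dimensional Abel summation suffices. Multiplication by a coordinate then preserves the bound,
  hence so do polynomials and, through its power series, \<open>exp \<phi>\<close>.\<close>

definition mult_bound :: "('n::finite \<Rightarrow> int set) \<Rightarrow> real \<Rightarrow> ('n \<Rightarrow> int \<Rightarrow> complex) \<Rightarrow> real
    \<Rightarrow> (int ^ 'n \<Rightarrow> complex) \<Rightarrow> real \<Rightarrow> bool" where
  "mult_bound X T z K w C \<longleftrightarrow> (\<forall>m::'n \<Rightarrow> nat.
     norm (\<Sum>x | \<forall>i. x $ i \<in> X i. w x * (\<Prod>i\<in>UNIV. of_real ((of_int (x $ i) / T) ^ m i) * z i (x $ i))) \<le> C * K)"

definition mult_op :: "('n::finite \<Rightarrow> int set) \<Rightarrow> real \<Rightarrow> ('n \<Rightarrow> int \<Rightarrow> complex) \<Rightarrow> real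
    \<Rightarrow> (int ^ 'n \<Rightarrow> complex) \<Rightarrow> real \<Rightarrow> bool" where
  "mult_op X T z K \<phi> A \<longleftrightarrow>
     (\<forall>w C. mult_bound X T z K w C \<longrightarrow> mult_bound X T z K (\<lambda>x. \<phi> x * w x) (A * C))"

lemma mult_bound_nonneg: "mult_bound X T z K w C \<Longrightarrow> 0 \<le> C * K"
  unfolding mult_bound_def by (meson norm_ge_zero order_trans)

lemma mult_bound_add:
  "mult_bound X T z K v C \<Longrightarrow> mult_bound X T z K w D \<Longrightarrow> mult_bound X T z K (\<lambda>x. v x + w x) (C + D)"
  unfolding mult_bound_def distrib_right sum.distrib by (meson norm_triangle_mono)

lemma mult_op_const: "mult_op X T z K (\<lambda>x. c) (norm c)"
  unfolding mult_op_def mult_bound_def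
  by (auto simp: mult.assoc norm_mult mult_left_mono simp flip: sum_distrib_left)

lemma mult_op_mono: "mult_op X T z K \<phi> A \<Longrightarrow> A \<le> B \<Longrightarrow> mult_op X T z K \<phi> B"
  unfolding mult_op_def
proof (intro allI impI)
  fix w C assume *: "\<forall>w C. mult_bound X T z K w C \<longrightarrow> mult_bound X T z K (\<lambda>x. \<phi> x * w x) (A * C)"
    "A \<le> B" "mult_bound X T z K w C"
  have "A * C * K \<le> B * C * K"
    using mult_right_mono[OF *(2) mult_bound_nonneg[OF *(3)]] by (simp add: mult.assoc)
  moreover have "mult_bound X T z K (\<lambda>x. \<phi> x * w x) (A * C)" using * by blast
  ultimately show "mult_bound X T z K (\<lambda>x. \<phi> x * w x) (B * C)"
    unfolding mult_bound_def by (meson order_trans)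
qed

lemma mult_op_coord: "mult_op X T z K (\<lambda>x. of_real (of_int (x $ i) / T)) 1"
  unfolding mult_op_def
proof (intro allI impI)
  fix w :: "int ^ 'a \<Rightarrow> complex" and C assume w: "mult_bound X T z K w C"
  show "mult_bound X T z K (\<lambda>x. of_real (of_int (x $ i) / T) * w x) (1 * C)"
    unfolding mult_bound_def
  proof
    fix m :: "'a \<Rightarrow> nat"
    have "of_real (of_int (x $ i) / T) * w x * (\<Prod>j\<in>UNIV. of_real ((of_int (x $ j) / T) ^ m j) * z j (x $ j))
       = w x * (\<Prod>j\<in>UNIV. of_real ((of_int (x $ j) / T) ^ (m(i := m i + 1)) j) * z j (x $ j))" for x :: "int ^ 'a"
    proof -
      have "(\<Prod>j\<in>UNIV. complex_of_real ((of_int (x $ j) / T) ^ (m(i := m i + 1)) j) * z j (x $ j))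
        = (\<Prod>j\<in>UNIV. (if j = i then of_real (of_int (x $ i) / T) else 1) * (of_real ((of_int (x $ j) / T) ^ m j) * z j (x $ j)))"
        by (intro prod.cong) auto
      also have "\<dots> = of_real (of_int (x $ i) / T) * (\<Prod>j\<in>UNIV. of_real ((of_int (x $ j) / T) ^ m j) * z j (x $ j))"
        by (simp add: prod.distrib)
      finally show ?thesis by simp
    qed
    then show "norm (\<Sum>x | \<forall>i. x $ i \<in> X i. of_real (of_int (x $ i) / T) * w x *
        (\<Prod>j\<in>UNIV. of_real ((of_int (x $ j) / T) ^ m j) * z j (x $ j))) \<le> 1 * C * K"
      using w unfolding mult_bound_def by simp
  qed
qed

lemma mult_op_add:
  "mult_op X T z K \<phi> A \<Longrightarrow> mult_op X T z K \<psi> B \<Longrightarrow> mult_op X T z K (\<lambda>x. \<phi> x + \<psi> x) (A + B)"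
  unfolding mult_op_def distrib_right using mult_bound_add by blast

lemma mult_op_mult:
  "mult_op X T z K \<phi> A \<Longrightarrow> mult_op X T z K \<psi> B \<Longrightarrow> mult_op X T z K (\<lambda>x. \<phi> x * \<psi> x) (A * B)"
  unfolding mult_op_def mult.assoc by blast

lemma mult_op_sum:
  assumes "\<And>j. j \<in> J \<Longrightarrow> mult_op X T z K (\<phi> j) (A j)"
  shows "mult_op X T z K (\<lambda>x. \<Sum>j\<in>J. \<phi> j x) (\<Sum>j\<in>J. A j)"
  using assms
proof (induction J rule: infinite_finite_induct)
  case (insert j J)
  then show ?case by (simp add: mult_op_add)
qed (use mult_op_const[of X T z K 0] in simp_all)

lemma mult_op_scale:
  "mult_op X T z K \<phi> A \<Longrightarrow> mult_op X T z K (\<lambda>x. c * \<phi> x) (norm c * A)"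
  by (rule mult_op_mult[OF mult_op_const])

text \<open>If \<phi> acts with norm A, its powers act with norm A^k, and the partial sums of the
  exponential series with the partial sums of exp A. Both sides then pass to the limit.\<close>

lemma mult_bound_exp:
  assumes "mult_op X T z K \<phi> A" "mult_bound X T z K w C"
  shows "mult_bound X T z K (\<lambda>x. exp (\<phi> x) * w x) (exp A * C)"
  unfolding mult_bound_def
proof
  fix m
  let ?g = "\<lambda>x. \<Prod>i\<in>UNIV. of_real ((of_int (x $ i) / T) ^ m i) * z i (x $ i)"
  have pow: "mult_op X T z K (\<lambda>x. \<phi> x ^ k) (A ^ k)" for k
  proof (induction k)
    case 0 then show ?case using mult_op_const[of X T z K 1] by simp
  next
    case (Suc k) then show ?case using mult_op_mult[OF assms(1)] by simp
  qed
  have part: "mult_op X T z K (\<lambda>x. \<Sum>k<n. \<phi> x ^ k /\<^sub>R fact k) (\<Sum>k<n. A ^ k /\<^sub>R fact k)" for n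
  proof (rule mult_op_sum)
    fix k
    show "mult_op X T z K (\<lambda>x. \<phi> x ^ k /\<^sub>R fact k) (A ^ k /\<^sub>R fact k)"
      using mult_op_scale[OF pow[of k], of "of_real (inverse (fact k))"]
      by (simp add: scaleR_conv_of_real norm_inverse)
  qed
  have "norm (\<Sum>x | \<forall>i. x $ i \<in> X i. ((\<Sum>k<n. \<phi> x ^ k /\<^sub>R fact k) * w x) * ?g x) \<le> (\<Sum>k<n. A ^ k /\<^sub>R fact k) * C * K" for n
    using part[of n] assms(2) unfolding mult_op_def mult_bound_def by blast
  moreover have "(\<lambda>n. norm (\<Sum>x | \<forall>i. x $ i \<in> X i. ((\<Sum>k<n. \<phi> x ^ k /\<^sub>R fact k) * w x) * ?g x))
      \<longlonglongrightarrow> norm (\<Sum>x | \<forall>i. x $ i \<in> X i. (exp (\<phi> x) * w x) * ?g x)"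
    using exp_converges[unfolded sums_def]
    by (intro tendsto_norm tendsto_sum tendsto_mult tendsto_const) blast
  moreover have "(\<lambda>n. (\<Sum>k<n. A ^ k /\<^sub>R fact k) * C * K) \<longlonglongrightarrow> exp A * C * K"
    using exp_converges[unfolded sums_def, of A] by (intro tendsto_mult tendsto_const)
  ultimately show "norm (\<Sum>x | \<forall>i. x $ i \<in> X i. (exp (\<phi> x) * w x) * ?g x) \<le> exp A * C * K"
    by (meson LIMSEQ_le)
qed

text \<open>The starting point of the calculus. The sum factors over the coordinates, and on 0..T-1
  the weight (t / T)^m is increasing with values between 0 and 1, so Abel summation loses nothing,
  uniformly in m. This is why the coordinates of a block start at 0.\<close>

lemma mult_bound_1:
  fixes lo hi :: "'n::finite \<Rightarrow> int"
  assumes "\<And>i. {lo i..hi i} \<subseteq> {0..<int T}"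
  shows "mult_bound (\<lambda>i. {lo i..hi i}) (real T) (\<lambda>i t. e_fun (\<nu> i * of_int t))
           (\<Prod>i\<in>UNIV. 2 * geom_bound T (\<nu> i)) (\<lambda>x. 1) 1"
  unfolding mult_bound_def
proof
  fix m :: "'n \<Rightarrow> nat"
  let ?f = "\<lambda>i t. complex_of_real ((of_int t / real T) ^ m i) * e_fun (\<nu> i * of_int t)"
  have one: "norm (\<Sum>t\<in>{lo i..hi i}. ?f i t) \<le> 2 * geom_bound T (\<nu> i)" for i
  proof (cases "lo i \<le> hi i")
    case True
    then have b: "0 \<le> lo i" "hi i < int T" using assms[of i] by auto
    have "norm (\<Sum>t\<in>{lo i..hi i}. ?f i t) \<le> (of_int (hi i) / real T) ^ m i * (2 * geom_bound T (\<nu> i))"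
    proof (rule abel_summation_bound[OF True])
      show "0 \<le> (real_of_int (lo i) / real T) ^ m i" using b by simp
    next
      fix s t assume "lo i \<le> s" "s \<le> t" "t \<le> hi i"
      then show "(real_of_int s / real T) ^ m i \<le> (real_of_int t / real T) ^ m i"
        using b by (intro power_mono divide_right_mono divide_nonneg_nonneg) auto
    next
      fix s assume "lo i \<le> s"
      then show "norm (\<Sum>t\<in>{s..hi i}. e_fun (\<nu> i * of_int t)) \<le> 2 * geom_bound T (\<nu> i)"
        using b by (intro geometric_sum_bound) auto
    qed
    also have "\<dots> \<le> 1 * (2 * geom_bound T (\<nu> i))"
      using b True by (intro mult_right_mono power_le_one) (auto simp: field_simps)
    finally show ?thesis by simp
  qed simp
  have "(\<Sum>x | \<forall>i. x $ i \<in> {lo i..hi i}. 1 * (\<Prod>i\<in>UNIV. ?f i (x $ i))) = (\<Prod>i\<in>UNIV. \<Sum>t\<in>{lo i..hi i}. ?f i t)"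
    using sum_vec_set_prod[of "\<lambda>i. {lo i..hi i}" ?f] by simp
  then show "norm (\<Sum>x | \<forall>i. x $ i \<in> {lo i..hi i}. 1 * (\<Prod>i\<in>UNIV. ?f i (x $ i))) \<le> 1 * (\<Prod>i\<in>UNIV. 2 * geom_bound T (\<nu> i))"
    by (simp only: prod_norm[symmetric] mult_1) (intro prod_mono conjI norm_ge_zero one)
qed

text \<open>\<open>D\<close> plays the role of a degree: on a block of relative size \<open>\<delta>\<close> a function bounded by \<open>A\<close>
  varies by at most \<open>D * \<delta> * A\<close>.\<close>

definition mult_lip :: "('n::finite \<Rightarrow> int set) \<Rightarrow> real \<Rightarrow> ('n \<Rightarrow> int \<Rightarrow> complex) \<Rightarrow> real \<Rightarrow> real
    \<Rightarrow> (int ^ 'n \<Rightarrow> complex) \<Rightarrow> complex \<Rightarrow> real \<Rightarrow> nat \<Rightarrow> bool" where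
  "mult_lip X T z K \<delta> \<phi> c A D \<longleftrightarrow> mult_op X T z K \<phi> A \<and> norm c \<le> A \<and>
     mult_op X T z K (\<lambda>x. \<phi> x - c) (real D * \<delta> * A)"

lemma mult_lip_1: "mult_lip X T z K \<delta> (\<lambda>x. 1) 1 1 0"
  using mult_op_const[of X T z K 1] mult_op_const[of X T z K 0] by (simp add: mult_lip_def)

text \<open>Since \<phi> * \<psi> - c * c' = (\<phi> - c) * \<psi> + c * (\<psi> - c'), the numbers
  \<open>D\<close> add like degrees while the bounds multiply.\<close>

lemma mult_lip_mult:
  assumes "mult_lip X T z K \<delta> \<phi> c A D" "mult_lip X T z K \<delta> \<psi> c' A' D'"
  shows "mult_lip X T z K \<delta> (\<lambda>x. \<phi> x * \<psi> x) (c * c') (A * A') (D + D')"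
proof -
  have A: "norm c \<le> A" "norm c' \<le> A'" "0 \<le> A"
    using assms by (auto simp: mult_lip_def intro: order.trans[OF norm_ge_zero])
  have c: "mult_op X T z K (\<lambda>x. c) A" using mult_op_const mult_op_mono A(1) by blast
  have "mult_op X T z K (\<lambda>x. (\<phi> x - c) * \<psi> x + c * (\<psi> x - c')) (real D * \<delta> * A * A' + A * (real D' * \<delta> * A'))"
    using assms c unfolding mult_lip_def by (intro mult_op_add mult_op_mult) auto
  then have "mult_op X T z K (\<lambda>x. \<phi> x * \<psi> x - c * c') (real (D + D') * \<delta> * (A * A'))"
    by (simp add: algebra_simps)
  moreover have "norm (c * c') \<le> A * A'" using A by (simp add: norm_mult mult_mono)
  ultimately show ?thesis using assms unfolding mult_lip_def by (auto intro: mult_op_mult)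
qed

lemma mult_lip_power:
  assumes "mult_lip X T z K \<delta> \<phi> c A D"
  shows "mult_lip X T z K \<delta> (\<lambda>x. \<phi> x ^ k) (c ^ k) (A ^ k) (k * D)"
proof (induction k)
  case 0 then show ?case using mult_lip_1 by simp
next
  case (Suc k) then show ?case using mult_lip_mult[OF assms] by simp
qed

lemma mult_lip_prod:
  assumes "finite J" "\<And>j. j \<in> J \<Longrightarrow> mult_lip X T z K \<delta> (\<phi> j) (c j) (A j) (D j)"
  shows "mult_lip X T z K \<delta> (\<lambda>x. \<Prod>j\<in>J. \<phi> j x) (\<Prod>j\<in>J. c j) (\<Prod>j\<in>J. A j) (\<Sum>j\<in>J. D j)"
  using assms
proof (induction J)
  case empty then show ?case using mult_lip_1 by simp
next
  case (insert j J) then show ?case by (simp add: mult_lip_mult)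
qed

text \<open>Along the block b + q * t the coordinate moves by at most q * T, which is the fraction q
  * T / V of its bound V; this fraction is the relative block size \<delta>.\<close>

lemma mult_lip_coord:
  assumes "0 < T" "0 \<le> q" "\<bar>b\<bar> + q * T \<le> V" "0 < V"
  shows "mult_lip X T z K (q * T / V) (\<lambda>t. of_real (b + q * of_int (t $ i))) (of_real b) V 1"
proof -
  have "mult_op X T z K (\<lambda>t. of_real (q * T) * of_real (of_int (t $ i) / T)) (norm (complex_of_real (q * T)) * 1)"
    by (rule mult_op_scale[OF mult_op_coord])
  then have 1: "mult_op X T z K (\<lambda>t. of_real (q * of_int (t $ i))) (q * T)"
    using assms by (simp add: norm_mult)
  have "mult_op X T z K (\<lambda>t. of_real b + of_real (q * of_int (t $ i))) (norm (complex_of_real b) + q * T)"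
    by (rule mult_op_add[OF mult_op_const 1])
  then have 2: "mult_op X T z K (\<lambda>t. of_real (b + q * of_int (t $ i))) V"
    using assms(3) by (simp add: mult_op_mono)
  have "\<bar>b\<bar> \<le> V" using assms mult_nonneg_nonneg[of q T] by linarith
  then show ?thesis using 1 2 assms by (simp add: mult_lip_def)
qed

definition coeff_norm :: "'n int_mpoly \<Rightarrow> real" where
  "coeff_norm p = (\<Sum>m\<in>Poly_Mapping.keys p. \<bar>of_int (Poly_Mapping.lookup p m)\<bar>)"

lemma coeff_norm_nonneg: "0 \<le> coeff_norm p" by (simp add: coeff_norm_def sum_nonneg)

text \<open>A mean value estimate in multiplier form: a monomial of degree j at points of size V has
  slope about j * V^(j - 1), and the block has length q * T. The value at the base point b is
  subtracted because it contributes a constant phase.\<close>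

lemma mult_op_mpoly_eval:
  fixes b :: "int ^ 'n::finite" and p :: "'n int_mpoly"
  assumes "0 < T" "\<And>i. \<bar>of_int (b $ i)\<bar> + real q * T \<le> V" "1 \<le> V"
  shows "mult_op X T z K (\<lambda>t. of_real (of_int (mpoly_eval p (b + int q *s t) - mpoly_eval p b)))
    (coeff_norm p * real (mpoly_degree p) * (real q * T) * V ^ mpoly_degree p / V)"
proof -
  let ?\<delta> = "real q * T / V"
  let ?c = "\<lambda>m. Poly_Mapping.lookup p m"
  let ?g = "\<lambda>m (x :: int ^ 'n). \<Prod>i\<in>UNIV. (x $ i) ^ Poly_Mapping.lookup m i"
  have coord: "mult_lip X T z K ?\<delta> (\<lambda>t. of_real (of_int (b $ i) + real q * of_int (t $ i))) (of_real (of_int (b $ i))) V 1" for i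
    by (rule mult_lip_coord) (use assms in auto)
  have mon: "mult_op X T z K (\<lambda>t. of_real (of_int (?c m * (?g m (b + int q *s t) - ?g m b))))
      (\<bar>of_int (?c m)\<bar> * (real (mpoly_degree p) * ?\<delta> * V ^ mpoly_degree p))"
    if m: "m \<in> Poly_Mapping.keys p" for m
  proof -
    have deg: "mon_degree m \<le> mpoly_degree p" by (rule mon_degree_le_mpoly_degree[OF m])
    have "mult_lip X T z K ?\<delta> (\<lambda>t. \<Prod>i\<in>UNIV. (of_real (of_int (b $ i) + real q * of_int (t $ i))) ^ Poly_Mapping.lookup m i)
       (\<Prod>i\<in>UNIV. of_real (of_int (b $ i)) ^ Poly_Mapping.lookup m i)
       (\<Prod>i\<in>UNIV. V ^ Poly_Mapping.lookup m i) (\<Sum>i\<in>UNIV. Poly_Mapping.lookup m i * 1)"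
      by (intro mult_lip_prod mult_lip_power coord) auto
    then have "mult_op X T z K (\<lambda>t. of_real (of_int (?g m (b + int q *s t) - ?g m b))) (real (mon_degree m) * ?\<delta> * V ^ mon_degree m)"
      by (simp add: mult_lip_def mon_degree_def power_sum[symmetric] of_int_prod of_int_power of_real_prod)
    from mult_op_scale[OF this, of "of_real (of_int (?c m))"]
    have 1: "mult_op X T z K (\<lambda>t. of_real (of_int (?c m * (?g m (b + int q *s t) - ?g m b))))
        (\<bar>of_int (?c m)\<bar> * (real (mon_degree m) * ?\<delta> * V ^ mon_degree m))"
      by simp
        have "real (mon_degree m) * ?\<delta> * V ^ mon_degree m \<le> real (mpoly_degree p) * ?\<delta> * V ^ mpoly_degree p"
      using deg assms by (intro mult_mono power_increasing) auto
    then show ?thesis by (intro mult_op_mono[OF 1] mult_left_mono) auto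
  qed
  have eq: "mpoly_eval p (b + int q *s t) - mpoly_eval p b = (\<Sum>m\<in>Poly_Mapping.keys p. ?c m * (?g m (b + int q *s t) - ?g m b))" for t
    by (simp add: mpoly_eval_def right_diff_distrib sum_subtractf)
  have "mult_op X T z K (\<lambda>t. \<Sum>m\<in>Poly_Mapping.keys p. of_real (of_int (?c m * (?g m (b + int q *s t) - ?g m b))))
     (\<Sum>m\<in>Poly_Mapping.keys p. \<bar>of_int (?c m)\<bar> * (real (mpoly_degree p) * ?\<delta> * V ^ mpoly_degree p))"
    by (rule mult_op_sum) (rule mon)
  then have "mult_op X T z K (\<lambda>t. \<Sum>m\<in>Poly_Mapping.keys p. of_real (of_int (?c m * (?g m (b + int q *s t) - ?g m b))))
     (coeff_norm p * (real (mpoly_degree p) * ?\<delta> * V ^ mpoly_degree p))"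
    unfolding coeff_norm_def sum_distrib_right .
  then show ?thesis unfolding eq by (simp add: mult_ac)
qed

section \<open>Cutting a box into residue classes inside small cubes\<close>

lemma le_div_iff_mult_le_int:
  fixes a s q :: int
  assumes "0 < q"
  shows "s \<le> a div q \<longleftrightarrow> s * q \<le> a"
proof
  assume "s \<le> a div q"
  then have "s * q \<le> a div q * q" using assms by (intro mult_right_mono) auto
  also have "\<dots> \<le> a" using assms div_mult_mod_eq[of a q] pos_mod_sign[of q a] by linarith
  finally show "s * q \<le> a" .
next
  assume "s * q \<le> a"
  from zdiv_mono1[OF this assms] show "s \<le> a div q" using assms by simp
qed

text \<open>Each coordinate range is cut into intervals of length L = q * T, and each resulting cube
  into residue classes modulo q. A point is then \<open>base x\<close> plus q times
  \<open>\<tau> x\<close>, with the coordinates of \<open>\<tau> x\<close> in 0..T-1, and there are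
  at most (N div L + 1) * q \<le> 2 * N / T base values per coordinate. Intersecting with {a..b}
  merely shortens the ranges of t, which is why the hypothesis covers all subintervals of
  0..T-1.\<close>

lemma block_decomposition_bound:
  fixes g :: "int ^ 'n::finite \<Rightarrow> complex" and q T :: nat and N :: int
  assumes "1 \<le> q" "1 \<le> T" "int (q * T) \<le> N" "{a..b} \<subseteq> {0..\<chi> i. N}"
    and "\<And>c lo hi. (\<And>i. 0 \<le> c $ i) \<Longrightarrow> (\<And>i. c $ i \<le> 2 * N) \<Longrightarrow> (\<And>i. {lo i..hi i} \<subseteq> {0..<int T}) \<Longrightarrow>
      norm (\<Sum>t | \<forall>i. t $ i \<in> {lo i..hi i}. g (c + int q *s t)) \<le> M"
  shows "norm (\<Sum>x\<in>{a..b}. g x) \<le> (2 * real_of_int N / T) ^ CARD('n) * M"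
proof -
  define L where "L = int (q * T)"
  have L: "L > 0" "L \<le> N" "int q > 0" "int T > 0" "L = int q * int T" using assms by (auto simp: L_def)
  define \<tau> :: "int ^ 'n \<Rightarrow> int ^ 'n" where "\<tau> x = (\<chi> i. (x $ i mod L) div int q)" for x
  define base where "base x = x - int q *s \<tau> x" for x
  \<comment> \<open>Base values are a multiple of L plus a residue below q. As the last interval may
    stick out of the range, they are bounded by 2 * N rather than N.\<close>
  define \<beta> where "\<beta> = (\<lambda>(k, \<rho>). k * L + \<rho>) ` ({0..N div L} \<times> {0..<int q})"
  define \<B> where "\<B> = {c :: int ^ 'n. \<forall>i. c $ i \<in> \<beta>}"
  have fin_\<beta>: "finite \<beta>" by (simp add: \<beta>_def)
  have fin: "finite \<B>" unfolding \<B>_def by (rule finite_vec_set) (rule fin_\<beta>)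
  have Npos: "N > 0" using L(1,2) by linarith
  have card_\<beta>: "real (card \<beta>) \<le> 2 * real_of_int N / T"
  proof -
    have "card \<beta> \<le> card ({0..N div L} \<times> {0..<int q})" unfolding \<beta>_def by (rule card_image_le) simp
    also have "\<dots> = nat (N div L + 1) * q" by simp
    finally have "real (card \<beta>) \<le> real (nat (N div L + 1) * q)" by (rule of_nat_mono)
    also have "\<dots> = (of_int (N div L) + 1) * real q"
      using L Npos pos_imp_zdiv_nonneg_iff[of L N] by simp
    also have "\<dots> \<le> (2 * (real_of_int N / of_int L)) * real q"
    proof (rule mult_right_mono)
      have "of_int (N div L) \<le> real_of_int N / of_int L" by (rule real_of_int_div4)
      moreover have "1 \<le> real_of_int N / of_int L" using L(1,2) by simp
      ultimately show "of_int (N div L) + 1 \<le> 2 * (real_of_int N / of_int L)" by linarith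
    qed simp
    also have "\<dots> = 2 * real_of_int N / T" using assms(1) by (simp add: L_def)
    finally show ?thesis .
  qed
  have base_nth: "base x $ i = (x $ i div L) * L + (x $ i mod L) mod int q" for x i
    using div_mult_mod_eq[of "x $ i" L] div_mult_mod_eq[of "x $ i mod L" "int q"]
    by (simp add: base_def \<tau>_def algebra_simps)
  have base_in: "base x \<in> \<B>" if "x \<in> {a..b}" for x
  proof -
    have "base x $ i \<in> \<beta>" for i
    proof -
      have "x \<in> {0..\<chi> i. N}" using that assms(4) by blast
      then have x: "0 \<le> x $ i" "x $ i \<le> N" by (auto simp: less_eq_vec_def)
      have "(x $ i div L, (x $ i mod L) mod int q) \<in> {0..N div L} \<times> {0..<int q}"
        using x L by (auto simp: pos_imp_zdiv_nonneg_iff zdiv_mono1)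
      then show ?thesis unfolding base_nth \<beta>_def by (intro image_eqI[rotated]) auto
    qed
    then show ?thesis by (simp add: \<B>_def)
  qed
  have "(\<Sum>x\<in>{a..b}. g x) = (\<Sum>c\<in>\<B>. \<Sum>x | x \<in> {a..b} \<and> base x = c. g x)"
    by (rule sum.group[symmetric]) (use fin base_in in auto)
  also have "norm \<dots> \<le> (\<Sum>c\<in>\<B>. M)"
  proof (rule sum_norm_le)
    fix c assume c: "c \<in> \<B>"
    \<comment> \<open>The double negation expresses the ceiling of (a - c) / q through
      \<open>div\<close>.\<close>
    define lo where "lo i = max 0 (- ((c $ i - a $ i) div int q))" for i
    define hi where "hi i = min (int T - 1) ((b $ i - c $ i) div int q)" for i
    have c_dec: "\<exists>k \<rho>. c $ i = k * L + \<rho> \<and> 0 \<le> k \<and> k \<le> N div L \<and> 0 \<le> \<rho> \<and> \<rho> < int q" for i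
      using c by (fastforce simp: \<B>_def \<beta>_def)
    have c0: "0 \<le> c $ i" for i using c_dec[of i] L by auto
    have c2: "c $ i \<le> 2 * N" for i
    proof -
      obtain k \<rho> where "c $ i = k * L + \<rho>" "0 \<le> k" "k \<le> N div L" "0 \<le> \<rho>" "\<rho> < int q" using c_dec by blast
      moreover have "k * L \<le> N div L * L" using calculation L by (intro mult_right_mono) auto
      moreover have "N div L * L \<le> N" using L div_mult_mod_eq[of N L] pos_mod_sign[of L N] by linarith
      moreover have "int q \<le> L" using L by (simp add: L_def)
      ultimately show ?thesis using L by linarith
    qed
    have box: "c $ i + int q * s \<in> {a $ i..b $ i} \<and> s \<in> {0..<int T} \<longleftrightarrow> s \<in> {lo i..hi i}" for s i
    proof -
      have "c $ i + int q * s \<le> b $ i \<longleftrightarrow> s * int q \<le> b $ i - c $ i" by (simp add: algebra_simps)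
      also have "\<dots> \<longleftrightarrow> s \<le> (b $ i - c $ i) div int q" by (rule le_div_iff_mult_le_int[OF L(3), symmetric])
      finally have 1: "c $ i + int q * s \<le> b $ i \<longleftrightarrow> s \<le> (b $ i - c $ i) div int q" .
      have "a $ i \<le> c $ i + int q * s \<longleftrightarrow> (- s) * int q \<le> c $ i - a $ i" by (simp add: algebra_simps)
      also have "\<dots> \<longleftrightarrow> - s \<le> (c $ i - a $ i) div int q" by (rule le_div_iff_mult_le_int[OF L(3), symmetric])
      finally have 2: "a $ i \<le> c $ i + int q * s \<longleftrightarrow> - ((c $ i - a $ i) div int q) \<le> s" by linarith
      show ?thesis using 1 2 by (auto simp: lo_def hi_def)
    qed
    have \<tau>: "\<tau> (c + int q *s t) = t" if "\<forall>i. t $ i \<in> {0..<int T}" for t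
    proof -
      have "(c + int q *s t) $ i mod L div int q = t $ i" for i
      proof -
        obtain k \<rho> where k: "c $ i = k * L + \<rho>" "0 \<le> \<rho>" "\<rho> < int q" using c_dec by blast
        have t: "0 \<le> t $ i" "t $ i + 1 \<le> int T" using that by (simp_all add: zless_imp_add1_zle)
        have "int q * (t $ i + 1) \<le> L" unfolding L(5) using t by (intro mult_left_mono) auto
        then have lt: "\<rho> + int q * t $ i < L" using k by (simp add: algebra_simps)
        have "(c + int q *s t) $ i = (\<rho> + int q * t $ i) + k * L" using k by simp
        then have "(c + int q *s t) $ i mod L = (\<rho> + int q * t $ i) mod L" by (simp only: mod_mult_self1)
        also have "\<dots> = \<rho> + int q * t $ i" using k t lt by (intro mod_pos_pos_trivial) auto
        finally show ?thesis using k L by simp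
      qed
      then show ?thesis by (simp add: \<tau>_def vec_eq_iff)
    qed
    have "(\<Sum>x | x \<in> {a..b} \<and> base x = c. g x) = (\<Sum>t | \<forall>i. t $ i \<in> {lo i..hi i}. g (c + int q *s t))"
    proof (rule sum.reindex_bij_witness[of _ "\<lambda>t. c + int q *s t" \<tau>])
      fix x assume "x \<in> {x. x \<in> {a..b} \<and> base x = c}"
      then have x: "x \<in> {a..b}" "base x = c" by auto
      show eq: "c + int q *s \<tau> x = x" using x(2) by (auto simp: base_def)
      have "\<tau> x $ i \<in> {0..<int T}" for i
      proof -
        have "0 \<le> x $ i mod L" "x $ i mod L < int T * int q" using L by (auto simp: mult.commute)
        then have "x $ i mod L div int q < int T"
          using le_div_iff_mult_le_int[OF L(3), of "int T" "x $ i mod L"] by linarith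
        then show ?thesis using L(1,3) by (simp add: \<tau>_def pos_imp_zdiv_nonneg_iff)
      qed
      moreover have "c $ i + int q * \<tau> x $ i = x $ i" for i by (metis eq vector_add_component vector_smult_component)
      ultimately show "\<tau> x \<in> {t. \<forall>i. t $ i \<in> {lo i..hi i}}"
        using x(1) box by (simp add: less_eq_vec_def) (metis atLeastAtMost_iff box)
      show "g (c + int q *s \<tau> x) = g x" by (simp only: eq)
    next
      fix t :: "int ^ 'n" assume "t \<in> {t. \<forall>i. t $ i \<in> {lo i..hi i}}"
      then have t: "c $ i + int q * t $ i \<in> {a $ i..b $ i} \<and> t $ i \<in> {0..<int T}" for i using box by blast
      show 1: "\<tau> (c + int q *s t) = t" by (rule \<tau>) (use t in blast)
      show "c + int q *s t \<in> {x. x \<in> {a..b} \<and> base x = c}"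
        using t by (auto simp: base_def 1 less_eq_vec_def)
    qed
    also have "norm \<dots> \<le> M"
    proof (rule assms(5))
      show "{lo i..hi i} \<subseteq> {0..<int T}" for i by (auto simp: lo_def hi_def)
    qed (use c0 c2 in auto)
    finally show "norm (\<Sum>x | x \<in> {a..b} \<and> base x = c. g x) \<le> M" .
  qed
  also have "\<dots> = real (card \<B>) * M" by simp
  also have "\<dots> \<le> (2 * real_of_int N / T) ^ CARD('n) * M"
  proof (rule mult_right_mono)
    have "real (card \<B>) = real (card \<beta>) ^ CARD('n)" unfolding \<B>_def using fin_\<beta> by (simp add: card_vec_set)
    also have "\<dots> \<le> (2 * real_of_int N / T) ^ CARD('n)" by (intro power_mono card_\<beta>) auto
    finally show "real (card \<B>) \<le> (2 * real_of_int N / T) ^ CARD('n)" .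
    \<comment> \<open>Nonnegativity of M comes from the hypothesis applied to an empty
      block.\<close>
    have "norm (\<Sum>t | \<forall>i. t $ i \<in> {1..0}. g (0 + int q *s t)) \<le> M"
      using Npos by (intro assms(5)) auto
    then show "0 \<le> M" by (meson norm_ge_zero order_trans)
  qed
  finally show ?thesis .
qed

section \<open>The phase after l - 1 differences\<close>

definition phase :: "nat \<Rightarrow> (nat \<Rightarrow> nat) \<Rightarrow> (nat \<Rightarrow> nat \<Rightarrow> 'n::finite int_mpoly)
    \<Rightarrow> (nat \<Rightarrow> nat \<Rightarrow> real) \<Rightarrow> int ^ 'n \<Rightarrow> real" where
  "phase d r u \<alpha> x = (\<Sum>j=1..d. \<Sum>s=1..r j. \<alpha> j s * of_int (mpoly_eval (u j s) x))"

text \<open>Up to sign, the i-th coefficient of the linear form that is left of the degree l part of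
  the phase after differencing in the directions h 1, ..., h (l - 1): the \<alpha> l s paired with
  the polarised forms at (h 1, ..., h (l - 1), e_i). Entry l of h is overwritten by e_i.\<close>

definition polar_coeff :: "(nat \<Rightarrow> nat) \<Rightarrow> (nat \<Rightarrow> nat \<Rightarrow> 'n::finite int_mpoly)
    \<Rightarrow> (nat \<Rightarrow> nat \<Rightarrow> real) \<Rightarrow> nat \<Rightarrow> (nat \<Rightarrow> int ^ 'n) \<Rightarrow> 'n \<Rightarrow> real" where
  "polar_coeff r u \<alpha> l h i = (\<Sum>s=1..r l. \<alpha> l s *
     of_int (mixed_diff {1..l} (h(l := axis i 1)) (mpoly_eval (u l s)) 0))"

lemma mixed_diff_phase:
  "mixed_diff I h (phase d r u \<alpha>) x
    = (\<Sum>j=1..d. \<Sum>s=1..r j. \<alpha> j s * of_int (mixed_diff I h (mpoly_eval (u j s)) x))"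
proof -
  have "mixed_diff I h (phase d r u \<alpha>) x
    = mixed_diff I h (\<lambda>x. \<Sum>j=1..d. \<Sum>s=1..r j. \<alpha> j s * of_int (mpoly_eval (u j s) x)) x"
    by (simp add: phase_def[abs_def])
  then show ?thesis by (simp only: mixed_diff_sum mixed_diff_mult mixed_diff_of_int)
qed

text \<open>After l - 1 differences degree l has become affine, and the slope in direction i is one
  more difference, along e_i. The sign comes from the convention f x - f (x + h).\<close>

lemma mixed_diff_degree:
  fixes p :: "'n::finite int_mpoly" and h :: "nat \<Rightarrow> int ^ 'n"
  assumes "mpoly_degree p = l" "1 \<le> l"
  shows "(mixed_diff {1..l - 1} h (mpoly_eval p) (x + y) :: int) - mixed_diff {1..l - 1} h (mpoly_eval p) x
    = - (\<Sum>i\<in>UNIV. y $ i * mixed_diff {1..l} (h(l := axis i 1)) (mpoly_eval p) 0)"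
proof -
  define g where "g = (mixed_diff {1..l - 1} h (mpoly_eval p) :: _ \<Rightarrow> int)"
  have "poly_deg_le 1 g" unfolding g_def
    using poly_deg_le_mpoly_eval[of p] assms by (intro poly_deg_le_mixed_diff) auto
  note aff = poly_deg_le_1_affine[OF this]
  have "mixed_diff {1..l} (h(l := axis i 1)) (mpoly_eval p) 0 = g 0 - g (axis i 1)" for i
  proof -
    have I: "{1..l} = insert l {1..l - 1}" using assms by auto
    have "mixed_diff {1..l - 1} (h(l := axis i 1)) (mpoly_eval p) = g"
      unfolding g_def using assms by (intro mixed_diff_cong) auto
    then show ?thesis unfolding I by (subst mixed_diff_insert) (use assms in auto)
  qed
  then show ?thesis unfolding g_def[symmetric] using aff[of "x + y"] aff[of x]
    by (simp add: distrib_right sum.distrib)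
qed

abbreviation approximates :: "(nat \<Rightarrow> nat) \<Rightarrow> (nat \<Rightarrow> nat \<Rightarrow> real) \<Rightarrow> real \<Rightarrow> nat set \<Rightarrow> real \<Rightarrow> nat \<Rightarrow> bool" where
  "approximates r \<alpha> P J \<theta> q \<equiv> \<forall>j\<in>J. \<forall>s\<in>{1..r j}. dist_int (real q * \<alpha> j s) \<le> P powr (- real j + \<theta>)"

text \<open>Along a progression c + q * t the increments of degree below l vanish, degree l
  contributes a linear form with coefficients - q * \<lambda>_i, and the increments of higher degree
  are divisible by q, so that modulo 1 each \<alpha> may be replaced by its approximation error over
  q. This error term is what \<open>mult_bound_exp\<close> removes. The constant E depends on the
  system and l alone, as the bound is summed over all h later on.\<close>

lemma inner_sum_bound:
  fixes u :: "nat \<Rightarrow> nat \<Rightarrow> 'n::finite int_mpoly"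
  assumes sys: "is_system d r u" and l: "1 \<le> l" "l \<le> d"
  shows "\<exists>E>0. \<forall>P \<theta> \<alpha> q T h a b. 1 \<le> P \<longrightarrow> 1 \<le> q \<longrightarrow> 1 \<le> T \<longrightarrow> real q * real T \<le> P powr (1 - \<theta>) \<longrightarrow> 0 \<le> \<theta> \<longrightarrow>
    (approximates r \<alpha> P {l<..d} \<theta> q) \<longrightarrow>
    (\<forall>k\<in>{1..l - 1}. \<forall>i. \<bar>real_of_int (h k $ i)\<bar> \<le> P) \<longrightarrow> {a..b} \<subseteq> {0..\<chi> i. \<lfloor>P\<rfloor>} \<longrightarrow>
    norm (\<Sum>x\<in>{a..b}. e_fun (mixed_diff {1..l - 1} h (phase d r u \<alpha>) x))
      \<le> E * (\<Prod>i\<in>UNIV. P / T * geom_bound T (real q * polar_coeff r u \<alpha> l h i))"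
proof -
  define A0 where "A0 = (\<Sum>j\<in>{l<..d}. \<Sum>s\<in>{1..r j}. 2 ^ (l - 1) * coeff_norm (u j s) * real j * (real l + 3) ^ j)"
  \<comment> \<open>The exponential pays for removing the higher degrees; 4^n is 2^n from the number
    of base points times 2^n from the factors 2 * geom_bound.\<close>
  define E where "E = exp (2 * pi * A0) * 4 ^ CARD('n)"
  show ?thesis
  proof (intro exI[of _ E] conjI allI impI)
    show "E > 0" by (simp add: E_def)
    fix P \<theta> :: real and \<alpha> and q T :: nat and h :: "nat \<Rightarrow> int ^ 'n" and a b :: "int ^ 'n"
    assume P: "1 \<le> P" and q: "1 \<le> q" and T: "1 \<le> T" and qT: "real q * real T \<le> P powr (1 - \<theta>)"
      and \<theta>: "0 \<le> \<theta>"
      and maj: "approximates r \<alpha> P {l<..d} \<theta> q"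
      and h: "\<forall>k\<in>{1..l - 1}. \<forall>i. \<bar>real_of_int (h k $ i)\<bar> \<le> P" and ab: "{a..b} \<subseteq> {0..\<chi> i. \<lfloor>P\<rfloor>}"
    define I where "I = {1..l - 1}"
    define D where "D j s x = (mixed_diff I h (mpoly_eval (u j s)) x :: int)" for j s x
    define G where "G x = mixed_diff I h (phase d r u \<alpha>) x" for x
    define lam where "lam i = polar_coeff r u \<alpha> l h i" for i
    define be where "be j s = real q * \<alpha> j s - of_int (round (real q * \<alpha> j s))" for j s
    \<comment> \<open>Room for the coordinates that occur: 2 P for the base point, l * P for the
      shifts by sums of the h k, and P for the block.\<close>
    define V where "V = (real l + 3) * P"
    define M where "M = exp (2 * pi * A0) * (\<Prod>i\<in>UNIV. 2 * geom_bound T (real q * lam i))"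
    have G: "G x = (\<Sum>j=1..d. \<Sum>s=1..r j. \<alpha> j s * of_int (D j s x))" for x
      by (simp add: G_def D_def mixed_diff_phase)
    have P1: "P powr (1 - \<theta>) \<le> P" using P \<theta> powr_mono[of "1 - \<theta>" 1 P] by simp
    have qTP: "real q * real T \<le> P" using qT P1 by linarith
    have deg: "mpoly_degree (u j s) = j" if "j \<in> {1..d}" "s \<in> {1..r j}" for j s
      using sys that by (simp add: is_system_def)
    have block: "norm (\<Sum>t | \<forall>i. t $ i \<in> {lo i..hi i}. e_fun (G (c + int q *s t))) \<le> M"
      if c: "\<And>i. 0 \<le> c $ i" "\<And>i. c $ i \<le> 2 * \<lfloor>P\<rfloor>" and X: "\<And>i. {lo i..hi i} \<subseteq> {0..<int T}" for c lo hi
    proof -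
      define X' where "X' i = {lo i..hi i}" for i
      define z where "z i t = e_fun (- (real q * lam i) * of_int t)" for i t
      define K where "K = (\<Prod>i\<in>UNIV. 2 * geom_bound T (- (real q * lam i)))"
      define \<phi> where "\<phi> t = (\<Sum>j\<in>{l<..d}. \<Sum>s\<in>{1..r j}. be j s / q * of_int (D j s (c + int q *s t) - D j s c))" for t
      have cP: "\<bar>real_of_int (c $ i)\<bar> \<le> 2 * P" for i using c[of i] P by linarith
      have "G (c + int q *s t) - (G c + (\<Sum>i\<in>UNIV. - (real q * lam i) * of_int (t $ i)) + \<phi> t) \<in> \<int>" for t
      proof -
        define \<delta> where "\<delta> j s = D j s (c + int q *s t) - D j s c" for j s
        have low: "\<delta> j s = 0" if "j \<in> {1..<l}" "s \<in> {1..r j}" for j s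
        proof -
          have "poly_deg_le (card I) (mpoly_eval (u j s) :: int ^ 'n \<Rightarrow> int)"
            using deg[of j s] that l by (intro poly_deg_le_mono[OF poly_deg_le_mpoly_eval]) (auto simp: I_def)
          then have "mixed_diff I h (mpoly_eval (u j s)) x = (mixed_diff I h (mpoly_eval (u j s)) y :: int)" for x y
            by (intro mixed_diff_const_x) (auto simp: I_def)
          then show ?thesis unfolding \<delta>_def D_def by simp
        qed
        have mid: "\<delta> l s = - (\<Sum>i\<in>UNIV. (int q *s t) $ i * mixed_diff {1..l} (h(l := axis i 1)) (mpoly_eval (u l s)) 0)"
          if "s \<in> {1..r l}" for s
          unfolding \<delta>_def D_def I_def by (rule mixed_diff_degree) (use deg that l in auto)
        have "(\<Sum>s=1..r l. \<alpha> l s * of_int (\<delta> l s)) = (\<Sum>s=1..r l. \<Sum>i\<in>UNIV.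
            - (real q * of_int (t $ i)) * (\<alpha> l s * of_int (mixed_diff {1..l} (h(l := axis i 1)) (mpoly_eval (u l s)) 0)))"
          by (rule sum.cong[OF refl]) (simp add: mid sum_distrib_left sum_negf mult_ac)
        also have "\<dots> = (\<Sum>i\<in>UNIV. - (real q * lam i) * of_int (t $ i))"
          unfolding lam_def polar_coeff_def
          by (subst sum.swap) (simp add: sum_distrib_left sum_distrib_right sum_negf mult_ac)
        finally have mid': "(\<Sum>s=1..r l. \<alpha> l s * of_int (\<delta> l s)) = (\<Sum>i\<in>UNIV. - (real q * lam i) * of_int (t $ i))" .
        have high: "\<alpha> j s * of_int (\<delta> j s) - be j s / q * of_int (\<delta> j s) \<in> \<int>" for j s
        proof -
          have "int q dvd \<delta> j s" unfolding \<delta>_def D_def by (rule dvd_mixed_diff)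
          then obtain k where k: "\<delta> j s = int q * k" by (elim dvdE)
          have "\<alpha> j s * of_int (\<delta> j s) - be j s / q * of_int (\<delta> j s) = of_int (round (real q * \<alpha> j s) * k)"
            using q by (simp add: be_def k field_simps)
          then show ?thesis by simp
        qed
        have set: "{1..d} = {1..<l} \<union> ({l} \<union> {l<..d})" using l by auto
        have "G (c + int q *s t) - G c = (\<Sum>j\<in>{1..d}. \<Sum>s=1..r j. \<alpha> j s * of_int (\<delta> j s))"
          by (simp add: G \<delta>_def right_diff_distrib sum_subtractf)
        also have "\<dots> = (\<Sum>j\<in>{1..<l}. \<Sum>s=1..r j. \<alpha> j s * of_int (\<delta> j s)) + ((\<Sum>j\<in>{l}. \<Sum>s=1..r j. \<alpha> j s * of_int (\<delta> j s))
           + (\<Sum>j\<in>{l<..d}. \<Sum>s=1..r j. \<alpha> j s * of_int (\<delta> j s)))"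
          unfolding set by (subst sum.union_disjoint, simp, simp, force, subst sum.union_disjoint) auto
        also have "(\<Sum>j\<in>{1..<l}. \<Sum>s=1..r j. \<alpha> j s * of_int (\<delta> j s)) = 0" using low by simp
        finally have "G (c + int q *s t) - (G c + (\<Sum>i\<in>UNIV. - (real q * lam i) * of_int (t $ i)) + \<phi> t)
          = (\<Sum>j\<in>{l<..d}. \<Sum>s=1..r j. \<alpha> j s * of_int (\<delta> j s)) - \<phi> t" using mid' by simp
        also have "\<dots> = (\<Sum>j\<in>{l<..d}. \<Sum>s=1..r j. \<alpha> j s * of_int (\<delta> j s) - be j s / q * of_int (\<delta> j s))"
          unfolding \<phi>_def \<delta>_def by (simp only: sum_subtractf)
        also have "\<dots> \<in> \<int>" by (intro Ints_sum high)
        finally show ?thesis .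
      qed
      from e_fun_cong_int[OF this]
      have e: "e_fun (G (c + int q *s t)) = e_fun (G c) * (exp (2 * of_real pi * \<i> * of_real (\<phi> t)) * (\<Prod>i\<in>UNIV. z i (t $ i)))" for t
        by (simp only: e_fun_add e_fun_sum[OF finite] z_def e_fun_def[of "\<phi> t"] mult_ac)
      have op\<phi>: "mult_op X' T z K (\<lambda>t. of_real (\<phi> t)) A0"
      proof -
        have op_term: "mult_op X' T z K (\<lambda>t. of_real (be j s / q * of_int (D j s (c + int q *s t) - D j s c)))
             (2 ^ (l - 1) * coeff_norm (u j s) * real j * (real l + 3) ^ j)"
          if js: "j \<in> {l<..d}" "s \<in> {1..r j}" for j s
        proof -
          define p where "p = u j s"
          have pj: "mpoly_degree p = j" using deg[of j s] js l by (simp add: p_def)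
          define B where "B = coeff_norm p * real j * (real q * T) * V ^ j / V"
          have V1: "V \<ge> 1" unfolding V_def using P mult_mono[of 1 "real l + 3" 1 P] by simp
          have shift: "mult_op X' T z K (\<lambda>t. of_real (of_int (mpoly_eval p (c + sum h S + int q *s t) - mpoly_eval p (c + sum h S)))) B"
            if S: "S \<subseteq> I" for S
            unfolding B_def pj[symmetric]
          proof (rule mult_op_mpoly_eval)
            fix i
            have "\<bar>real_of_int (sum h S $ i)\<bar> \<le> (\<Sum>k\<in>S. \<bar>real_of_int (h k $ i)\<bar>)"
              by (simp add: sum_abs)
            also have "\<dots> \<le> (\<Sum>k\<in>S. P)" using S h by (intro sum_mono) (auto simp: I_def)
            also have "\<dots> \<le> real l * P"
            proof -
              have "card S \<le> card I" by (rule card_mono) (use S in \<open>auto simp: I_def\<close>)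
              also have "\<dots> \<le> l" by (simp add: I_def)
              finally show ?thesis using P by (simp add: mult_right_mono)
            qed
            finally have "\<bar>real_of_int (sum h S $ i)\<bar> \<le> real l * P" .
            then show "\<bar>real_of_int ((c + sum h S) $ i)\<bar> + real q * real T \<le> V"
              using cP[of i] qTP by (simp add: V_def algebra_simps)
          qed (use T V1 in auto)
          have eq: "D j s (c + int q *s t) - D j s c
             = (\<Sum>S\<in>Pow I. (-1) ^ card S * (mpoly_eval p (c + sum h S + int q *s t) - mpoly_eval p (c + sum h S)))" for t
            by (simp add: D_def mixed_diff_def p_def right_diff_distrib sum_subtractf algebra_simps)
          have "mult_op X' T z K (\<lambda>t. \<Sum>S\<in>Pow I. (-1) ^ card S * of_real (of_int (mpoly_eval p (c + sum h S + int q *s t) - mpoly_eval p (c + sum h S))))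
            (\<Sum>S\<in>Pow I. norm ((-1) ^ card S :: complex) * B)"
            by (intro mult_op_sum mult_op_scale shift) auto
          then have "mult_op X' T z K (\<lambda>t. of_real (of_int (D j s (c + int q *s t) - D j s c))) (2 ^ (l - 1) * B)"
            by (simp add: eq norm_power card_Pow I_def)
          from mult_op_scale[OF this, of "of_real (be j s / q)"]
          have 1: "mult_op X' T z K (\<lambda>t. of_real (be j s / q * of_int (D j s (c + int q *s t) - D j s c)))
              (\<bar>be j s\<bar> / q * (2 ^ (l - 1) * B))"
            by (simp add: norm_divide)
          \<comment> \<open>The estimate that dictates the block length: the error P^(\<theta> - j),
            the slope P^(j - 1) and the length T \<le> P^(1 - \<theta>) multiply to at most
            1.\<close>
          have "\<bar>be j s\<bar> * T * P ^ j / P \<le> 1"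
          proof -
            have "\<bar>be j s\<bar> \<le> P powr (- real j + \<theta>)" using maj js by (auto simp: be_def dist_int_def)
            moreover have "real T \<le> P powr (1 - \<theta>)" using qT q T by (smt (verit) mult_le_cancel_right1 of_nat_1 of_nat_mono)
            ultimately have "\<bar>be j s\<bar> * T \<le> P powr (- real j + \<theta>) * P powr (1 - \<theta>)" by (intro mult_mono) auto
            also have "\<dots> = P powr (1 - real j)" by (simp flip: powr_add)
            also have "\<dots> = P / P ^ j" using P by (simp add: powr_diff powr_realpow)
            finally show ?thesis using P by (simp add: field_simps)
          qed
          moreover have "\<bar>be j s\<bar> / q * (2 ^ (l - 1) * B) = (\<bar>be j s\<bar> * T * P ^ j / P) * (2 ^ (l - 1) * coeff_norm p * real j * (real l + 3) ^ j / (real l + 3))"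
          proof -
            have "x / Q * (c * (k * J * (Q * t) * (w * P) ^ j / (w * P))) = (x * t * P ^ j / P) * (c * k * J * w ^ j / w)"
              if "Q \<noteq> 0" "w \<noteq> 0" for x Q c k J t w :: real
              using that P by (simp add: power_mult_distrib field_simps)
            from this[of "real q" "real l + 3"] show ?thesis using q unfolding B_def V_def by simp
          qed
          moreover have "0 \<le> 2 ^ (l - 1) * coeff_norm p * real j * (real l + 3) ^ j / (real l + 3)" using coeff_norm_nonneg[of p] by simp
          ultimately have "\<bar>be j s\<bar> / q * (2 ^ (l - 1) * B) \<le> 1 * (2 ^ (l - 1) * coeff_norm p * real j * (real l + 3) ^ j / (real l + 3))"
            by (metis mult_right_mono)
          also have "\<dots> \<le> 2 ^ (l - 1) * coeff_norm p * real j * (real l + 3) ^ j / 1"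
            unfolding mult_1 using coeff_norm_nonneg[of p] by (intro divide_left_mono) auto
          finally show ?thesis using mult_op_mono[OF 1] by (simp add: p_def)
        qed
        have "mult_op X' T z K (\<lambda>t. \<Sum>j\<in>{l<..d}. \<Sum>s\<in>{1..r j}. of_real (be j s / q * of_int (D j s (c + int q *s t) - D j s c))) A0"
          unfolding A0_def by (intro mult_op_sum op_term)
        then show ?thesis by (simp add: \<phi>_def)
      qed
      have "mult_bound X' T z K (\<lambda>x. 1) 1"
        unfolding X'_def z_def K_def by (rule mult_bound_1) (rule X)
      moreover have "mult_op X' T z K (\<lambda>t. 2 * of_real pi * \<i> * of_real (\<phi> t)) (2 * pi * A0)"
        using mult_op_scale[OF op\<phi>, of "2 * of_real pi * \<i>"] by (simp add: norm_mult)
      ultimately have "mult_bound X' T z K (\<lambda>t. exp (2 * of_real pi * \<i> * of_real (\<phi> t)) * 1) (exp (2 * pi * A0) * 1)"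
        by (rule mult_bound_exp[rotated])
      then have "norm (\<Sum>t | \<forall>i. t $ i \<in> X' i. exp (2 * of_real pi * \<i> * of_real (\<phi> t)) * (\<Prod>i\<in>UNIV. z i (t $ i))) \<le> exp (2 * pi * A0) * K"
        unfolding mult_bound_def by (auto dest!: spec[of _ "\<lambda>i. 0"])
      then show ?thesis unfolding e sum_distrib_left[symmetric] norm_mult
        by (simp add: M_def K_def X'_def)
    qed
    have "norm (\<Sum>x\<in>{a..b}. e_fun (G x)) \<le> (2 * real_of_int \<lfloor>P\<rfloor> / T) ^ CARD('n) * M"
    proof (rule block_decomposition_bound[OF q T _ ab])
      show "int (q * T) \<le> \<lfloor>P\<rfloor>" using qTP by (simp add: le_floor_iff)
    qed (rule block)
    also have "\<dots> \<le> (2 * P / T) ^ CARD('n) * M"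
      using P by (intro mult_right_mono power_mono divide_right_mono) (auto simp: M_def intro!: mult_nonneg_nonneg prod_nonneg)
    also have "\<dots> = E * (\<Prod>i\<in>UNIV. P / T * geom_bound T (real q * lam i))"
    proof -
      have "(4 :: real) ^ CARD('n) = 2 ^ CARD('n) * 2 ^ CARD('n)" by (simp flip: power_mult_distrib)
      then show ?thesis by (simp only: M_def E_def prod.distrib prod_constant power_mult_distrib power_divide) simp
    qed
    finally show "norm (\<Sum>x\<in>{a..b}. e_fun (mixed_diff {1..l - 1} h (phase d r u \<alpha>) x))
      \<le> E * (\<Prod>i\<in>UNIV. P / T * geom_bound T (real q * polar_coeff r u \<alpha> l h i))"
      by (simp add: G_def I_def lam_def)
  qed
qed

subsection \<open>Contraction for symmetric systems of linear forms\<close>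

definition int_cube :: "real \<Rightarrow> (int ^ 'n::finite) set" where
  "int_cube A = {y. \<forall>i. \<bar>real_of_int (y $ i)\<bar> \<le> A}"

lemma int_cube_eq: "int_cube A = {y :: int ^ 'n::finite. \<forall>i. y $ i \<in> {- \<lfloor>A\<rfloor>..\<lfloor>A\<rfloor>}}"
proof -
  have "\<bar>real_of_int t\<bar> \<le> A \<longleftrightarrow> t \<in> {- \<lfloor>A\<rfloor>..\<lfloor>A\<rfloor>}" for t
    unfolding atLeastAtMost_iff abs_le_iff le_floor_iff minus_le_iff[of "\<lfloor>A\<rfloor>"] of_int_minus by auto
  then show ?thesis by (simp add: int_cube_def)
qed

lemma finite_int_cube [simp]: "finite (int_cube A)"
  unfolding int_cube_eq by (rule finite_vec_set) simp

lemma card_int_cube: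
  assumes "0 \<le> A"
  shows "real (card (int_cube A :: (int ^ 'n::finite) set)) = (2 * of_int \<lfloor>A\<rfloor> + 1) ^ CARD('n)"
proof -
  have "card (int_cube A :: (int ^ 'n) set) = nat (2 * \<lfloor>A\<rfloor> + 1) ^ CARD('n)"
    unfolding int_cube_eq by (subst card_vec_set) simp_all
  then show ?thesis using assms by simp
qed

text \<open>Subtracting one fixed member embeds the fibre into D. In this way counts of
  inhomogeneous conditions are reduced to counts of homogeneous ones.\<close>

lemma card_fibre_le:
  fixes \<kappa> :: "'a::ab_group_add \<Rightarrow> 'b"
  assumes "finite D" "\<And>y y'. y \<in> S \<Longrightarrow> y' \<in> S \<Longrightarrow> \<kappa> y = \<kappa> y' \<Longrightarrow> y - y' \<in> D"
  shows "card {y \<in> S. \<kappa> y = c} \<le> card D"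
proof (cases "{y \<in> S. \<kappa> y = c} = {}")
  case False
  then obtain y0 where y0: "y0 \<in> S" "\<kappa> y0 = c" by blast
  show ?thesis
    by (rule card_inj_on_le[of "\<lambda>y. y - y0"]) (use assms y0 in \<open>auto simp: inj_on_def\<close>)
qed (simp only: card.empty)

lemma card_le_cells:
  fixes \<kappa> :: "'a::ab_group_add \<Rightarrow> 'b"
  assumes "finite D" "finite S" "finite C" "\<kappa> ` S \<subseteq> C"
    and "\<And>y y'. y \<in> S \<Longrightarrow> y' \<in> S \<Longrightarrow> \<kappa> y = \<kappa> y' \<Longrightarrow> y - y' \<in> D"
  shows "card S \<le> card C * card D"
proof -
  have "card S = (\<Sum>c\<in>C. card {y \<in> S. \<kappa> y = c})"
    using sum.group[OF assms(2-4), of "\<lambda>_. 1::nat"] by simp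
  also have "\<dots> \<le> (\<Sum>c\<in>C. card D)" by (intro sum_mono card_fibre_le assms) auto
  finally show ?thesis by simp
qed

text \<open>For a symmetric matrix the vectors \<open>(y / A, (m y - k) / w)\<close> with \<open>k\<close> integral pair
  integrally under the standard symplectic form, up to the factor \<open>A * w\<close>. When \<open>A * w\<close> is small the
  pairing vanishes, so the vectors counted span an isotropic subspace, of dimension at most \<open>n\<close>.\<close>

lemma symplectic_pairing_zero:
  fixes m :: "'n::finite \<Rightarrow> 'n \<Rightarrow> real" and y y' k k' :: "int ^ 'n" and A w :: real
  assumes sym: "\<And>i j. m i j = m j i" and pos: "0 < A" "0 < w" and small: "A * w * (4 * CARD('n)) \<le> 1"
    and v: "\<And>i. \<bar>real_of_int (y $ i)\<bar> \<le> A" "\<And>i. \<bar>(\<Sum>j\<in>UNIV. m i j * y $ j) - k $ i\<bar> \<le> w"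
    and v': "\<And>i. \<bar>real_of_int (y' $ i)\<bar> \<le> A" "\<And>i. \<bar>(\<Sum>j\<in>UNIV. m i j * y' $ j) - k' $ i\<bar> \<le> w"
  shows "(\<Sum>i\<in>UNIV. y $ i * ((\<Sum>j\<in>UNIV. m i j * y' $ j) - k' $ i)) = (\<Sum>i\<in>UNIV. y' $ i * ((\<Sum>j\<in>UNIV. m i j * y $ j) - k $ i))"
proof -
  let ?P = "\<Sum>i\<in>UNIV. y $ i * ((\<Sum>j\<in>UNIV. m i j * y' $ j) - k' $ i)"
  let ?Q = "\<Sum>i\<in>UNIV. y' $ i * ((\<Sum>j\<in>UNIV. m i j * y $ j) - k $ i)"
  have "(\<Sum>i\<in>UNIV. \<Sum>j\<in>UNIV. y $ i * (m i j * y' $ j)) = (\<Sum>j\<in>UNIV. \<Sum>i\<in>UNIV. y $ i * (m i j * y' $ j))"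
    by (rule sum.swap)
  also have "\<dots> = (\<Sum>j\<in>UNIV. \<Sum>i\<in>UNIV. y' $ j * (m j i * y $ i))"
    by (intro sum.cong refl) (simp add: sym[of _ "_"] mult_ac)
  finally have "?P - ?Q = of_int (\<Sum>i\<in>UNIV. y' $ i * k $ i - y $ i * k' $ i)"
    by (simp add: right_diff_distrib sum_subtractf sum_distrib_left)
  moreover have "\<bar>?P - ?Q\<bar> < 1"
  proof -
    have b: "\<bar>\<Sum>i\<in>UNIV. f i * g i\<bar> \<le> CARD('n) * (A * w)" if "\<And>i. \<bar>f i\<bar> \<le> A" "\<And>i. \<bar>g i\<bar> \<le> w" for f g :: "'n \<Rightarrow> real"
    proof -
      have "\<bar>\<Sum>i\<in>UNIV. f i * g i\<bar> \<le> (\<Sum>i\<in>(UNIV :: 'n set). A * w)"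
        by (rule order.trans[OF sum_abs sum_mono]) (use that pos in \<open>simp add: abs_mult mult_mono\<close>)
      then show ?thesis by simp
    qed
    have "\<bar>?P\<bar> \<le> CARD('n) * (A * w)" "\<bar>?Q\<bar> \<le> CARD('n) * (A * w)"
      by (rule b; use v v' in simp)+
    then show ?thesis using small by (simp add: algebra_simps)
  qed
  ultimately have "?P - ?Q = 0" by (metis of_int_0 of_int_abs of_int_less_1_iff abs_zero zabs_less_one_iff)
  then show ?thesis by simp
qed

text \<open>The rotation J turns the symplectic pairing into the inner product, so an isotropic S is
  orthogonal to J S, which has the same dimension, and both fit into dimension 2 n.\<close>

lemma dim_isotropic_le:
  fixes S :: "((real ^ 'n::finite) \<times> (real ^ 'n)) set"
  assumes "\<And>v v'. v \<in> S \<Longrightarrow> v' \<in> S \<Longrightarrow> fst v \<bullet> snd v' = fst v' \<bullet> snd v"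
  shows "dim S \<le> CARD('n)"
proof -
  define J :: "(real ^ 'n) \<times> (real ^ 'n) \<Rightarrow> (real ^ 'n) \<times> (real ^ 'n)" where "J v = (- snd v, fst v)" for v
  have lin: "linear J" by (rule linearI) (auto simp: J_def)
  have inj: "inj J" by (auto simp: inj_def J_def prod_eq_iff)
  have orth: "orthogonal v (J v')" if "v \<in> S" "v' \<in> S" for v v'
    using assms[OF that] by (simp add: orthogonal_def J_def inner_prod_def inner_commute)
  have "dim (S \<union> J ` S) = dim S + dim (J ` S)"
    by (rule dim_orthogonal_sum) (use orth in \<open>auto simp: orthogonal_def\<close>)
  moreover have "dim (J ` S) = dim S" by (rule dim_image_eq[OF lin]) (use inj in \<open>auto intro: inj_on_subset\<close>)
  moreover have "dim (S \<union> J ` S) \<le> DIM((real ^ 'n) \<times> (real ^ 'n))" by (rule dim_subset_UNIV)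
  ultimately show ?thesis by simp
qed

text \<open>The coordinates in an orthonormal basis of the span are cut at mesh \<rho> / n, so two
  members of a cell are at distance at most \<rho>. The exponent is governed by the dimension of the
  span, not by that of the ambient space.\<close>

lemma card_bounded_span_cells:
  fixes f :: "'a::ab_group_add \<Rightarrow> 'e::euclidean_space"
  assumes "finite D" "finite S" and dim: "dim (f ` S) \<le> n" and "0 < n"
    and bd: "\<And>y. y \<in> S \<Longrightarrow> norm (f y) \<le> B" and B: "0 \<le> B" and \<rho>: "0 < \<rho>" "\<rho> \<le> 1"
    and close: "\<And>y y'. y \<in> S \<Longrightarrow> y' \<in> S \<Longrightarrow> norm (f y - f y') \<le> \<rho> \<Longrightarrow> y - y' \<in> D"
  shows "real (card S) \<le> ((2 * B * n + 2) / \<rho>) ^ n * card D"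
proof -
  obtain Bs where Bs: "pairwise orthogonal Bs" "\<And>x. x \<in> Bs \<Longrightarrow> norm x = 1" "independent Bs"
      "card Bs = dim (span (f ` S))" "span Bs = span (f ` S)"
    using orthonormal_basis_subspace[of "span (f ` S)"] by (metis subspace_span)
  have finB: "finite Bs" using Bs(3) by (rule independent_imp_finite)
  have cardB: "card Bs \<le> n" using Bs(4) dim by (simp add: dim_span)
  define \<delta> where "\<delta> = \<rho> / n"
  have \<delta>: "\<delta> > 0" using \<rho> assms(4) by (simp add: \<delta>_def)
  define \<kappa> where "\<kappa> y = (\<lambda>b\<in>Bs. \<lfloor>(f y \<bullet> b) / \<delta>\<rfloor>)" for y
  define W where "W = {\<lfloor>- (B / \<delta>)\<rfloor>..\<lfloor>B / \<delta>\<rfloor>}"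
  have "card S \<le> card (Bs \<rightarrow>\<^sub>E W) * card D"
  proof (rule card_le_cells[where \<kappa> = \<kappa>])
    show "finite (Bs \<rightarrow>\<^sub>E W)" using finB by (intro finite_PiE) (auto simp: W_def)
    show "\<kappa> ` S \<subseteq> Bs \<rightarrow>\<^sub>E W"
    proof (intro image_subsetI PiE_I)
      fix y b assume y: "y \<in> S" and b: "b \<in> Bs"
      have "\<bar>f y \<bullet> b\<bar> \<le> norm (f y) * norm b" by (rule Cauchy_Schwarz_ineq2)
      also have "\<dots> \<le> B" using bd[OF y] Bs(2)[OF b] by simp
      finally have "- B \<le> f y \<bullet> b" "f y \<bullet> b \<le> B" by auto
      then have "- (B / \<delta>) \<le> (f y \<bullet> b) / \<delta>" "(f y \<bullet> b) / \<delta> \<le> B / \<delta>"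
        using \<delta> by (auto simp: field_simps)
      then show "\<kappa> y b \<in> W" using b by (auto simp: \<kappa>_def W_def intro: floor_mono)
    qed (auto simp: \<kappa>_def)
  next
    fix y y' assume y: "y \<in> S" "y' \<in> S" "\<kappa> y = \<kappa> y'"
    define v where "v = f y - f y'"
    have vspan: "v \<in> span Bs" unfolding Bs(5) v_def using y by (intro span_diff span_base) auto
    have coord: "\<bar>v \<bullet> b\<bar> \<le> \<delta>" if b: "b \<in> Bs" for b
    proof -
      have "\<lfloor>(f y \<bullet> b) / \<delta>\<rfloor> = \<lfloor>(f y' \<bullet> b) / \<delta>\<rfloor>" using fun_cong[OF y(3), of b] b by (simp add: \<kappa>_def)
      then have "\<bar>(f y \<bullet> b) / \<delta> - (f y' \<bullet> b) / \<delta>\<bar> \<le> 1" by linarith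
      also have "(f y \<bullet> b) / \<delta> - (f y' \<bullet> b) / \<delta> = (v \<bullet> b) / \<delta>" by (simp add: v_def inner_diff_left diff_divide_distrib)
      finally show ?thesis using \<delta> by (simp add: pos_divide_le_eq)
    qed
    have v: "(\<Sum>b\<in>Bs. (v \<bullet> b) *\<^sub>R b) = v"
      by (rule orthonormal_basis_expand[OF Bs(1,2) vspan finB])
    have "norm v \<le> (\<Sum>b\<in>Bs. norm ((v \<bullet> b) *\<^sub>R b))" by (subst v[symmetric]) (rule norm_sum)
    also have "\<dots> \<le> (\<Sum>b\<in>Bs. \<delta>)" using Bs(2) coord by (intro sum_mono) auto
    also have "\<dots> \<le> n * \<delta>" using cardB \<delta> by (simp add: mult_right_mono)
    also have "\<dots> = \<rho>" using assms(4) by (simp add: \<delta>_def)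
    finally show "y - y' \<in> D" using close y by (simp add: v_def)
  qed (use assms in auto)
  then have "real (card S) \<le> real (card (Bs \<rightarrow>\<^sub>E W) * card D)" by (rule of_nat_mono)
  also have "\<dots> = real (card W) ^ card Bs * card D" using finB by (simp add: card_PiE)
  also have "\<dots> \<le> ((2 * B * n + 2) / \<rho>) ^ n * card D"
  proof (rule mult_right_mono)
    have "\<lfloor>- (B / \<delta>)\<rfloor> \<le> \<lfloor>B / \<delta>\<rfloor>" using B \<delta> by (intro floor_mono) (auto intro: order.trans[of _ 0])
    then have "real (card W) = of_int (\<lfloor>B / \<delta>\<rfloor> - \<lfloor>- (B / \<delta>)\<rfloor> + 1)" by (simp add: W_def)
    also have "\<dots> \<le> 2 * (B / \<delta>) + 2" by linarith
    also have "\<dots> = (2 * B * n + 2 * \<rho>) / \<rho>" using \<rho> assms(4) by (simp add: \<delta>_def field_simps)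
    also have "\<dots> \<le> (2 * B * n + 2) / \<rho>" using \<rho> by (intro divide_right_mono) auto
    finally have W: "real (card W) \<le> (2 * B * n + 2) / \<rho>" .
    have "1 \<le> (2 * B * n + 2) / \<rho>" 
    proof -
      have "0 \<le> 2 * B * n" using B by simp
      then have "\<rho> \<le> 2 * B * n + 2" using \<rho> by linarith
      then show ?thesis using \<rho> by (simp add: pos_le_divide_eq)
    qed
    then have "real (card W) ^ card Bs \<le> ((2 * B * n + 2) / \<rho>) ^ card Bs" "((2 * B * n + 2) / \<rho>) ^ card Bs \<le> ((2 * B * n + 2) / \<rho>) ^ n"
      using W cardB by (auto intro: power_mono power_increasing)
    then show "real (card W) ^ card Bs \<le> ((2 * B * n + 2) / \<rho>) ^ n" by linarith
  qed simp
  finally show ?thesis .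
qed

text \<open>A form of Davenport's shrinking lemma, which is usually derived from the duality of
  successive minima. In dimension 2 n a contraction by z would cost z^(-2 n); as the rescaled points
  f y span an isotropic space, of dimension at most n, it costs z^(-n), the very factor by which the
  cube for y loses volume. These points have norm at most 2 n, whence the constant 4 n^2 +
  2.\<close>

lemma symmetric_shrink:
  fixes m :: "'n::finite \<Rightarrow> 'n \<Rightarrow> real" and A w z :: real
  assumes sym: "\<And>i j. m i j = m j i" and pos: "0 < A" "0 < w" and small: "A * w * (4 * CARD('n)) \<le> 1"
    and z: "0 < z" "z \<le> 1"
  shows "real (card {y \<in> int_cube A. \<forall>i. dist_int (\<Sum>j\<in>UNIV. m i j * of_int (y $ j)) \<le> w})
    \<le> ((4 * real CARD('n) ^ 2 + 2) / z) ^ CARD('n) *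
      real (card {y \<in> int_cube (z * A). \<forall>i. dist_int (\<Sum>j\<in>UNIV. m i j * of_int (y $ j)) \<le> z * w})"
proof -
  define L where "L y i = (\<Sum>j\<in>UNIV. m i j * real_of_int (y $ j))" for y :: "int ^ 'n" and i
  define k :: "int ^ 'n \<Rightarrow> int ^ 'n" where "k y = (\<chi> i. round (L y i))" for y
  define S where "S = {y \<in> int_cube A. \<forall>i. dist_int (L y i) \<le> w}"
  define D where "D = {y \<in> int_cube (z * A). \<forall>i. dist_int (L y i) \<le> z * w}"
  define f :: "int ^ 'n \<Rightarrow> (real ^ 'n) \<times> (real ^ 'n)" where
    "f y = ((\<chi> i. of_int (y $ i) / A), (\<chi> i. (L y i - of_int (k y $ i)) / w))" for y
  have S: "\<bar>real_of_int (y $ i)\<bar> \<le> A" "\<bar>L y i - of_int (k y $ i)\<bar> \<le> w" if "y \<in> S" for y i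
    using that by (auto simp: S_def int_cube_def k_def dist_int_def)
  have "dim (f ` S) \<le> CARD('n)"
  proof (rule dim_isotropic_le)
    fix v v' assume "v \<in> f ` S" "v' \<in> f ` S"
    then obtain y y' where y: "y \<in> S" "v = f y" and y': "y' \<in> S" "v' = f y'" by blast
    have "(\<Sum>i\<in>UNIV. y $ i * (L y' i - k y' $ i)) = (\<Sum>i\<in>UNIV. y' $ i * (L y i - k y $ i))"
      unfolding L_def by (rule symplectic_pairing_zero[OF sym pos small])
        (use S[OF y(1)] S[OF y'(1)] in \<open>simp_all add: L_def\<close>)
    then show "fst v \<bullet> snd v' = fst v' \<bullet> snd v"
      by (simp add: y(2) y'(2) f_def inner_vec_def flip: sum_divide_distrib)
  qed
  moreover have "norm (f y) \<le> 2 * real CARD('n)" if y: "y \<in> S" for y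
  proof -
    have a: "\<bar>fst (f y) $ i\<bar> \<le> 1" for i
    proof -
      have "\<bar>fst (f y) $ i\<bar> = \<bar>of_int (y $ i)\<bar> / A" using pos by (simp add: f_def)
      also have "\<dots> \<le> 1" unfolding pos_divide_le_eq[OF pos(1)] using S(1)[OF y, of i] by simp
      finally show ?thesis .
    qed
    have b: "\<bar>snd (f y) $ i\<bar> \<le> 1" for i
    proof -
      have "\<bar>snd (f y) $ i\<bar> = \<bar>L y i - of_int (k y $ i)\<bar> / w" using pos by (simp add: f_def)
      also have "\<dots> \<le> 1" unfolding pos_divide_le_eq[OF pos(2)] using S(2)[OF y, of i] by simp
      finally show ?thesis .
    qed
    have l1: "norm x \<le> CARD('n)" if "\<And>i. \<bar>x $ i\<bar> \<le> 1" for x :: "real ^ 'n"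
      using order.trans[OF norm_le_l1_cart[of x] sum_mono[of UNIV "\<lambda>i. \<bar>x $ i\<bar>" "\<lambda>i. 1"]] that by simp
    have 1: "norm (fst (f y)) \<le> CARD('n)" by (rule l1) (rule a)
    have 2: "norm (snd (f y)) \<le> CARD('n)" by (rule l1) (rule b)
    show ?thesis using 1 2 norm_Pair_le[of "fst (f y)" "snd (f y)"] by simp
  qed
  moreover have "y - y' \<in> D" if y: "y \<in> S" "y' \<in> S" and n: "norm (f y - f y') \<le> z" for y y'
  proof -
    have a: "\<bar>fst (f y - f y') $ i\<bar> \<le> z" for i
      using n norm_fst_le[of "fst (f y - f y')" "snd (f y - f y')"] component_le_norm_cart[of "fst (f y - f y')" i]
      unfolding prod.collapse by linarith
    have b: "\<bar>snd (f y - f y') $ i\<bar> \<le> z" for i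
      using n norm_snd_le[of "snd (f y - f y')" "fst (f y - f y')"] component_le_norm_cart[of "snd (f y - f y')" i]
      unfolding prod.collapse by linarith
    have "\<bar>real_of_int ((y - y') $ i)\<bar> \<le> z * A" for i
    proof -
      have "real_of_int ((y - y') $ i) = A * (fst (f y - f y') $ i)" using pos by (simp add: f_def field_simps)
      then show ?thesis using a[of i] pos by (simp add: abs_mult mult.commute)
    qed
    moreover have "dist_int (L (y - y') i) \<le> z * w" for i
    proof -
      have "L (y - y') i = L y i - L y' i" by (simp add: L_def algebra_simps sum_subtractf)
      then have "L (y - y') i - of_int (k y $ i - k y' $ i) = w * (snd (f y - f y') $ i)"
      proof -
        have "w * (a / w - b / w) = a - b" for a b using pos by (simp add: right_diff_distrib)
        moreover have "snd (f y - f y') $ i = (L y i - of_int (k y $ i)) / w - (L y' i - of_int (k y' $ i)) / w"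
          by (simp add: f_def)
        ultimately show ?thesis using \<open>L (y - y') i = L y i - L y' i\<close> by simp
      qed
      then have "\<bar>L (y - y') i - of_int (k y $ i - k y' $ i)\<bar> \<le> z * w"
        using b[of i] pos by (simp add: abs_mult mult.commute)
      then show ?thesis using dist_int_le order.trans by blast
    qed
    ultimately show ?thesis by (simp add: D_def int_cube_def)
  qed
  ultimately have "real (card S) \<le> ((2 * (2 * real CARD('n)) * CARD('n) + 2) / z) ^ CARD('n) * card D"
    using z by (intro card_bounded_span_cells[of D S f "CARD('n)" "2 * real CARD('n)" z]) (auto simp: S_def D_def)
  then show ?thesis by (simp add: S_def D_def L_def power2_eq_square mult_ac)
qed

text \<open>The circle is divided into T cells. In the cells next to an integer the trivial bound T
  is used; elsewhere the distance to the integers is at least min (k, T - 1 - k) / T. One summand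
  serves each end of the unit interval, so that no minimum has to be handled when summing over
  k.\<close>

lemma geom_bound_cell:
  assumes T: "1 \<le> T" and k: "k = \<lfloor>real T * frac x\<rfloor>"
  shows "0 \<le> k" "k < int T" "geom_bound T x \<le> real T / (real_of_int k + 1) + real T / (real T - real_of_int k)"
proof -
  have f: "0 \<le> frac x" "frac x < 1" by (auto simp: frac_ge_0 frac_lt_1)
  have f2: "real_of_int k \<le> T * frac x" "T * frac x < real_of_int k + 1" unfolding k by linarith+
  show k0: "0 \<le> k" unfolding k using f by simp
  have "real T * frac x < real T * 1" using f T by (intro mult_strict_left_mono) auto
  then show kT: "k < int T" using f2 by linarith
  have kT': "real_of_int k + 1 \<le> T" using kT by linarith
  have g: "geom_bound T x \<le> T" by (rule geom_bound_le)
  have nn: "0 \<le> T / (real_of_int k + 1)" "0 \<le> T / (real T - k)" using k0 kT' by auto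
  consider "k = 0" | "k = int T - 1" | "1 \<le> k" "k \<le> int T - 2" using k0 kT by linarith
  then show "geom_bound T x \<le> real T / (real_of_int k + 1) + real T / (real T - real_of_int k)"
  proof cases
    case 1
    then show ?thesis using g nn by simp
  next
    case 2
    then show ?thesis using g nn by simp
  next
    case 3
    have d: "dist_int x = min (frac x) (1 - frac x)"
    proof (rule antisym)
      have "dist_int x \<le> frac x" using dist_int_le[of x "\<lfloor>x\<rfloor>"] f by (simp add: frac_def)
      moreover have "dist_int x \<le> 1 - frac x" using dist_int_le[of x "\<lfloor>x\<rfloor> + 1"] f by (simp add: frac_def)
      ultimately show "dist_int x \<le> min (frac x) (1 - frac x)" by simp
      have "round x \<le> \<lfloor>x\<rfloor> \<or> \<lfloor>x\<rfloor> + 1 \<le> round x" by linarith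
      then show "min (frac x) (1 - frac x) \<le> dist_int x"
        unfolding dist_int_def frac_def by linarith
    qed
    show ?thesis
    proof (cases "frac x \<le> 1 / 2")
      case True
      have "real_of_int k / T \<le> dist_int x" using True f2 T by (simp add: d field_simps)
      then have "geom_bound T x \<le> 1 / (2 * (real_of_int k / T))" using 3 T by (intro geom_bound_le_inverse) auto
      also have "\<dots> = T / (2 * real_of_int k)" by simp
      also have "\<dots> \<le> real T / (real_of_int k + 1)" using 3 by (intro divide_left_mono) auto
      finally show ?thesis using nn by linarith
    next
      case False
      have "(real T - 1 - real_of_int k) / T \<le> dist_int x" using False f2 T by (simp add: d field_simps)
      then have "geom_bound T x \<le> 1 / (2 * ((real T - 1 - real_of_int k) / T))" using 3 T by (intro geom_bound_le_inverse) (auto simp: field_simps)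
      also have "\<dots> = T / (2 * (real T - 1 - real_of_int k))" by simp
      also have "\<dots> \<le> real T / (real T - real_of_int k)" using 3 by (intro divide_left_mono) auto
      finally show ?thesis using nn by linarith
    qed
  qed
qed

lemma sum_cell_bound:
  assumes "1 \<le> T"
  shows "(\<Sum>k\<in>{0..<int T}. real T / (real_of_int k + 1) + real T / (real T - real_of_int k)) = 2 * real T * harm T"
proof -
  have "(\<Sum>k\<in>{0..<int T}. real T / (real_of_int k + 1) + real T / (real T - real_of_int k)) = (\<Sum>k<T. real T / (real k + 1) + real T / (real T - real k))"
    by (rule sum.reindex_bij_witness[of _ int nat]) auto
  also have "\<dots> = (\<Sum>k<T. real T / (real k + 1)) + (\<Sum>k<T. real T / (real T - real k))" by (rule sum.distrib)
  also have "(\<Sum>k<T. real T / (real T - real k)) = (\<Sum>k<T. real T / (real k + 1))"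
    by (rule sum.reindex_bij_witness[of _ "\<lambda>k. T - 1 - k" "\<lambda>k. T - 1 - k"]) (auto simp: of_nat_diff)
  also have "(\<Sum>k<T. real T / (real k + 1)) = T * harm T"
    unfolding harm_def sum_distrib_left
    by (rule sum.reindex_bij_witness[of _ "\<lambda>k. k - 1" Suc]) (auto simp: field_simps)
  finally show ?thesis by simp
qed

text \<open>The y are sorted by the cells of the n fractional parts of v y and by the cubes of side
  A that contain y. Two in one class differ by an element of the set on the right, so every class
  has at most that many members, while the weight is bounded in terms of the class. The sum over the
  cells factors into n harmonic sums; the number of cubes is at most (4 P / A)^n because A \<le>
  P.\<close>

lemma sum_geom_bound_le_count:
  fixes v :: "int ^ 'n::finite \<Rightarrow> 'n \<Rightarrow> real"
  assumes add: "\<And>y y' i. v (y - y') i = v y i - v y' i" and T: "1 \<le> T"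
    and P: "0 \<le> P" and A: "0 < A" "A \<le> P"
  shows "(\<Sum>y\<in>int_cube P. \<Prod>i\<in>UNIV. geom_bound T (v y i))
    \<le> (2 * real T * harm T * (4 * P / A)) ^ CARD('n) *
      real (card {y \<in> int_cube A. \<forall>i. dist_int (v y i) \<le> 1 / T})"
proof -
  define w where "w k = real T / (of_int k + 1) + real T / (T - of_int k)" for k :: int
  define S :: "(int ^ 'n) set" where "S = int_cube P"
  define D where "D = {y \<in> int_cube A. \<forall>i. dist_int (v y i) \<le> 1 / T}"
  define W where "W = {\<lfloor>- (P / A)\<rfloor>..\<lfloor>P / A\<rfloor>}"
  define C1 :: "('n \<Rightarrow> int) set" where "C1 = UNIV \<rightarrow>\<^sub>E {0..<int T}"
  define C2 :: "('n \<Rightarrow> int) set" where "C2 = UNIV \<rightarrow>\<^sub>E W"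
  define \<kappa>1 where "\<kappa>1 y i = \<lfloor>real T * frac (v y i)\<rfloor>" for y i
  define \<kappa>2 where "\<kappa>2 y i = \<lfloor>of_int (y $ i) / A\<rfloor>" for y :: "int ^ 'n" and i
  define \<kappa> where "\<kappa> y = (\<kappa>1 y, \<kappa>2 y)" for y
  have cell: "0 \<le> \<kappa>1 y i" "\<kappa>1 y i < int T" "geom_bound T (v y i) \<le> w (\<kappa>1 y i)" for y i
    using geom_bound_cell[OF T, of "\<kappa>1 y i" "v y i"] by (auto simp: \<kappa>1_def w_def)
  have w0: "0 \<le> w k" if "k \<in> {0..<int T}" for k
    using that by (auto simp: w_def intro!: add_nonneg_nonneg divide_nonneg_nonneg)
  have fin: "finite S" "finite C1" "finite C2" "finite D"
    by (auto simp: S_def C1_def C2_def W_def D_def intro!: finite_PiE)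
  have \<kappa>S: "\<kappa> ` S \<subseteq> C1 \<times> C2"
  proof (rule image_subsetI)
    fix y assume "y \<in> S"
    then have "- P \<le> of_int (y $ i) \<and> of_int (y $ i) \<le> P" for i by (auto simp: S_def int_cube_def abs_le_iff minus_le_iff)
    then have "- (P / A) \<le> of_int (y $ i) / A" "of_int (y $ i) / A \<le> P / A" for i using A by (auto simp: field_simps)
    then have "\<kappa>2 y i \<in> W" for i by (auto simp: \<kappa>2_def W_def intro: floor_mono)
    then show "\<kappa> y \<in> C1 \<times> C2" using cell by (auto simp: \<kappa>_def C1_def C2_def)
  qed
  have fibre: "card {y \<in> S. \<kappa> y = c} \<le> card D" for c
  proof (rule card_fibre_le[OF fin(4)])
    fix y y' assume "y \<in> S" "y' \<in> S" "\<kappa> y = \<kappa> y'"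
    then have 1: "\<kappa>1 y i = \<kappa>1 y' i" and 2: "\<kappa>2 y i = \<kappa>2 y' i" for i by (auto simp: \<kappa>_def dest: fun_cong)
    have "\<bar>real_of_int ((y - y') $ i)\<bar> \<le> A" for i
    proof -
      have "\<bar>of_int (y $ i) / A - of_int (y' $ i) / A\<bar> \<le> 1" using 2[of i] unfolding \<kappa>2_def by linarith
      also have "of_int (y $ i) / A - of_int (y' $ i) / A = of_int ((y - y') $ i) / A" by (simp add: diff_divide_distrib)
      finally show ?thesis using A by (simp add: pos_divide_le_eq)
    qed
    moreover have "dist_int (v (y - y') i) \<le> 1 / T" for i
    proof -
      have "\<bar>real T * frac (v y i) - real T * frac (v y' i)\<bar> \<le> 1" using 1[of i] unfolding \<kappa>1_def by linarith
      then have "real T * \<bar>frac (v y i) - frac (v y' i)\<bar> \<le> 1" by (simp add: abs_mult flip: right_diff_distrib)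
      then have "\<bar>frac (v y i) - frac (v y' i)\<bar> \<le> 1 / T" using T by (simp add: field_simps)
      moreover have "dist_int (v (y - y') i) \<le> \<bar>frac (v y i) - frac (v y' i)\<bar>"
        using dist_int_le[of "v (y - y') i" "\<lfloor>v y i\<rfloor> - \<lfloor>v y' i\<rfloor>"] by (simp add: add frac_def algebra_simps)
      ultimately show ?thesis by linarith
    qed
    ultimately show "y - y' \<in> D" by (simp add: D_def int_cube_def)
  qed
  have "(\<Sum>y\<in>S. \<Prod>i\<in>UNIV. geom_bound T (v y i)) \<le> (\<Sum>y\<in>S. \<Prod>i\<in>UNIV. w (fst (\<kappa> y) i))"
    by (intro sum_mono prod_mono) (auto simp: \<kappa>_def cell)
  also have "\<dots> = (\<Sum>c\<in>C1 \<times> C2. \<Sum>y | y \<in> S \<and> \<kappa> y = c. \<Prod>i\<in>UNIV. w (fst (\<kappa> y) i))"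
    by (rule sum.group[symmetric]) (use fin \<kappa>S in auto)
  also have "\<dots> = (\<Sum>c\<in>C1 \<times> C2. real (card {y \<in> S. \<kappa> y = c}) * (\<Prod>i\<in>UNIV. w (fst c i)))"
    by (intro sum.cong refl) simp
  also have "\<dots> \<le> (\<Sum>c\<in>C1 \<times> C2. real (card D) * (\<Prod>i\<in>UNIV. w (fst c i)))"
    by (intro sum_mono mult_right_mono of_nat_mono fibre prod_nonneg) (auto simp: C1_def intro!: w0)
  also have "\<dots> = real (card D) * (real (card C2) * (\<Sum>c\<in>C1. \<Prod>i\<in>UNIV. w (c i)))"
    by (simp add: sum.cartesian_product' sum_distrib_left mult_ac)
  also have "(\<Sum>c\<in>C1. \<Prod>i\<in>UNIV. w (c i)) = (\<Prod>i\<in>(UNIV :: 'n set). \<Sum>k\<in>{0..<int T}. w k)"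
    unfolding C1_def by (rule prod_sum_PiE[symmetric]) auto
  also have "\<dots> = (2 * real T * harm T) ^ CARD('n)"
    using sum_cell_bound[OF T] by (simp add: w_def)
  also have "real (card D) * (real (card C2) * (2 * real T * harm T) ^ CARD('n))
      \<le> real (card D) * ((4 * P / A) ^ CARD('n) * (2 * real T * harm T) ^ CARD('n))"
  proof (intro mult_left_mono mult_right_mono)
    have "\<lfloor>- (P / A)\<rfloor> \<le> \<lfloor>P / A\<rfloor>" using P A by (intro floor_mono) (auto intro: order.trans[of _ 0])
    then have "real (card W) = of_int (\<lfloor>P / A\<rfloor> - \<lfloor>- (P / A)\<rfloor> + 1)" by (simp add: W_def)
    also have "\<dots> \<le> 2 * (P / A) + 2" by linarith
    also have "\<dots> \<le> 4 * P / A" using A by (simp add: field_simps)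
    finally have W: "real (card W) \<le> 4 * P / A" .
    have "real (card C2) = real (card W) ^ CARD('n)" by (simp add: C2_def card_PiE)
    also have "\<dots> \<le> (4 * P / A) ^ CARD('n)" by (intro power_mono W) auto
    finally show "real (card C2) \<le> (4 * P / A) ^ CARD('n)" .
  qed (auto intro!: zero_le_power mult_nonneg_nonneg harm_nonneg)
  finally show ?thesis unfolding S_def D_def power_mult_distrib[of "2 * real T * harm T"] by (simp only: mult_ac)
qed

section \<open>Counting tuples with small distances\<close>

definition multi_count :: "nat set \<Rightarrow> ((nat \<Rightarrow> int ^ 'n::finite) \<Rightarrow> 'n \<Rightarrow> real) \<Rightarrow> (nat \<Rightarrow> real) \<Rightarrow> real \<Rightarrow> real" where
  "multi_count I \<Lambda> A w = real (card {h \<in> PiE I (\<lambda>k. int_cube (A k)). \<forall>i. dist_int (\<Lambda> h i) \<le> w})"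

lemma multi_count_insert:
  assumes "finite I" "k \<notin> I"
  shows "multi_count (insert k I) \<Lambda> A w
    = (\<Sum>h\<in>PiE I (\<lambda>k. int_cube (A k)). real (card {y \<in> int_cube (A k). \<forall>i. dist_int (\<Lambda> (h(k := y)) i) \<le> w}))"
proof -
  have "multi_count (insert k I) \<Lambda> A w
      = (\<Sum>h\<in>PiE (insert k I) (\<lambda>k. int_cube (A k)). if \<forall>i. dist_int (\<Lambda> h i) \<le> w then 1 else 0)"
    using assms by (simp add: multi_count_def sum.If_cases finite_PiE Int_def)
  also have "\<dots> = (\<Sum>h\<in>PiE I (\<lambda>k. int_cube (A k)). \<Sum>y\<in>int_cube (A k). if \<forall>i. dist_int (\<Lambda> (h(k := y)) i) \<le> w then 1 else 0)"
    by (rule sum_PiE_insert[OF assms(2)])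
  also have "\<dots> = (\<Sum>h\<in>PiE I (\<lambda>k. int_cube (A k)). real (card {y \<in> int_cube (A k). \<forall>i. dist_int (\<Lambda> (h(k := y)) i) \<le> w}))"
    by (simp add: sum.If_cases Int_def)
  finally show ?thesis .
qed

text \<open>With the other variables frozen, \<Lambda> is a symmetric system in the k-th one and
  \<open>symmetric_shrink\<close> applies. The sizes \<open>A\<close> are kept per variable since
  one variable is contracted at a time.\<close>

lemma multi_count_shrink:
  fixes \<Lambda> :: "(nat \<Rightarrow> int ^ 'n::finite) \<Rightarrow> 'n \<Rightarrow> real" and A :: "nat \<Rightarrow> real" and w z :: real
  assumes I: "finite I" "k \<in> I"
    and sym: "\<And>h. \<exists>m. (\<forall>i j. m i j = m j i) \<and> (\<forall>y i. \<Lambda> (h(k := y)) i = (\<Sum>j\<in>UNIV. m i j * of_int (y $ j)))"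
    and pos: "0 < A k" "0 < w" and small: "A k * w * (4 * CARD('n)) \<le> 1" and z: "0 < z" "z \<le> 1"
  shows "multi_count I \<Lambda> A w \<le> ((4 * real CARD('n) ^ 2 + 2) / z) ^ CARD('n) * multi_count I \<Lambda> (A(k := z * A k)) (z * w)"
proof -
  define J where "J = I - {k}"
  have J: "I = insert k J" "finite J" "k \<notin> J" using I by (auto simp: J_def)
  have PiE: "PiE J (\<lambda>j. int_cube ((A(k := z * A k)) j)) = PiE J (\<lambda>j. int_cube (A j) :: (int ^ 'n) set)"
    using J(3) by (intro PiE_cong) auto
  show ?thesis unfolding J(1) multi_count_insert[OF J(2,3)] PiE sum_distrib_left
  proof (rule sum_mono)
    fix h
    obtain m where m: "\<And>i j. m i j = m j i" "\<And>y i. \<Lambda> (h(k := y)) i = (\<Sum>j\<in>UNIV. m i j * of_int (y $ j))"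
      using sym by metis
    show "real (card {y \<in> int_cube (A k). \<forall>i. dist_int (\<Lambda> (h(k := y)) i) \<le> w})
      \<le> ((4 * real CARD('n) ^ 2 + 2) / z) ^ CARD('n) *
        real (card {y \<in> int_cube ((A(k := z * A k)) k). \<forall>i. dist_int (\<Lambda> (h(k := y)) i) \<le> z * w})"
      unfolding m(2) fun_upd_same by (rule symmetric_shrink[OF m(1) pos small z])
  qed
qed

text \<open>Every contraction also multiplies the width by z, so the smallness condition, once true,
  remains true for the next variable.\<close>

lemma multi_count_shrink_all:
  fixes \<Lambda> :: "(nat \<Rightarrow> int ^ 'n::finite) \<Rightarrow> 'n \<Rightarrow> real" and A :: "nat \<Rightarrow> real" and B w z :: real
  assumes I: "finite I" and K: "finite K" "K \<subseteq> I"
    and sym: "\<And>k h. k \<in> I \<Longrightarrow> \<exists>m. (\<forall>i j. m i j = m j i) \<and> (\<forall>y i. \<Lambda> (h(k := y)) i = (\<Sum>j\<in>UNIV. m i j * of_int (y $ j)))"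
    and B: "\<And>k. k \<in> K \<Longrightarrow> A k = B" "0 < B" and w: "0 < w" and small: "B * w * (4 * CARD('n)) \<le> 1" and z: "0 < z" "z \<le> 1"
  shows "multi_count I \<Lambda> A w \<le> (((4 * real CARD('n) ^ 2 + 2) / z) ^ CARD('n)) ^ card K *
    multi_count I \<Lambda> (\<lambda>k. if k \<in> K then z * B else A k) (z ^ card K * w)"
  using K B(1)
proof (induction K)
  case empty
  then show ?case by simp
next
  case (insert k K)
  let ?c = "((4 * real CARD('n) ^ 2 + 2) / z) ^ CARD('n)"
  let ?A = "\<lambda>j. if j \<in> K then z * B else A j"
  have c0: "0 \<le> ?c" using z by simp
  have Ak: "?A k = B" using insert by simp
  have zp: "z ^ card K * w \<le> w" using z w mult_right_mono[OF power_le_one[of z "card K"], of w] by simp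
  have "multi_count I \<Lambda> ?A (z ^ card K * w) \<le> ?c * multi_count I \<Lambda> (?A(k := z * ?A k)) (z * (z ^ card K * w))"
  proof (rule multi_count_shrink[OF I])
    have "B * (z ^ card K * w) * (4 * CARD('n)) \<le> B * w * (4 * CARD('n))"
      using zp B(2) by (intro mult_right_mono mult_left_mono) auto
    then show "?A k * (z ^ card K * w) * real (4 * CARD('n)) \<le> 1" unfolding Ak using small by linarith
  qed (use insert sym z w B(2) Ak in auto)
  also have "?A(k := z * ?A k) = (\<lambda>j. if j \<in> insert k K then z * B else A j)" unfolding Ak by (auto simp: fun_eq_iff)
  finally have "?c ^ card K * multi_count I \<Lambda> ?A (z ^ card K * w)
     \<le> ?c ^ card K * (?c * multi_count I \<Lambda> (\<lambda>j. if j \<in> insert k K then z * B else A j) (z * (z ^ card K * w)))"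
    using c0 by (intro mult_left_mono) auto
  then show ?case using insert.IH insert.prems insert.hyps by (simp add: mult_ac)
qed

subsection \<open>Simultaneous approximation from a nonsingular minor\<close>

lemma abs_det_le:
  fixes M :: "real ^ 'n::finite ^ 'n"
  assumes "\<And>i j. \<bar>M $ i $ j\<bar> \<le> b i"
  shows "\<bar>det M\<bar> \<le> fact CARD('n) * (\<Prod>i\<in>UNIV. b i)"
proof -
  have "\<bar>det M\<bar> \<le> (\<Sum>p | p permutes (UNIV :: 'n set). \<bar>of_int (sign p) * (\<Prod>i\<in>UNIV. M $ i $ p i)\<bar>)"
    unfolding det_def by (rule sum_abs)
  also have "\<dots> \<le> (\<Sum>p | p permutes (UNIV :: 'n set). \<Prod>i\<in>UNIV. b i)"
  proof (rule sum_mono)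
    fix p :: "'n \<Rightarrow> 'n"
    have "\<bar>of_int (sign p) :: real\<bar> = 1" by (simp add: sign_def)
    then show "\<bar>of_int (sign p) * (\<Prod>i\<in>UNIV. M $ i $ p i)\<bar> \<le> (\<Prod>i\<in>UNIV. b i)"
      using assms by (simp add: abs_mult abs_prod prod_mono)
  qed
  also have "\<dots> = fact CARD('n) * (\<Prod>i\<in>UNIV. b i)" by (simp add: card_permutations[of UNIV "CARD('n)"])
  finally show ?thesis .
qed

lemma det_of_int: "det (\<chi> i j. of_int (M $ i $ j)) = (of_int (det (M :: int ^ 'n::finite ^ 'n)) :: 'a::comm_ring_1)"
  by (simp add: det_def)

text \<open>Independent rows are completed by coordinate vectors to a nonsingular matrix, whose determinant
  is, up to sign, a maximal minor of the given rows.\<close>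

lemma independent_rows_completion:
  fixes v :: "nat \<Rightarrow> 'a::field ^ 'n::finite"
  assumes dim: "k \<le> vec.dim (v ` {1..k})"
  obtains \<sigma> :: "nat \<Rightarrow> 'n" where "inj_on \<sigma> {1..k}"
    "det (\<chi> i. if i \<in> \<sigma> ` {1..k} then v (the_inv_into {1..k} \<sigma> i) else axis i 1) \<noteq> 0"
proof -
  let ?S = "v ` {1..k}"
  have "vec.dim ?S \<le> card ?S" by (rule vec.dim_le_card') simp
  then have card: "card ?S = k" "vec.dim ?S = card ?S"
    using dim card_image_le[of "{1..k}" v] by auto
  have inj: "inj_on v {1..k}" by (rule eq_card_imp_inj_on) (use card in auto)
  have indep: "vec.independent ?S"
    by (rule vec.card_le_dim_spanning[where V = ?S]) (use card in \<open>auto intro: vec.span_base\<close>)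
  obtain B where B: "?S \<subseteq> B" "B \<subseteq> ?S \<union> range (\<lambda>i. axis i 1)" "vec.independent B"
      "?S \<union> range (\<lambda>i. axis i 1) \<subseteq> vec.span B"
    using vec.maximal_independent_subset_extend[of ?S "?S \<union> range (\<lambda>i. axis i 1)"] indep by blast
  have axes: "range (\<lambda>i. axis i 1) = (cart_basis :: ('a ^ 'n) set)" by (auto simp: cart_basis_def)
  have spanB: "vec.span B = UNIV"
  proof -
    have "vec.span cart_basis \<subseteq> vec.span B" using B(4) unfolding axes by (intro vec.span_minimal) auto
    then show ?thesis by auto
  qed
  have finB: "finite B" using B(3) vec.finiteI_independent by blast
  have cardB: "card B = CARD('n)"
    using vec.dim_eq_card_independent[OF B(3)] spanB vec.dim_span[of B] by (simp add: vec.dim_UNIV vec_dim_card card_cart_basis)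
  \<comment> \<open>The coordinates whose axis vector was really added. An axis vector already among
    the rows counts as a row, so the k rows fit exactly into the positions outside J.\<close>
  define J where "J = {i. axis i 1 \<in> B - ?S}"
  have "B - ?S = (\<lambda>i. axis i 1) ` J" using B(2) by (auto simp: J_def)
  moreover have "inj (\<lambda>i. axis i (1 :: 'a) :: 'a ^ 'n)" by (auto simp: inj_def axis_eq_axis)
  ultimately have "card J = card (B - ?S)" by (metis card_image inj_on_subset subset_UNIV)
  also have "\<dots> = CARD('n) - k" using B(1) cardB card by (simp add: card_Diff_subset)
  finally have "card (- J) = card {1..k}"
    using card cardB card_mono[OF finB B(1)] by (simp add: Compl_eq_Diff_UNIV card_Diff_subset)
  then obtain \<sigma> where \<sigma>: "bij_betw \<sigma> {1..k} (- J)" using finite_same_card_bij[of "{1..k}" "- J"] by auto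
  let ?M = "\<chi> i. if i \<in> \<sigma> ` {1..k} then v (the_inv_into {1..k} \<sigma> i) else axis i 1"
  have inj\<sigma>: "inj_on \<sigma> {1..k}" and im: "\<sigma> ` {1..k} = - J" using \<sigma> by (auto simp: bij_betw_def)
  have "B \<subseteq> rows ?M"
  proof
    fix x assume "x \<in> B"
    have "(\<exists>s\<in>{1..k}. x = v s) \<or> (\<exists>i\<in>J. x = axis i 1)"
    proof (cases "x \<in> ?S")
      case True
      then show ?thesis by (auto simp: image_iff)
    next
      case False
      with \<open>x \<in> B\<close> B(2) obtain i where "x = axis i 1" by auto
      with False \<open>x \<in> B\<close> show ?thesis unfolding J_def by blast
    qed
    then consider s where "s \<in> {1..k}" "x = v s" | i where "i \<in> J" "x = axis i 1" by blast
    then show "x \<in> rows ?M"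
    proof cases
      case 1
      have 1: "the_inv_into {1..k} \<sigma> (\<sigma> s) = s" by (rule the_inv_into_f_f[OF inj\<sigma> 1(1)])
      have 2: "\<sigma> s \<in> \<sigma> ` {1..k}" using \<open>s \<in> {1..k}\<close> by (rule imageI)
      have "row (\<sigma> s) ?M = x" unfolding row_def vec_lambda_beta if_P[OF 2] 1 \<open>x = v s\<close> by (rule vec_lambda_eta)
      then show ?thesis unfolding rows_def by blast
    next
      case 2
      then have 3: "i \<notin> \<sigma> ` {1..k}" using im by blast
      have "row i ?M = x" unfolding row_def vec_lambda_beta if_not_P[OF 3] 2(2) by (rule vec_lambda_eta)
      then show ?thesis unfolding rows_def by blast
    qed
  qed
  then have "vec.span (rows ?M) = UNIV" using spanB vec.span_mono by blast
  then have "invertible ?M"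
    using matrix_left_invertible_span_rows_gen[of ?M] by (metis invertible_left_inverse)
  then have "det ?M \<noteq> 0" by (simp add: invertible_det_nz)
  with inj\<sigma> show ?thesis by (rule that)
qed

text \<open>The denominator is the absolute value of a minor D of order k. By Cramer's rule D * y s
  is the determinant in which the row of A s is replaced by the vector b of the given sums.
  Splitting b into its nearest integer vector and a remainder of size w gives an integer plus at
  most n! * X^(k - 1) * w. The field is left open: the rank is known over the complex numbers in one
  application and over the rationals in the other.\<close>

lemma cramer_approximation:
  fixes A :: "nat \<Rightarrow> int ^ 'n::finite" and y :: "nat \<Rightarrow> real"
  assumes dim: "k \<le> vec.dim ((\<lambda>s. \<chi> i. (of_int (A s $ i) :: 'a::field_char_0)) ` {1..k})"
    and X: "1 \<le> X" "\<And>s i. s \<in> {1..k} \<Longrightarrow> \<bar>real_of_int (A s $ i)\<bar> \<le> X"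
    and w: "\<And>i. dist_int (\<Sum>s=1..k. y s * of_int (A s $ i)) \<le> w"
  obtains q :: nat where "1 \<le> q" "real q \<le> fact CARD('n) * X ^ k"
    "\<And>s. s \<in> {1..k} \<Longrightarrow> dist_int (real q * y s) \<le> fact CARD('n) * X ^ (k - 1) * w"
proof -
  obtain \<sigma> :: "nat \<Rightarrow> 'n" where \<sigma>: "inj_on \<sigma> {1..k}"
    and det: "det (\<chi> i. if i \<in> \<sigma> ` {1..k} then (\<chi> j. of_int (A (the_inv_into {1..k} \<sigma> i) $ j)) else axis i (1::'a)) \<noteq> 0"
    by (rule independent_rows_completion[OF dim])
  define \<tau> where "\<tau> = the_inv_into {1..k} \<sigma>"
  define N :: "int ^ 'n ^ 'n" where "N = (\<chi> i. if i \<in> \<sigma> ` {1..k} then A (\<tau> i) else axis i 1)"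
  define D where "D = det N"
  have eq: "(\<chi> i. if i \<in> \<sigma> ` {1..k} then (\<chi> j. of_int (A (\<tau> i) $ j)) else axis i (1::'a))
      = (\<chi> i j. of_int (N $ i $ j))"
    by (simp add: N_def vec_eq_iff axis_def)
  have "det (\<chi> i j. of_int (N $ i $ j)) \<noteq> (0 :: 'a)" using det unfolding \<tau>_def[symmetric] eq .
  then have D: "D \<noteq> 0" by (simp add: det_of_int D_def)
  define M :: "real ^ 'n ^ 'n" where "M = transpose (\<chi> i j. of_int (N $ i $ j))"
  have detM: "det M = of_int D" unfolding M_def det_transpose det_of_int D_def ..
  \<comment> \<open>The unknowns that belong to the completing axis rows are set to 0, so that
    \<open>M *v Y\<close> involves the given rows alone.\<close>
  define Y :: "real ^ 'n" where "Y = (\<chi> i. if i \<in> \<sigma> ` {1..k} then y (\<tau> i) else 0)"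
  define b :: "real ^ 'n" where "b = (\<chi> i. \<Sum>s=1..k. y s * of_int (A s $ i))"
  have "M *v Y = b"
  proof -
    have "(M *v Y) $ i = b $ i" for i
    proof -
      have "(M *v Y) $ i = (\<Sum>j\<in>UNIV. of_int (N $ j $ i) * Y $ j)"
        by (simp add: M_def matrix_vector_mult_def transpose_def)
      also have "\<dots> = (\<Sum>j\<in>\<sigma> ` {1..k}. of_int (A (\<tau> j) $ i) * y (\<tau> j))"
        by (rule sum.mono_neutral_cong_right) (auto simp: N_def Y_def)
      also have "\<dots> = (\<Sum>s=1..k. of_int (A s $ i) * y s)"
        using \<sigma> by (subst sum.reindex) (simp_all add: \<tau>_def the_inv_into_f_f)
      finally show ?thesis by (simp add: b_def mult.commute)
    qed
    then show ?thesis by (simp add: vec_eq_iff)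
  qed
  then have cr: "Y = (\<chi> c. det (\<chi> i j. if j = c then b $ i else M $ i $ j) / det M)"
    using cramer[of M Y b] D detM by simp
  define R where "R c x = (\<chi> i. if i = c then x else (\<chi> j. of_int (N $ i $ j)))" for c and x :: "real ^ 'n"
  have R: "of_int D * Y $ c = det (R c b)" for c
  proof -
    have "(\<chi> i j. if j = c then b $ i else M $ i $ j) = transpose (R c b)"
      by (simp add: R_def M_def transpose_def vec_eq_iff)
    then have "det (\<chi> i j. if j = c then b $ i else M $ i $ j) = det (R c b)" by (simp add: det_transpose)
    then show ?thesis using arg_cong[OF cr, of "\<lambda>v. v $ c"] D detM by simp
  qed
  define m :: "int ^ 'n" where "m = (\<chi> i. round (b $ i))"
  have Rsplit: "det (R c b) = of_int (det (\<chi> i. if i = c then m else N $ i)) + det (R c (b - (\<chi> i. of_int (m $ i))))" for c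
  proof -
    let ?m = "\<chi> i. real_of_int (m $ i)"
    have "det (R c (?m + (b - ?m))) = det (R c ?m) + det (R c (b - ?m))"
      unfolding R_def by (rule det_row_add)
    then have 1: "det (R c b) = det (R c ?m) + det (R c (b - ?m))" by simp
    have 2: "R c ?m = (\<chi> i j. of_int ((\<chi> i. if i = c then m else N $ i) $ i $ j))"
      by (simp add: R_def vec_eq_iff)
    show ?thesis unfolding 1 2 det_of_int ..
  qed
  have entry: "\<bar>real_of_int (N $ i $ j)\<bar> \<le> (if i \<in> \<sigma> ` {1..k} then X else 1)" for i j
  proof (cases "i \<in> \<sigma> ` {1..k}")
    case True
    then obtain s where s: "s \<in> {1..k}" "i = \<sigma> s" by blast
    have "\<tau> i = s" unfolding s(2) \<tau>_def by (rule the_inv_into_f_f[OF \<sigma> s(1)])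
    with True X(2)[OF s(1), of j] show ?thesis by (simp add: N_def)
  qed (simp add: N_def axis_def)
  have prodX: "(\<Prod>i\<in>UNIV. if i \<in> \<sigma> ` {1..k} then X else 1) = X ^ k"
    using \<sigma> by (simp add: prod.If_cases card_image)
  show ?thesis
  proof (rule that[of "nat \<bar>D\<bar>"])
    show "1 \<le> nat \<bar>D\<bar>" using D by simp
    have "\<bar>det (\<chi> i j. real_of_int (N $ i $ j))\<bar> \<le> fact CARD('n) * (\<Prod>i\<in>UNIV. if i \<in> \<sigma> ` {1..k} then X else 1)"
      by (rule abs_det_le) (use entry in simp)
    then show "real (nat \<bar>D\<bar>) \<le> fact CARD('n) * X ^ k" unfolding prodX det_of_int D_def[symmetric] by simp
  next
    fix s assume s: "s \<in> {1..k}"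
    define c where "c = \<sigma> s"
    have c: "c \<in> \<sigma> ` {1..k}" "\<tau> c = s"
      unfolding c_def \<tau>_def by (rule imageI[OF s], rule the_inv_into_f_f[OF \<sigma> s])
    then have Yc: "Y $ c = y s" by (simp add: Y_def)
    have ent: "\<bar>R c (b - (\<chi> i. of_int (m $ i))) $ i $ j\<bar> \<le> (if i = c then w else if i \<in> \<sigma> ` {1..k} then X else 1)" for i j
    proof (cases "i = c")
      case True
      then show ?thesis using w[of j] by (simp add: R_def m_def b_def dist_int_def)
    next
      case False
      then show ?thesis using entry[of i j] by (simp add: R_def)
    qed
    have "(\<Prod>i\<in>UNIV. if i = c then w else if i \<in> \<sigma> ` {1..k} then X else 1)
        = w * (\<Prod>i\<in>UNIV - {c}. if i \<in> \<sigma> ` {1..k} then X else 1)"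
      by (subst prod.remove[of _ c]) (auto intro!: prod.cong)
    also have "(\<Prod>i\<in>UNIV - {c}. if i \<in> \<sigma> ` {1..k} then X else 1) = X ^ (k - 1)"
    proof -
      have "(UNIV - {c}) \<inter> \<sigma> ` {1..k} = \<sigma> ` {1..k} - {c}" by blast
      moreover have "card (\<sigma> ` {1..k} - {c}) = k - 1" unfolding card_Diff_singleton[OF c(1)] card_image[OF \<sigma>] by simp
      moreover have "(\<Prod>i\<in>UNIV - {c}. if i \<in> \<sigma> ` {1..k} then X else 1) = X ^ card ((UNIV - {c}) \<inter> \<sigma> ` {1..k})"
        unfolding prod.If_cases[OF finite] Collect_mem_eq by simp
      ultimately show ?thesis by simp
    qed
    finally have bound: "\<bar>det (R c (b - (\<chi> i. of_int (m $ i))))\<bar> \<le> fact CARD('n) * (w * X ^ (k - 1))"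
      using abs_det_le[OF ent] by simp
    have "of_int D * y s - of_int (det (\<chi> i. if i = c then m else N $ i)) = det (R c (b - (\<chi> i. of_int (m $ i))))"
      using R[of c] Rsplit[of c] Yc by simp
    then have "dist_int (of_int D * y s) \<le> fact CARD('n) * (w * X ^ (k - 1))"
      using dist_int_le[of "of_int D * y s" "det (\<chi> i. if i = c then m else N $ i)"] bound by linarith
    moreover have "dist_int (real (nat \<bar>D\<bar>) * y s) = dist_int (of_int D * y s)"
      using dist_int_minus[of "of_int D * y s"] by (cases "D \<ge> 0") (auto simp: abs_if)
    ultimately show "dist_int (real (nat \<bar>D\<bar>) * y s) \<le> fact CARD('n) * X ^ (k - 1) * w" by (simp add: mult_ac)
  qed
qed

subsection \<open>Polarised forms and the singular locus\<close>

lemma additive_expand_mixed_diff: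
  fixes f :: "int ^ 'n::finite \<Rightarrow> 'b::comm_ring_1"
  assumes "finite I" "k \<in> I" "poly_deg_le (card I) f"
  shows "mixed_diff I (h(k := y)) f x = (\<Sum>j\<in>UNIV. of_int (y $ j) * mixed_diff I (h(k := axis j 1)) f x)"
  by (rule additive_expand[of "\<lambda>y. mixed_diff I (h(k := y)) f x"]) (rule mixed_diff_additive[OF assms])

text \<open>Multilinear expansion of the vectors in K leaves mixed differences along basis vectors,
  of which there are finitely many; they supply a constant independent of A and h.\<close>

lemma mixed_diff_size:
  fixes f :: "int ^ 'n::finite \<Rightarrow> int"
  assumes I: "finite I" and K: "finite K" "K \<subseteq> I" and deg: "poly_deg_le (card I) f"
  shows "\<exists>C\<ge>0. \<forall>A\<ge>0. \<forall>h. (\<forall>k\<in>K. h k \<in> int_cube A) \<longrightarrow> (\<forall>k\<in>I - K. h k \<in> range (\<lambda>j. axis j 1)) \<longrightarrow>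
    \<bar>real_of_int (mixed_diff I h f 0)\<bar> \<le> C * A ^ card K"
  using K
proof (induction K)
  case empty
  let ?H = "I \<rightarrow>\<^sub>E range (\<lambda>j. axis j 1 :: int ^ 'n)"
  let ?C = "\<Sum>h\<in>?H. \<bar>real_of_int (mixed_diff I h f 0)\<bar>"
  have fin: "finite ?H" using I by (intro finite_PiE) auto
  have "\<bar>real_of_int (mixed_diff I h f 0)\<bar> \<le> ?C" if "\<forall>k\<in>I. h k \<in> range (\<lambda>j. axis j 1)" for h
  proof -
    have "mixed_diff I h f 0 = mixed_diff I (restrict h I) f 0"
      by (rule mixed_diff_cong[THEN fun_cong]) simp
    moreover have "restrict h I \<in> ?H" using that by auto
    ultimately show ?thesis
      using member_le_sum[of "restrict h I" ?H "\<lambda>h. \<bar>real_of_int (mixed_diff I h f 0)\<bar>"] fin by simp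
  qed
  then show ?case by (intro exI[of _ ?C]) (auto intro: sum_nonneg)
next
  case (insert k K)
  then obtain C where C: "C \<ge> 0" and bound: "\<And>A h. 0 \<le> A \<Longrightarrow> (\<forall>k\<in>K. h k \<in> int_cube A) \<Longrightarrow>
      (\<forall>k\<in>I - K. h k \<in> range (\<lambda>j. axis j 1)) \<Longrightarrow> \<bar>real_of_int (mixed_diff I h f 0)\<bar> \<le> C * A ^ card K" by blast
  show ?case
  proof (intro exI[of _ "CARD('n) * C"] conjI allI impI)
    fix A :: real and h :: "_ \<Rightarrow> int ^ 'n"
    assume A: "0 \<le> A" and h: "\<forall>k\<in>insert k K. h k \<in> int_cube A" "\<forall>k\<in>I - insert k K. h k \<in> range (\<lambda>j. axis j 1)"
    have "mixed_diff I h f 0 = mixed_diff I (h(k := h k)) f 0" by simp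
    also have "\<dots> = (\<Sum>j\<in>UNIV. of_int (h k $ j) * mixed_diff I (h(k := axis j 1)) f 0)"
      by (rule additive_expand_mixed_diff) (use I insert.prems deg in auto)
    finally have "\<bar>real_of_int (mixed_diff I h f 0)\<bar> = \<bar>\<Sum>j\<in>UNIV. of_int (h k $ j) * real_of_int (mixed_diff I (h(k := axis j 1)) f 0)\<bar>"
      by simp
    also have "\<dots> \<le> (\<Sum>j\<in>(UNIV :: 'n set). A * (C * A ^ card K))"
    proof (rule order.trans[OF sum_abs sum_mono])
      fix j :: 'n
      have "\<bar>real_of_int (mixed_diff I (h(k := axis j 1)) f 0)\<bar> \<le> C * A ^ card K"
        by (rule bound[OF A]) (use h insert.hyps in auto)
      moreover have "\<bar>real_of_int (h k $ j)\<bar> \<le> A" using h(1) by (simp add: int_cube_def)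
      ultimately show "\<bar>of_int (h k $ j) * real_of_int (mixed_diff I (h(k := axis j 1)) f 0)\<bar> \<le> A * (C * A ^ card K)"
        using A unfolding abs_mult by (intro mult_mono) auto
    qed
    also have "\<dots> = CARD('n) * C * A ^ card (insert k K)" using insert.hyps by simp
    finally show "\<bar>real_of_int (mixed_diff I h f 0)\<bar> \<le> CARD('n) * C * A ^ card (insert k K)" .
  qed (use C in simp)
qed

text \<open>The matrix entry pairs \<alpha> with the polarised forms that have e_j in place k and
  e_i in the last place; interchanging two directions of a mixed difference changes nothing. The
  factor c will be the denominator q.\<close>

lemma polar_coeff_symmetric:
  fixes u :: "nat \<Rightarrow> nat \<Rightarrow> 'n::finite int_mpoly"
  assumes deg: "\<And>s. s \<in> {1..r l} \<Longrightarrow> mpoly_degree (u l s) \<le> l" and k: "k \<in> {1..l - 1}"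
  shows "\<exists>m. (\<forall>i j. m i j = m j i) \<and> (\<forall>y i. c * polar_coeff r u \<alpha> l (h(k := y)) i = (\<Sum>j\<in>UNIV. m i j * of_int (y $ j)))"
proof -
  define g where "g s i j = real_of_int (mixed_diff {1..l} (h(k := axis j 1, l := axis i 1)) (mpoly_eval (u l s)) 0)" for s i j
  have kl: "k \<noteq> l" using k by auto
  have exp: "real_of_int (mixed_diff {1..l} (h(k := y, l := axis i 1)) (mpoly_eval (u l s)) 0) = (\<Sum>j\<in>UNIV. of_int (y $ j) * g s i j)"
    if s: "s \<in> {1..r l}" for s i y
  proof -
    have "poly_deg_le (card {1..l}) (mpoly_eval (u l s) :: int ^ 'n \<Rightarrow> int)"
      using deg[OF s] by (intro poly_deg_le_mono[OF poly_deg_le_mpoly_eval]) simp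
    from additive_expand_mixed_diff[OF _ _ this, of k "h(l := axis i 1)" y 0]
    have "mixed_diff {1..l} (h(l := axis i 1, k := y)) (mpoly_eval (u l s)) 0
       = (\<Sum>j\<in>UNIV. of_int (y $ j) * (mixed_diff {1..l} (h(l := axis i 1, k := axis j 1)) (mpoly_eval (u l s)) 0 :: int))"
      using k by auto
    then show ?thesis unfolding g_def fun_upd_twist[OF kl] by simp
  qed
  have symg: "g s i j = g s j i" for s i j
  proof -
    have I: "{1..l} = insert k (insert l ({1..l} - {k, l}))" using k by auto
    show ?thesis unfolding g_def by (subst (1 2) I, subst mixed_diff_swap) (use kl in auto)
  qed
  show ?thesis
  proof (intro exI[of _ "\<lambda>i j. c * (\<Sum>s=1..r l. \<alpha> l s * g s i j)"] conjI allI)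
    fix y i
    have "c * polar_coeff r u \<alpha> l (h(k := y)) i = c * (\<Sum>s=1..r l. \<alpha> l s * (\<Sum>j\<in>UNIV. of_int (y $ j) * g s i j))"
      unfolding polar_coeff_def by (intro arg_cong[of _ _ "\<lambda>t. c * t"] sum.cong refl) (simp only: exp)
    also have "\<dots> = (\<Sum>s=1..r l. \<Sum>j\<in>UNIV. c * (\<alpha> l s * g s i j) * of_int (y $ j))"
      by (simp add: sum_distrib_left mult_ac)
    also have "\<dots> = (\<Sum>j\<in>UNIV. \<Sum>s=1..r l. c * (\<alpha> l s * g s i j) * of_int (y $ j))" by (rule sum.swap)
    also have "\<dots> = (\<Sum>j\<in>UNIV. c * (\<Sum>s=1..r l. \<alpha> l s * g s i j) * of_int (y $ j))"
      by (simp add: sum_distrib_left sum_distrib_right)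
    finally show "c * polar_coeff r u \<alpha> l (h(k := y)) i = (\<Sum>j\<in>UNIV. c * (\<Sum>s=1..r l. \<alpha> l s * g s i j) * of_int (y $ j))" .
  qed (simp add: symg)
qed

text \<open>Passes from real lattice points to integer vectors, where divisibility and differencing
  take place.\<close>

lemma exp_sum_eq:
  fixes u :: "nat \<Rightarrow> nat \<Rightarrow> 'n::finite int_mpoly"
  assumes "0 < P"
  shows "exp_sum d r u P \<alpha> = (\<Sum>x\<in>{0..\<chi> i. \<lfloor>P\<rfloor>}. e_fun (phase d r u \<alpha> x))"
proof -
  let ?v = "\<lambda>x::int^'n. \<chi> i. real_of_int (x $ i)"
  have eq: "(\<lambda>y. P *\<^sub>R y) ` cbox (0 :: real ^ 'n) 1 \<inter> {x. \<forall>i. x $ i \<in> \<int>} = ?v ` {0..\<chi> i. \<lfloor>P\<rfloor>}"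
  proof (intro equalityI subsetI)
    fix z assume "z \<in> (\<lambda>y. P *\<^sub>R y) ` cbox (0 :: real ^ 'n) 1 \<inter> {x. \<forall>i. x $ i \<in> \<int>}"
    then obtain y where y1: "z = P *\<^sub>R y" "y \<in> cbox 0 1" and zi: "\<And>i. z $ i \<in> \<int>" by blast
    have y: "z = P *\<^sub>R y" "\<And>i. 0 \<le> y $ i \<and> y $ i \<le> 1" using y1 by (auto simp: mem_box_cart)
    have 1: "of_int \<lfloor>z $ i\<rfloor> = z $ i" for i using zi[of i] by (auto elim: Ints_cases)
    have 2: "0 \<le> z $ i" "z $ i \<le> P" for i using y(2)[of i] assms by (auto simp: y(1) mult_left_le)
    have "z = ?v (\<chi> i. \<lfloor>z $ i\<rfloor>)" by (simp add: vec_eq_iff 1)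
    moreover have "(\<chi> i. \<lfloor>z $ i\<rfloor>) \<in> {0..\<chi> i. \<lfloor>P\<rfloor>}" using 2 by (simp add: less_eq_vec_def floor_mono)
    ultimately show "z \<in> ?v ` {0..\<chi> i. \<lfloor>P\<rfloor>}" by blast
  next
    fix z assume "z \<in> ?v ` {0..\<chi> i. \<lfloor>P\<rfloor>}"
    then obtain x where x: "z = ?v x" "\<And>i. 0 \<le> x $ i \<and> x $ i \<le> \<lfloor>P\<rfloor>" by (auto simp: less_eq_vec_def)
    have "z = P *\<^sub>R (\<chi> i. real_of_int (x $ i) / P)" using assms by (simp add: x(1) vec_eq_iff)
    moreover have "(\<chi> i. real_of_int (x $ i) / P) \<in> cbox (0 :: real ^ 'n) 1"
      using x(2) assms by (auto simp: mem_box_cart le_floor_iff)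
    ultimately show "z \<in> (\<lambda>y. P *\<^sub>R y) ` cbox (0 :: real ^ 'n) 1 \<inter> {x. \<forall>i. x $ i \<in> \<int>}"
      using x(1) by auto
  qed
  have inj: "inj_on ?v {0..\<chi> i. \<lfloor>P\<rfloor>}" by (auto simp: inj_on_def vec_eq_iff)
  show ?thesis unfolding exp_sum_def eq
    by (subst sum.reindex[OF inj]) (simp add: phase_def mpoly_eval_of_int)
qed

lemma integer_points_subset:
  assumes "M \<subseteq> {1..m} \<rightarrow>\<^sub>E UNIV"
  shows "{x \<in> M. \<forall>k\<in>{1..m}. \<forall>i. x k $ i \<in> \<int> \<and> norm (x k $ i) \<le> P} \<subseteq> {1..m} \<rightarrow>\<^sub>E (cvec ` (int_cube P :: (int ^ 'n::finite) set))"
proof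
  fix x assume x: "x \<in> {x \<in> M. \<forall>k\<in>{1..m}. \<forall>i. x k $ i \<in> \<int> \<and> norm (x k $ i) \<le> P}"
  have "x k \<in> cvec ` (int_cube P :: (int ^ 'n) set)" if k: "k \<in> {1..m}" for k
  proof -
    have xk: "x k $ i \<in> \<int>" "norm (x k $ i) \<le> P" for i using x k by blast+
    have "\<forall>i. \<exists>t. x k $ i = of_int t" using xk(1) by (metis Ints_cases)
    then obtain t where t: "\<And>i. x k $ i = of_int (t i)" by metis
    have "x k = cvec (\<chi> i. t i)" by (simp add: cvec_def vec_eq_iff t)
    moreover have "(\<chi> i. t i) \<in> int_cube P" using xk(2) by (simp add: int_cube_def t)
    ultimately show ?thesis by blast
  qed
  then show "x \<in> {1..m} \<rightarrow>\<^sub>E (cvec ` int_cube P)" using x assms by (auto simp: PiE_iff subset_iff)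
qed

text \<open>A \<open>GREATEST\<close> that is not attained would denote an arbitrary real, so its
  defining property becomes available only once the supremum is shown to satisfy it.\<close>

lemma g_inv_bound:
  fixes U :: "nat \<Rightarrow> 'n::finite int_mpoly"
  assumes l: "2 \<le> l" and k: "1 \<le> k" and "0 < \<epsilon>"
  shows "(\<lambda>P::real. real (count_int_points (l - 1) (sing_locus l k U) P))
    \<in> O[at_top](\<lambda>P. P powr (real (CARD('n) * (l - 1)) - g_inv l k U + \<epsilon>))"
proof -
  define M where "M = sing_locus l k U"
  define N where "N = real (CARD('n) * (l - 1))"
  define cnt where "cnt P = real (count_int_points (l - 1) M P)" for P
  define good where "good g \<longleftrightarrow> (\<forall>\<epsilon>>0. cnt \<in> O[at_top](\<lambda>P. P powr (N - g + \<epsilon>)))" for g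
  have sub: "{x \<in> M. \<forall>k\<in>{1..l - 1}. \<forall>i. x k $ i \<in> \<int> \<and> norm (x k $ i) \<le> P} \<subseteq> {1..l - 1} \<rightarrow>\<^sub>E (cvec ` (int_cube P :: (int ^ 'n) set))" for P
    by (rule integer_points_subset) (auto simp: M_def sing_locus_def)
  have fin: "finite ({1..l - 1} \<rightarrow>\<^sub>E (cvec ` (int_cube P :: (int ^ 'n) set)))" for P by (intro finite_PiE) auto
  have upper: "cnt P \<le> 3 ^ (CARD('n) * (l - 1)) * P powr N" if P: "1 \<le> P" for P
  proof -
    have "cnt P \<le> real (card ({1..l - 1} \<rightarrow>\<^sub>E (cvec ` (int_cube P :: (int ^ 'n) set))))"
      unfolding cnt_def count_int_points_def by (intro of_nat_mono card_mono fin sub)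
    also have "\<dots> = real (card (int_cube P :: (int ^ 'n) set)) ^ (l - 1)"
      by (simp add: card_PiE card_image inj_on_subset[OF inj_cvec])
    also have "\<dots> \<le> ((3 * P) ^ CARD('n)) ^ (l - 1)"
      unfolding card_int_cube[OF order.trans[OF zero_le_one P]]
    proof (intro power_mono)
      show "2 * real_of_int \<lfloor>P\<rfloor> + 1 \<le> 3 * P" using P by linarith
    qed (use P in auto)
    also have "\<dots> = 3 ^ (CARD('n) * (l - 1)) * P powr N"
    proof -
      have "P powr N = P ^ (CARD('n) * (l - 1))" unfolding N_def using P by (intro powr_realpow) simp
      then show ?thesis by (simp add: power_mult_distrib flip: power_mult)
    qed
    finally show ?thesis .
  qed
  have lower: "1 \<le> cnt P" if P: "0 \<le> P" for P
  proof -
    \<comment> \<open>The zero tuple. As l \<ge> 2, every polarised value involves a zero direction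
      and vanishes, so the rank is 0 < k. The tuple is counted for every P, which bounds the
      admissible exponents from above.\<close>
    define x where "x = (\<lambda>j\<in>{1..l - 1}. 0 :: complex ^ 'n)"
    have "Gam l (mpoly_eval (U s)) (x(l := axis i 1)) = 0" for s i
    proof -
      define h where "h = (\<lambda>j::nat. 0 :: int ^ 'n)(l := axis i 1)"
      have "Gam l (mpoly_eval (U s)) (x(l := axis i 1)) = of_int (mixed_diff {1..l} h (mpoly_eval (U s)) 0)"
      proof (rule Gam_eq_mixed_diff)
        fix j assume "j \<in> {1..l}"
        moreover have "cvec (0 :: int ^ 'n) = 0" by (simp add: cvec_def vec_eq_iff)
        ultimately show "(x(l := axis i 1)) j = cvec (h j)" by (cases "j = l") (auto simp: x_def h_def cvec_axis)
      qed
      also have "mixed_diff {1..l} h (mpoly_eval (U s)) 0 = (0 :: int)"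
      proof -
        have I: "{1..l} = insert 1 {2..l}" using l by auto
        show ?thesis unfolding I by (subst mixed_diff_insert) (use l in \<open>auto simp: h_def\<close>)
      qed
      finally show ?thesis by (simp only: of_int_0)
    qed
    then have "(\<lambda>s. \<chi> i. Gam l (mpoly_eval (U s)) (x(l := axis i 1))) ` {1..k} \<subseteq> {0}" by (auto simp: vec_eq_iff)
    then have dim0: "vec.dim ((\<lambda>s. \<chi> i. Gam l (mpoly_eval (U s)) (x(l := axis i 1))) ` {1..k}) = 0"
      by (simp add: vec.dim_eq_0)
    have "x \<in> {1..l - 1} \<rightarrow>\<^sub>E UNIV" by (simp add: x_def)
    then have "x \<in> M" unfolding M_def sing_locus_def mem_Collect_eq dim0 using k by simp
    then have "{x} \<subseteq> {x \<in> M. \<forall>k\<in>{1..l - 1}. \<forall>i. x k $ i \<in> \<int> \<and> norm (x k $ i) \<le> P}"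
      using P by (auto simp: x_def)
    then have "card {x} \<le> card {x \<in> M. \<forall>k\<in>{1..l - 1}. \<forall>i. x k $ i \<in> \<int> \<and> norm (x k $ i) \<le> P}"
      by (intro card_mono finite_subset[OF sub fin])
    then show ?thesis by (simp add: cnt_def count_int_points_def)
  qed
  have good0: "good 0" unfolding good_def
  proof (intro allI impI bigoI[where c = "3 ^ (CARD('n) * (l - 1))"])
    fix \<epsilon> :: real assume \<epsilon>: "0 < \<epsilon>"
    show "\<forall>\<^sub>F P in at_top. norm (cnt P) \<le> 3 ^ (CARD('n) * (l - 1)) * norm (P powr (N - 0 + \<epsilon>))"
      using eventually_ge_at_top[of "1::real"]
    proof eventually_elim
      case (elim P)
      have "P powr N \<le> P powr (N - 0 + \<epsilon>)" using elim \<epsilon> by (intro powr_mono) auto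
      then have "3 ^ (CARD('n) * (l - 1)) * P powr N \<le> 3 ^ (CARD('n) * (l - 1)) * P powr (N - 0 + \<epsilon>)" by simp
      then have "cnt P \<le> 3 ^ (CARD('n) * (l - 1)) * P powr (N - 0 + \<epsilon>)" using upper[OF elim] by linarith
      then show ?case by (simp add: cnt_def)
    qed
  qed
  have bounded: "g \<le> N" if "good g" for g
  proof (rule ccontr)
    assume "\<not> g \<le> N"
    then have pos: "(g - N) / 2 > 0" by simp
    with that have "cnt \<in> O[at_top](\<lambda>P. P powr (N - g + (g - N) / 2))" unfolding good_def by blast
    moreover have "N - g + (g - N) / 2 = - ((g - N) / 2)" by (simp add: field_simps)
    ultimately have O: "cnt \<in> O[at_top](\<lambda>P. P powr (- ((g - N) / 2)))" by simp
    from landau_o.bigE[OF O] obtain c where c: "\<forall>\<^sub>F P in at_top. norm (cnt P) \<le> c * norm (P powr (- ((g - N) / 2)))" by blast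
    have "((\<lambda>P::real. c * norm (P powr (- ((g - N) / 2)))) \<longlongrightarrow> c * norm (0 :: real)) at_top"
      using pos by (intro tendsto_intros tendsto_neg_powr filterlim_ident) auto
    then have "\<forall>\<^sub>F P in at_top. c * norm (P powr (- ((g - N) / 2))) < 1" by (rule order_tendstoD) simp
    with c eventually_ge_at_top[of "0::real"] have "\<forall>\<^sub>F P::real in at_top. False"
      by eventually_elim (use lower in fastforce)
    then show False by simp
  qed
  define G where "G = Sup {g. good g}"
  have bdd: "bdd_above {g. good g}" using bounded by (auto simp: bdd_above_def)
  have goodG: "good G" unfolding good_def
  proof (intro allI impI)
    fix \<epsilon> :: real assume \<epsilon>: "0 < \<epsilon>"
    \<comment> \<open>An admissible g within \<epsilon> / 2 of the supremum, used with \<epsilon> /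
      2, shows that the supremum itself is admissible.\<close>
    have "\<exists>g\<in>{g. good g}. G - \<epsilon> / 2 < g" unfolding G_def
      by (rule less_cSupD) (use good0 \<epsilon> in auto)
    then obtain g where g: "good g" "G - \<epsilon> / 2 < g" by blast
    have "cnt \<in> O[at_top](\<lambda>P. P powr (N - g + \<epsilon> / 2))" using g \<epsilon> by (simp add: good_def)
    also have "(\<lambda>P::real. P powr (N - g + \<epsilon> / 2)) \<in> O[at_top](\<lambda>P. P powr (N - G + \<epsilon>))"
    proof (rule bigoI[where c = 1])
      show "\<forall>\<^sub>F P in at_top. norm (P powr (N - g + \<epsilon> / 2)) \<le> 1 * norm (P powr (N - G + \<epsilon>))"
        using eventually_ge_at_top[of "1::real"] by eventually_elim (use g in \<open>auto intro!: powr_mono\<close>)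
    qed
    finally show "cnt \<in> O[at_top](\<lambda>P. P powr (N - G + \<epsilon>))" .
  qed
  have "g_inv l k U = (GREATEST g. good g)"
    by (simp add: g_inv_def good_def cnt_def[abs_def] M_def N_def)
  also have "\<dots> = G"
  proof (rule Greatest_equality)
    show "good G" by (rule goodG)
    show "g \<le> G" if "good g" for g using that bdd by (auto simp: G_def intro: cSup_upper)
  qed
  finally have "cnt \<in> O[at_top](\<lambda>P. P powr (N - g_inv l k U + \<epsilon>))" using goodG assms(3) by (simp add: good_def)
  then show ?thesis by (simp add: cnt_def[abs_def] M_def N_def)
qed

subsection \<open>The linear forms\<close>

lemma mon_degree_eq_1_iff: "mon_degree m = 1 \<longleftrightarrow> (\<exists>i. m = Poly_Mapping.single i 1)"
proof
  assume "mon_degree m = 1"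
  then obtain i where i: "Poly_Mapping.lookup m i = 1" "\<And>j. j \<noteq> i \<Longrightarrow> Poly_Mapping.lookup m j = 0"
    by (auto simp: mon_degree_def sum_eq_Suc0_iff)
  have "m = Poly_Mapping.single i 1"
    by (rule poly_mapping_eqI) (use i in \<open>auto simp: lookup_single when_def\<close>)
  then show "\<exists>i. m = Poly_Mapping.single i 1" ..
qed (auto simp: mon_degree_def lookup_single when_def)

lemma mpoly_eval_hom_part_1:
  "mpoly_eval (hom_part 1 p) (0 :: int ^ 'n::finite) = 0"
  "mpoly_eval (hom_part 1 p) (axis i 1 :: int ^ 'n::finite) = Poly_Mapping.lookup p (Poly_Mapping.single i 1)"
proof -
  let ?K = "{m \<in> Poly_Mapping.keys p. mon_degree m = 1}"
  have prod: "(\<Prod>j\<in>UNIV. (x $ j) ^ Poly_Mapping.lookup (Poly_Mapping.single i 1) j) = x $ i" for x :: "int ^ 'n" and i :: 'n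
  proof -
    have "(\<Prod>j\<in>UNIV. (x $ j) ^ Poly_Mapping.lookup (Poly_Mapping.single i 1) j) = (\<Prod>j\<in>UNIV. if j = i then x $ i else 1)"
      by (intro prod.cong) (auto simp: lookup_single when_def)
    then show ?thesis by simp
  qed
  have "(\<Prod>j\<in>UNIV. ((0 :: int ^ 'n) $ j) ^ Poly_Mapping.lookup m j) = 0" if "mon_degree m = 1" for m
  proof -
    from iffD1[OF mon_degree_eq_1_iff that] obtain i where i: "m = Poly_Mapping.single i 1" by blast
    show ?thesis unfolding i prod by simp
  qed
  then show "mpoly_eval (hom_part 1 p) (0 :: int ^ 'n) = 0"
    unfolding mpoly_eval_hom_part by (intro sum.neutral) auto
  have "(\<Prod>j\<in>UNIV. (axis i 1 $ j :: int) ^ Poly_Mapping.lookup m j) = (if m = Poly_Mapping.single i 1 then 1 else 0)"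
    if "mon_degree m = 1" for m
  proof -
    from iffD1[OF mon_degree_eq_1_iff that] obtain i' where m: "m = Poly_Mapping.single i' 1" by blast
    have "m = Poly_Mapping.single i 1 \<longleftrightarrow> i' = i" unfolding m
      by (auto dest!: arg_cong[of _ _ "\<lambda>m. Poly_Mapping.lookup m i"] simp: lookup_single when_def split: if_splits)
    then show ?thesis using prod[of "axis i 1" i'] by (auto simp: m axis_def)
  qed
  then have "mpoly_eval (hom_part 1 p) (axis i 1 :: int ^ 'n) = (\<Sum>m\<in>?K. if m = Poly_Mapping.single i 1 then Poly_Mapping.lookup p m else 0)"
    unfolding mpoly_eval_hom_part by (intro sum.cong) auto
  also have "\<dots> = Poly_Mapping.lookup p (Poly_Mapping.single i 1)"
    by (auto simp: sum.delta in_keys_iff mon_degree_eq_1_iff[unfolded One_nat_def])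
  finally show "mpoly_eval (hom_part 1 p) (axis i 1 :: int ^ 'n) = Poly_Mapping.lookup p (Poly_Mapping.single i 1)" .
qed

text \<open>In degree one no differencing takes place: \<lambda>_i is, up to sign, the i-th
  coefficient of the combined linear form, whatever h is.\<close>

lemma polar_coeff_1:
  fixes u :: "nat \<Rightarrow> nat \<Rightarrow> 'n::finite int_mpoly"
  assumes "\<And>s. s \<in> {1..r 1} \<Longrightarrow> mpoly_degree (u 1 s) = 1"
  shows "polar_coeff r u \<alpha> 1 h i = - (\<Sum>s=1..r 1. \<alpha> 1 s * of_int (Poly_Mapping.lookup (u 1 s) (Poly_Mapping.single i 1)))"
proof -
  have "mixed_diff {1..1} (h(1 := axis i 1)) (mpoly_eval (u 1 s)) 0 = - Poly_Mapping.lookup (u 1 s) (Poly_Mapping.single i 1)"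
    if s: "s \<in> {1..r 1}" for s
  proof -
    have "mixed_diff {1..1} (h(1 := axis i 1)) (mpoly_eval (u 1 s)) 0 = (mixed_diff {1..1} (h(1 := axis i 1)) (mpoly_eval (hom_part 1 (u 1 s))) 0 :: int)"
      by (rule mixed_diff_hom_part[symmetric]) (use assms s in auto)
    also have "\<dots> = mpoly_eval (hom_part 1 (u 1 s)) 0 - mpoly_eval (hom_part 1 (u 1 s)) (axis i 1)"
      using mixed_diff_insert[of "{}" "1::nat" "h(1 := axis i 1)" "mpoly_eval (hom_part 1 (u 1 s)) :: _ \<Rightarrow> int" 0] by simp
    finally show ?thesis unfolding mpoly_eval_hom_part_1 by simp
  qed
  then have "polar_coeff r u \<alpha> 1 h i = (\<Sum>s=1..r 1. \<alpha> 1 s * of_int (- Poly_Mapping.lookup (u 1 s) (Poly_Mapping.single i 1)))"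
    unfolding polar_coeff_def by (intro sum.cong refl) simp
  then show ?thesis by (simp add: sum_negf)
qed

lemma vec_dim_full:
  fixes v :: "nat \<Rightarrow> 'a::field ^ 'n::finite"
  assumes "\<And>c. (\<Sum>s=1..k. c s *s v s) = 0 \<Longrightarrow> \<forall>s\<in>{1..k}. c s = 0"
  shows "k \<le> vec.dim (v ` {1..k})"
proof -
  have inj: "inj_on v {1..k}"
  proof (rule inj_onI, rule ccontr)
    fix s t assume st: "s \<in> {1..k}" "t \<in> {1..k}" "v s = v t" "s \<noteq> t"
    define c where "c a = (if a = s then 1 else if a = t then - 1 else 0 :: 'a)" for a
    have "(\<Sum>a=1..k. c a *s v a) = (\<Sum>a\<in>{s, t}. c a *s v a)"
      by (rule sum.mono_neutral_right) (use st in \<open>auto simp: c_def\<close>)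
    also have "\<dots> = 0" using st by (simp add: c_def vec_eq_iff)
    finally have "\<forall>s\<in>{1..k}. c s = 0" by (rule assms)
    then have "c s = 0" using st(1) by blast
    then show False by (simp add: c_def)
  qed
  have "vec.independent (v ` {1..k})"
  proof
    assume "vec.dependent (v ` {1..k})"
    then obtain c where c: "\<exists>w\<in>v ` {1..k}. c w \<noteq> 0" "(\<Sum>w\<in>v ` {1..k}. c w *s w) = 0"
      by (subst (asm) vec.dependent_finite) auto
    have "(\<Sum>s=1..k. c (v s) *s v s) = 0" using c(2) unfolding sum.reindex[OF inj] o_def .
    from assms[OF this] c(1) show False by auto
  qed
  then have "vec.dim (v ` {1..k}) = card (v ` {1..k})" by (rule vec.dim_eq_card_independent)
  then show ?thesis using card_image[OF inj] by simp
qed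

text \<open>A rational relation between the forms on the coordinates outside \<open>bad\<close> is a
  nontrivial combination whose nonzero coefficients all sit inside \<open>bad\<close>; then
  \<open>B1_inv\<close> would be at most \<open>card bad\<close>.\<close>

lemma B1_inv_full_rank:
  fixes u :: "nat \<Rightarrow> nat \<Rightarrow> 'n::finite int_mpoly" and bad :: "'n set"
  assumes k: "1 \<le> k" and B1: "ereal (card bad) < B1_inv k (lead_forms u 1)"
  shows "k \<le> vec.dim ((\<lambda>s. \<chi> i. rat_of_int (if i \<in> bad then 0 else Poly_Mapping.lookup (u 1 s) (Poly_Mapping.single i 1))) ` {1..k})"
proof (rule vec_dim_full, rule ccontr)
  fix c :: "nat \<Rightarrow> rat"
  let ?v = "\<lambda>s. (\<chi> i. rat_of_int (if i \<in> bad then 0 else Poly_Mapping.lookup (u 1 s) (Poly_Mapping.single i 1))) :: rat ^ 'n"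
  let ?S = "\<lambda>c. {m. (\<Sum>s=1..k. c s * rat_of_int (Poly_Mapping.lookup (lead_forms u 1 s) m)) \<noteq> 0}"
  assume zero: "(\<Sum>s=1..k. c s *s ?v s) = 0" and nz: "\<not> (\<forall>s\<in>{1..k}. c s = 0)"
  have "?S c \<subseteq> (\<lambda>i. Poly_Mapping.single i 1) ` bad"
  proof
    fix m assume m: "m \<in> ?S c"
    then obtain s where "Poly_Mapping.lookup (lead_forms u 1 s) m \<noteq> 0"
      by (metis (mono_tags, lifting) mem_Collect_eq mult_zero_right of_int_0 sum.neutral)
    then have deg: "mon_degree m = 1" by (auto simp: lead_forms_def lookup_hom_part split: if_splits)
    from iffD1[OF mon_degree_eq_1_iff deg] obtain i where i: "m = Poly_Mapping.single i 1" by blast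
    have "i \<in> bad"
    proof (rule ccontr)
      assume "i \<notin> bad"
      then have "(\<Sum>s=1..k. c s * rat_of_int (Poly_Mapping.lookup (lead_forms u 1 s) m)) = (\<Sum>s=1..k. c s *s ?v s) $ i"
        using deg by (simp add: lead_forms_def lookup_hom_part i)
      then have "(\<Sum>s=1..k. c s * rat_of_int (Poly_Mapping.lookup (lead_forms u 1 s) m)) = 0"
        unfolding zero zero_index .
      then show False using m by blast
    qed
    then show "m \<in> (\<lambda>i. Poly_Mapping.single i 1) ` bad" using i by blast
  qed
  then have "card (?S c) \<le> card ((\<lambda>i. Poly_Mapping.single i (1::nat)) ` bad)" by (intro card_mono) auto
  also have "\<dots> \<le> card bad" by (rule card_image_le) simp
  finally have "card (?S c) \<le> card bad" .
  moreover have "(LEAST N. \<exists>c :: nat \<Rightarrow> rat. (\<exists>s\<in>{1..k}. c s \<noteq> 0) \<and> N = card (?S c)) \<le> card (?S c)"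
    by (rule Least_le) (use nz in blast)
  ultimately have "B1_inv k (lead_forms u 1) \<le> ereal (card bad)" using k by (simp add: B1_inv_def)
  then show False using B1 by simp
qed

section \<open>Sizes for large P, and the stage of degree one\<close>

lemma eventually_const_powr_le:
  assumes "a < b"
  shows "\<forall>\<^sub>F P::real in at_top. C * P powr a \<le> P powr b"
proof -
  have "((\<lambda>P::real. C * P powr (a - b)) \<longlongrightarrow> C * 0) at_top"
    using assms by (intro tendsto_intros tendsto_neg_powr filterlim_ident) auto
  then have "\<forall>\<^sub>F P::real in at_top. C * P powr (a - b) < 1" by (rule order_tendstoD) simp
  then show ?thesis using eventually_gt_at_top[of "0::real"]
  proof eventually_elim
    case (elim P)
    have "C * P powr a = (C * P powr (a - b)) * P powr b" using elim by (simp add: mult.assoc flip: powr_add)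
    also have "\<dots> \<le> 1 * P powr b" using elim by (intro mult_right_mono) auto
    finally show ?case by simp
  qed
qed

text \<open>T is the longest block with q * T \<le> P^(1 - \<theta>). As q may be as large as
  P^\<theta>, it is only known to be at least about P^(1 - 2 \<theta>); rounding down costs a factor
  2 because the quotient is at least 1.\<close>

lemma block_length:
  fixes P \<theta> :: real and q :: nat
  assumes "1 \<le> P" "0 \<le> \<theta>" "\<theta> \<le> 1 / 2" "1 \<le> q" "real q \<le> P powr \<theta>"
  defines "T \<equiv> nat \<lfloor>P powr (1 - \<theta>) / q\<rfloor>"
  shows "1 \<le> T" "real q * real T \<le> P powr (1 - \<theta>)" "P powr (1 - 2 * \<theta>) \<le> 2 * real T" "real T \<le> P"
proof -
  have "P powr (1 - 2 * \<theta>) * real q \<le> P powr (1 - 2 * \<theta>) * P powr \<theta>" using assms by (intro mult_left_mono) auto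
  also have "\<dots> = P powr (1 - \<theta>)" by (simp flip: powr_add)
  finally have 1: "P powr (1 - 2 * \<theta>) \<le> P powr (1 - \<theta>) / q" using assms by (simp add: pos_le_divide_eq)
  have "1 \<le> P powr (1 - 2 * \<theta>)" using assms by (intro ge_one_powr_ge_zero) auto
  with 1 have 2: "1 \<le> P powr (1 - \<theta>) / q" by linarith
  then show T1: "1 \<le> T" unfolding T_def by (simp add: le_nat_iff le_floor_iff)
  have T: "real T = of_int \<lfloor>P powr (1 - \<theta>) / q\<rfloor>" using 2 by (simp add: T_def)
  then have "real T \<le> P powr (1 - \<theta>) / q" by linarith
  then show qT: "real q * real T \<le> P powr (1 - \<theta>)" using mult_right_mono[of "real T" "P powr (1 - \<theta>) / q" "real q"] assms(4) by (simp add: mult.commute)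
  have "1 \<le> \<lfloor>P powr (1 - \<theta>) / q\<rfloor>" using 2 by (simp add: le_floor_iff)
  then have "1 \<le> real T" unfolding T by linarith
  then have "P powr (1 - \<theta>) / q \<le> 2 * real T" using T by linarith
  then show "P powr (1 - 2 * \<theta>) \<le> 2 * real T" using 1 by linarith
  have "real T \<le> real q * real T" using mult_right_mono[of 1 "real q" "real T"] assms(4) by simp
  moreover have "P powr (1 - \<theta>) \<le> P powr 1" using assms by (intro powr_mono) auto
  ultimately show "real T \<le> P" using qT assms by simp
qed

text \<open>The condition on \<open>B1_inv\<close> says that as many bad coordinates as that, each
  saving P^\<delta>, would contradict the size of the sum. So there are fewer, and Cramer's rule
  applies to the coefficient matrix with the bad columns set to zero. The minors are bounded in
  terms of the system, so q grows by a constant factor, while the distances in degree one are P^(2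
  \<theta> + \<delta> - 1) up to a constant.\<close>

lemma linear_stage:
  fixes u :: "nat \<Rightarrow> nat \<Rightarrow> 'n::finite int_mpoly"
  assumes sys: "is_system d r u" and d: "1 \<le> d" and r1: "1 \<le> r 1" and \<theta>: "0 \<le> \<theta>" "\<theta> \<le> 1 / 2" and \<delta>: "0 < \<delta>"
    and B1: "\<And>b::nat. B1_inv (r 1) (lead_forms u 1) \<le> ereal (real b) \<Longrightarrow> Q < \<delta> * real b"
    and \<Delta>: "2 * \<theta> + \<delta> < \<Delta>"
  shows "\<forall>\<^sub>F P::real in at_top. \<forall>\<alpha>. \<forall>q::nat. 1 \<le> q \<longrightarrow> real q \<le> P powr \<theta> \<longrightarrow>
    (approximates r \<alpha> P {1<..d} \<theta> q) \<longrightarrow>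
    P powr (real CARD('n) - Q) < norm (exp_sum d r u P \<alpha>) \<longrightarrow>
    (\<exists>q'::nat. 1 \<le> q' \<and> real q' \<le> P powr \<Delta> \<and>
      (approximates r \<alpha> P {1..d} \<Delta> q'))"
proof -
  let ?n = "CARD('n)"
  obtain E where E: "E > 0" and inner: "\<And>P \<theta> \<alpha> q T (h :: nat \<Rightarrow> int ^ 'n) a b. 1 \<le> P \<Longrightarrow> 1 \<le> q \<Longrightarrow> 1 \<le> T \<Longrightarrow>
      real q * real T \<le> P powr (1 - \<theta>) \<Longrightarrow> 0 \<le> \<theta> \<Longrightarrow>
      (approximates r \<alpha> P {1<..d} \<theta> q) \<Longrightarrow>
      (\<forall>k\<in>{1..1 - 1}. \<forall>i. \<bar>real_of_int (h k $ i)\<bar> \<le> P) \<Longrightarrow> {a..b} \<subseteq> {0..\<chi> i. \<lfloor>P\<rfloor>} \<Longrightarrow>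
      norm (\<Sum>x\<in>{a..b}. e_fun (mixed_diff {1..1 - 1} h (phase d r u \<alpha>) x))
        \<le> E * (\<Prod>i\<in>UNIV. P / T * geom_bound T (real q * polar_coeff r u \<alpha> 1 h i))"
    using inner_sum_bound[OF sys, of 1] d by blast
  define A0 where "A0 s i = Poly_Mapping.lookup (u 1 s) (Poly_Mapping.single i 1)" for s i
  define X where "X = 1 + (\<Sum>s=1..r 1. \<Sum>i\<in>UNIV. \<bar>real_of_int (A0 s i)\<bar>)"
  have X1: "1 \<le> X" by (simp add: X_def sum_nonneg)
  have XA: "\<bar>real_of_int (A0 s i)\<bar> \<le> X" if "s \<in> {1..r 1}" for s i
  proof -
    have "\<bar>real_of_int (A0 s i)\<bar> \<le> (\<Sum>i\<in>UNIV. \<bar>real_of_int (A0 s i)\<bar>)"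
      by (rule member_le_sum) auto
    also have "\<dots> \<le> (\<Sum>s=1..r 1. \<Sum>i\<in>UNIV. \<bar>real_of_int (A0 s i)\<bar>)"
      by (rule member_le_sum[of s "{1..r 1}" "\<lambda>s. \<Sum>i\<in>UNIV. \<bar>real_of_int (A0 s i)\<bar>"]) (use that in \<open>auto simp: sum_nonneg\<close>)
    finally show ?thesis by (simp add: X_def)
  qed
  define F where "F = fact ?n * X ^ r 1"
  have "X ^ (r 1 - 1) \<le> X ^ r 1" using X1 by (intro power_increasing) auto
  then have F: "fact ?n * X ^ (r 1 - 1) \<le> F" "0 \<le> F" using X1 by (auto simp: F_def)
  \<comment> \<open>The number b of bad coordinates depends on \<alpha> and P but takes finitely
    many values, so one threshold for P serves all of them.\<close>
  have ev: "\<forall>\<^sub>F P::real in at_top. \<forall>b\<in>{..?n}. Q < \<delta> * real b \<longrightarrow> E * P powr (real ?n - \<delta> * real b) \<le> P powr (real ?n - Q)"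
  proof (rule eventually_ball_finite)
    show "\<forall>b\<in>{..?n}. \<forall>\<^sub>F P in at_top. Q < \<delta> * real b \<longrightarrow> E * P powr (real ?n - \<delta> * real b) \<le> P powr (real ?n - Q)"
    proof
      fix b
      show "\<forall>\<^sub>F P in at_top. Q < \<delta> * real b \<longrightarrow> E * P powr (real ?n - \<delta> * real b) \<le> P powr (real ?n - Q)"
        by (cases "Q < \<delta> * real b") (auto intro: eventually_const_powr_le)
    qed
  qed simp
  have "\<forall>\<^sub>F P::real in at_top. F * P powr (2 * \<theta> + \<delta>) \<le> P powr \<Delta>" by (rule eventually_const_powr_le) (rule \<Delta>)
  with ev eventually_ge_at_top[of "1::real"] show ?thesis
  proof eventually_elim
    case (elim P)
    note P = elim(2)
    show ?case
    proof (intro allI impI)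
      fix \<alpha> :: "nat \<Rightarrow> nat \<Rightarrow> real" and q :: nat
      assume q: "1 \<le> q" "real q \<le> P powr \<theta>"
        and maj: "approximates r \<alpha> P {1<..d} \<theta> q"
        and big: "P powr (real ?n - Q) < norm (exp_sum d r u P \<alpha>)"
      define T where "T = nat \<lfloor>P powr (1 - \<theta>) / q\<rfloor>"
      note T = block_length[OF P \<theta> q, folded T_def]
      define h :: "nat \<Rightarrow> int ^ 'n" where "h k = 0" for k
      define lam where "lam i = real q * polar_coeff r u \<alpha> 1 h i" for i
      \<comment> \<open>Chosen so that a bad coordinate contributes at most P / T * (1 / (2 w))
        \<le> P^(2 \<theta>) / w = P^(1 - \<delta>).\<close>
      define w where "w = P powr (- 1 + 2 * \<theta> + \<delta>)"
      have w0: "w > 0" using P by (simp add: w_def)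
      define bad where "bad = {i. w < dist_int (lam i)}"
      have PT: "P / T \<le> 2 * P powr (2 * \<theta>)"
      proof -
        have "P = P powr (2 * \<theta>) * P powr (1 - 2 * \<theta>)" using P by (simp flip: powr_add)
        also have "\<dots> \<le> P powr (2 * \<theta>) * (2 * real T)" using T by (intro mult_left_mono) auto
        finally show ?thesis using T by (simp add: pos_divide_le_eq mult_ac)
      qed
      have factor: "P / T * geom_bound T (lam i) \<le> (if i \<in> bad then P powr (1 - \<delta>) else P)" for i
      proof (cases "i \<in> bad")
        case True
        then have "geom_bound T (lam i) \<le> 1 / (2 * w)" using w0 by (intro geom_bound_le_inverse) (auto simp: bad_def)
        then have "P / T * geom_bound T (lam i) \<le> 2 * P powr (2 * \<theta>) * (1 / (2 * w))"
          using PT P by (intro mult_mono) auto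
        also have "\<dots> = P powr (2 * \<theta>) / w" by simp
        also have "\<dots> = P powr (1 - \<delta>)" by (simp add: w_def flip: powr_diff)
        finally show ?thesis using True by simp
      next
        case False
        have "P / T * geom_bound T (lam i) \<le> P / T * T" using P geom_bound_le by (intro mult_left_mono) auto
        then show ?thesis using T False by simp
      qed
      have "exp_sum d r u P \<alpha> = (\<Sum>x\<in>{0..\<chi> i. \<lfloor>P\<rfloor>}. e_fun (mixed_diff {1..1 - 1} h (phase d r u \<alpha>) x))"
        using P by (simp add: exp_sum_eq)
      also have "norm \<dots> \<le> E * (\<Prod>i\<in>UNIV. P / T * geom_bound T (lam i))"
        unfolding lam_def by (rule inner) (use P q T \<theta> maj in auto)
      also have "\<dots> \<le> E * (\<Prod>i\<in>UNIV. if i \<in> bad then P powr (1 - \<delta>) else P)"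
        using E P by (intro mult_left_mono prod_mono conjI factor) (auto intro!: mult_nonneg_nonneg)
      also have "(\<Prod>i\<in>UNIV. if i \<in> bad then P powr (1 - \<delta>) else P) = P powr (real ?n - \<delta> * real (card bad))"
      proof -
        have "card (- bad) = ?n - card bad" by (simp add: Compl_eq_Diff_UNIV card_Diff_subset)
        then have c: "real (card (- bad)) = real ?n - real (card bad)" by (simp add: of_nat_diff card_mono)
        have "(\<Prod>i\<in>UNIV. if i \<in> bad then P powr (1 - \<delta>) else P) = (P powr (1 - \<delta>)) ^ card bad * P ^ card (- bad)"
          by (simp add: prod.If_cases)
        also have "\<dots> = P powr ((1 - \<delta>) * real (card bad)) * P powr real (card (- bad))"
          using P by (simp add: powr_power powr_realpow mult.commute)
        also have "\<dots> = P powr (real ?n - \<delta> * real (card bad))" unfolding c by (simp add: algebra_simps flip: powr_add)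
        finally show ?thesis .
      qed
      finally have le: "norm (exp_sum d r u P \<alpha>) \<le> E * P powr (real ?n - \<delta> * real (card bad))" .
      have "\<not> Q < \<delta> * real (card bad)"
      proof
        assume "Q < \<delta> * real (card bad)"
        moreover have "card bad \<le> ?n" by (simp add: card_mono)
        ultimately have "E * P powr (real ?n - \<delta> * real (card bad)) \<le> P powr (real ?n - Q)" using elim(1) by blast
        then show False using le big by linarith
      qed
      then have "ereal (real (card bad)) < B1_inv (r 1) (lead_forms u 1)" using B1 by force
      from B1_inv_full_rank[OF r1 this]
      have rank: "r 1 \<le> vec.dim ((\<lambda>s. \<chi> i. rat_of_int ((\<chi> i. if i \<in> bad then 0 else A0 s i) $ i)) ` {1..r 1})"
        by (simp add: A0_def cong: if_cong)
      have lam: "lam i = - (\<Sum>s=1..r 1. real q * \<alpha> 1 s * of_int (A0 s i))" for i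
        using sys d unfolding lam_def A0_def
        by (subst polar_coeff_1) (auto simp: is_system_def sum_distrib_left mult_ac)
      obtain q1 :: nat where q1: "1 \<le> q1" "real q1 \<le> fact ?n * X ^ r 1"
        "\<And>s. s \<in> {1..r 1} \<Longrightarrow> dist_int (real q1 * (real q * \<alpha> 1 s)) \<le> fact ?n * X ^ (r 1 - 1) * w"
      proof (rule cramer_approximation[OF rank X1])
        show "\<bar>real_of_int ((\<chi> i. if i \<in> bad then 0 else A0 s i) $ i)\<bar> \<le> X" if "s \<in> {1..r 1}" for s i
          using XA[OF that, of i] X1 by simp
        show "dist_int (\<Sum>s=1..r 1. real q * \<alpha> 1 s * of_int ((\<chi> i. if i \<in> bad then 0 else A0 s i) $ i)) \<le> w" for i
        proof (cases "i \<in> bad")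
          case True
          then show ?thesis using w0 by (simp add: dist_int_def)
        next
          case False
          then have "(\<Sum>s=1..r 1. real q * \<alpha> 1 s * of_int ((\<chi> i. if i \<in> bad then 0 else A0 s i) $ i)) = - lam i"
            by (simp add: lam)
          then show ?thesis using False by (simp add: bad_def)
        qed
      qed blast
      have FP: "F * P powr a \<le> P powr (a - (2 * \<theta> + \<delta>) + \<Delta>)" for a
      proof -
        have "F * P powr a = (F * P powr (2 * \<theta> + \<delta>)) * P powr (a - (2 * \<theta> + \<delta>))"
          using P by (simp add: mult.assoc flip: powr_add)
        also have "\<dots> \<le> P powr \<Delta> * P powr (a - (2 * \<theta> + \<delta>))" using elim(3) by (intro mult_right_mono) auto
        finally show ?thesis by (simp add: add.commute flip: powr_add)
      qed
      have FP': "F * P powr (a + \<theta>) \<le> P powr (a + \<Delta>)" for a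
        using order.trans[OF FP powr_mono, of "a + \<theta>" "a + \<Delta>"] P \<theta> \<delta> by simp
      show "\<exists>q'::nat. 1 \<le> q' \<and> real q' \<le> P powr \<Delta> \<and>
        (approximates r \<alpha> P {1..d} \<Delta> q')"
      proof (intro exI[of _ "q1 * q"] conjI ballI)
        show "1 \<le> q1 * q" using q q1 by simp
        have "real (q1 * q) \<le> F * P powr (0 + \<theta>)" unfolding of_nat_mult F_def using q q1 by (intro mult_mono) auto
        then show "real (q1 * q) \<le> P powr \<Delta>" using FP'[of 0] by simp
      next
        fix j s assume js: "j \<in> {1..d}" "s \<in> {1..r j}"
        show "dist_int (real (q1 * q) * \<alpha> j s) \<le> P powr (- real j + \<Delta>)"
        proof (cases "j = 1")
          case True
          have "dist_int (real (q1 * q) * \<alpha> j s) \<le> fact ?n * X ^ (r 1 - 1) * w"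
            using q1(3)[of s] js True by (simp add: mult.assoc)
          also have "\<dots> \<le> F * w" using F w0 by (intro mult_right_mono) auto
          also have "\<dots> \<le> P powr (- real j + \<Delta>)" unfolding w_def using FP[of "- 1 + 2 * \<theta> + \<delta>"] True by simp
          finally show ?thesis .
        next
          case False
          have "dist_int (of_int (int q1) * (real q * \<alpha> j s)) \<le> \<bar>of_int (int q1)\<bar> * dist_int (real q * \<alpha> j s)"
            by (rule dist_int_mult_le)
          then have "dist_int (real (q1 * q) * \<alpha> j s) \<le> real q1 * dist_int (real q * \<alpha> j s)" by (simp add: mult.assoc)
          also have "\<dots> \<le> F * P powr (- real j + \<theta>)"
            using q1 maj js False F unfolding F_def by (intro mult_mono) auto
          also have "\<dots> \<le> P powr (- real j + \<Delta>)" by (rule FP')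
          finally show ?thesis .
        qed
      qed
    qed
  qed
qed

subsection \<open>Forms of degree at least two\<close>

lemma harm_le_powr:
  assumes "0 < a" "1 \<le> T" "real T \<le> P"
  shows "(harm T :: real) \<le> (1 + 1 / a) * P powr a"
proof -
  have P: "1 \<le> P" using assms by linarith
  have "(harm T :: real) \<le> 1 + ln (real T)"
    using decseqD[OF decseq_harm_diff_ln, of 0 "T - 1"] assms by (simp add: harm_expand)
  also have "ln (real T) \<le> ln P" using assms P by simp
  also have "ln P \<le> P powr a / a" by (rule ln_powr_bound) (use assms P in auto)
  also have "1 \<le> P powr a" using P assms by (intro ge_one_powr_ge_zero) auto
  finally show ?thesis by (simp add: algebra_simps)
qed

lemma multi_count_cong:
  fixes \<Lambda> :: "(nat \<Rightarrow> int ^ 'n::finite) \<Rightarrow> 'n \<Rightarrow> real"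
  assumes "\<And>k. k \<in> I \<Longrightarrow> A k = B k"
  shows "multi_count I \<Lambda> A w = multi_count I \<Lambda> B w"
proof -
  have "PiE I (\<lambda>k. int_cube (A k)) = (PiE I (\<lambda>k. int_cube (B k)) :: (nat \<Rightarrow> int ^ 'n) set)" using assms by (intro PiE_cong) simp
  then show ?thesis by (simp add: multi_count_def)
qed

text \<open>The distances start out at \<open>1 / T\<close>, and since \<open>P / T\<close> may be large the contraction of
  \<open>symmetric_shrink\<close> is not available for a box of size \<open>P\<close>. The first variable is therefore first cut
  down to size about \<open>T\<close> without any contraction. This loses a factor \<open>(P / T)\<^sup>2\<close> in the final
  width, which is where the \<open>4 * \<theta>\<close> of \<open>differencing_stage\<close> comes from.\<close>

lemma sum_geom_bound_le_multi_count:
  fixes \<Lambda> :: "(nat \<Rightarrow> int ^ 'n::finite) \<Rightarrow> 'n \<Rightarrow> real" and P H :: real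
  defines "K \<equiv> 4 * real CARD('n) ^ 2 + 2"
  assumes c: "1 \<le> c"
    and sym: "\<And>k h. k \<in> {1..c} \<Longrightarrow> \<exists>m. (\<forall>i j. m i j = m j i) \<and> (\<forall>y i. \<Lambda> (h(k := y)) i = (\<Sum>j\<in>UNIV. m i j * of_int (y $ j)))"
    and T: "1 \<le> T" "real T \<le> P" and H: "0 < H" "4 * real CARD('n) * H \<le> T" and small: "16 * real CARD('n) ^ 2 * P * H \<le> (real T)\<^sup>2"
  shows "(\<Sum>h\<in>{1..c} \<rightarrow>\<^sub>E int_cube P. \<Prod>i\<in>UNIV. geom_bound T (\<Lambda> h i))
    \<le> (8 * real T * harm T * K ^ c * (P / H) ^ c) ^ CARD('n) *
       multi_count {1..c} \<Lambda> (\<lambda>k. H) ((H / P) ^ (c - 1) * (4 * real CARD('n) * H / (real T)\<^sup>2))"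
proof -
  let ?n = "real CARD('n)"
  have n1: "1 \<le> ?n" by (simp add: Suc_leI)
  \<comment> \<open>The largest cube for which \<open>symmetric_shrink\<close> admits the width 1 /
    T, since A1 * (1 / T) * 4 n = 1.\<close>
  define A1 where "A1 = T / (4 * ?n)"
  define A0 where "A0 k = (if k = 1 then A1 else P)" for k :: nat
  define J where "J = {2..c}"
  have I: "{1..c} = insert 1 J" "finite J" "1 \<notin> J" using c by (auto simp: J_def)
  have P: "1 \<le> P" using T by linarith
  have A1: "0 < A1" "A1 \<le> P" "H \<le> A1"
  proof -
    show "0 < A1" using T n1 by (simp add: A1_def)
    have "1 \<le> 4 * ?n" using n1 by linarith
    then have "A1 \<le> T / 1" unfolding A1_def by (intro divide_left_mono) auto
    then show "A1 \<le> P" using T by simp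
    show "H \<le> A1" using H n1 by (simp add: A1_def pos_le_divide_eq mult_ac)
  qed
  have z: "0 < H / P" "H / P \<le> 1" "0 < H / A1" "H / A1 \<le> 1" using H A1 P by auto
  have K: "0 < K" by (simp add: K_def add_nonneg_pos)
  have harm: "0 \<le> (harm T :: real)" by (rule harm_nonneg)
  define w1 where "w1 = H / A1 * (1 / T)"
  have w1: "0 < w1" "w1 = 4 * ?n * H / (real T)\<^sup>2" 
  proof -
    show "0 < w1" unfolding w1_def using z T by (intro mult_pos_pos) auto
    show "w1 = 4 * ?n * H / (real T)\<^sup>2" by (simp add: w1_def A1_def power2_eq_square)
  qed
  have "(\<Sum>h\<in>{1..c} \<rightarrow>\<^sub>E int_cube P. \<Prod>i\<in>UNIV. geom_bound T (\<Lambda> h i))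
      = (\<Sum>h\<in>J \<rightarrow>\<^sub>E int_cube P. \<Sum>y\<in>int_cube P. \<Prod>i\<in>UNIV. geom_bound T (\<Lambda> (h(1 := y)) i))"
    unfolding I(1) by (rule sum_PiE_insert[OF I(3)])
  also have "\<dots> \<le> (\<Sum>h\<in>J \<rightarrow>\<^sub>E int_cube P. (2 * real T * harm T * (4 * P / A1)) ^ CARD('n) *
      real (card {y \<in> int_cube A1. \<forall>i. dist_int (\<Lambda> (h(1 := y)) i) \<le> 1 / T}))"
  proof (rule sum_mono, rule sum_geom_bound_le_count)
    fix h :: "nat \<Rightarrow> int ^ 'n" and y y' i
    obtain m where m: "\<And>y i. \<Lambda> (h(1 := y)) i = (\<Sum>j\<in>UNIV. m i j * real_of_int (y $ j))"
      using sym[of 1 h] c by auto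
    show "\<Lambda> (h(1 := y - y')) i = \<Lambda> (h(1 := y)) i - \<Lambda> (h(1 := y')) i"
      unfolding m by (simp add: right_diff_distrib sum_subtractf)
  qed (use T P A1 in auto)
  also have "\<dots> = (2 * real T * harm T * (4 * P / A1)) ^ CARD('n) * multi_count {1..c} \<Lambda> A0 (1 / T)"
  proof -
    have "PiE J (\<lambda>k. int_cube (A0 k)) = (J \<rightarrow>\<^sub>E int_cube P :: (nat \<Rightarrow> int ^ 'n) set)"
      using I(3) by (intro PiE_cong) (auto simp: A0_def)
    then show ?thesis unfolding I(1) multi_count_insert[OF I(2,3)] by (simp add: A0_def sum_distrib_left)
  qed
  also have "\<dots> \<le> (2 * real T * harm T * (4 * P / A1)) ^ CARD('n) * ((K / (H / A1)) ^ CARD('n) * ((((K / (H / P)) ^ CARD('n)) ^ card J) *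
      multi_count {1..c} \<Lambda> (\<lambda>k. H) ((H / P) ^ card J * w1)))"
  proof (rule mult_left_mono)
    have s1: "multi_count {1..c} \<Lambda> A0 (1 / T) \<le> (K / (H / A1)) ^ CARD('n) *
        multi_count {1..c} \<Lambda> (A0(1 := H / A1 * A0 1)) (H / A1 * (1 / T))"
      unfolding K_def
    proof (rule multi_count_shrink)
      show "A0 1 * (1 / real T) * real (4 * CARD('n)) \<le> 1" using T n1 by (simp add: A0_def A1_def)
    qed (use c sym T A1 z in \<open>auto simp: A0_def\<close>)
    \<comment> \<open>After the first variable the width is 4 n H / T^2, which is small enough for
      cubes of size P; that is the content of \<open>small\<close>.\<close>
    have s2: "multi_count {1..c} \<Lambda> (A0(1 := H / A1 * A0 1)) (H / A1 * (1 / T)) \<le>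
        ((K / (H / P)) ^ CARD('n)) ^ card J *
        multi_count {1..c} \<Lambda> (\<lambda>k. if k \<in> J then H / P * P else (A0(1 := H / A1 * A0 1)) k) ((H / P) ^ card J * (H / A1 * (1 / T)))"
      unfolding K_def
    proof (rule multi_count_shrink_all)
      show "0 < H / A1 * (1 / real T)" using w1 by (simp add: w1_def)
      show "P * (H / A1 * (1 / real T)) * real (4 * CARD('n)) \<le> 1"
        using small T unfolding w1_def[symmetric] w1(2) by (simp add: field_simps power2_eq_square)
      show "(A0(1 := H / A1 * A0 1)) k = P" if "k \<in> J" for k using that by (auto simp: A0_def J_def)
      show "\<exists>m. (\<forall>i j. m i j = m j i) \<and> (\<forall>y i. \<Lambda> (h(k := y)) i = (\<Sum>j\<in>UNIV. m i j * of_int (y $ j)))"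
        if "k \<in> {1..c}" for k h using that by (rule sym)
      show "J \<subseteq> {1..c}" by (auto simp: J_def)
    qed (use I z P in auto)
    have s3: "multi_count {1..c} \<Lambda> (\<lambda>k. if k \<in> J then H / P * P else (A0(1 := H / A1 * A0 1)) k) ((H / P) ^ card J * (H / A1 * (1 / T)))
       = multi_count {1..c} \<Lambda> (\<lambda>k. H) ((H / P) ^ card J * w1)"
      unfolding w1_def by (rule multi_count_cong) (use P A1 in \<open>auto simp: A0_def J_def\<close>)
    show "multi_count {1..c} \<Lambda> A0 (1 / T) \<le> (K / (H / A1)) ^ CARD('n) * ((((K / (H / P)) ^ CARD('n)) ^ card J) *
      multi_count {1..c} \<Lambda> (\<lambda>k. H) ((H / P) ^ card J * w1))"
      by (rule order.trans[OF s1], rule mult_left_mono[OF s2[unfolded s3]]) (use K H A1 in \<open>intro zero_le_power divide_nonneg_nonneg, auto\<close>)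
  qed (use T P A1 harm in auto)
  also have "\<dots> = ((2 * real T * harm T * (4 * P / A1)) * (K / (H / A1)) * (K / (H / P)) ^ card J) ^ CARD('n) *
      multi_count {1..c} \<Lambda> (\<lambda>k. H) ((H / P) ^ card J * w1)"
  proof -
    have "a ^ n * (b ^ n * ((e ^ n) ^ m * Z)) = (a * b * e ^ m) ^ n * Z" for a b e Z :: real and n m :: nat
      by (simp add: power_mult_distrib mult.commute[of n] flip: power_mult)
    then show ?thesis .
  qed
  \<comment> \<open>A1 cancels: cutting the first variable down to A1 and contracting it from there
    to H costs the same power of P / H as one contraction from P to H.\<close>
  also have "(2 * real T * harm T * (4 * P / A1)) * (K / (H / A1)) * (K / (H / P)) ^ card J
      = 8 * real T * harm T * ((K * (P / H)) * (K * (P / H)) ^ card J)"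
  proof -
    have e: "K / (H / P) = K * (P / H)" by simp
    have "(2 * real T * harm T * (4 * P / A1)) * (K / (H / A1)) = 8 * real T * harm T * (K * (P / H))"
      using A1 H by simp
    then show ?thesis unfolding e by (simp only: mult.assoc)
  qed
  also have "(K * (P / H)) * (K * (P / H)) ^ card J = K ^ c * (P / H) ^ c"
  proof -
    have "c = Suc (card J)" using c by (simp add: J_def)
    then show ?thesis by (metis power_Suc power_mult_distrib)
  qed
  finally show ?thesis using w1 by (simp add: J_def mult.assoc)
qed

lemma filterlim_powr_at_top:
  assumes "0 < \<eta>"
  shows "filterlim (\<lambda>P::real. P powr \<eta>) at_top at_top"
  unfolding filterlim_at_top
proof
  fix Z :: real
  show "\<forall>\<^sub>F P::real in at_top. Z \<le> P powr \<eta>"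
    using eventually_const_powr_le[OF assms, of Z] eventually_gt_at_top[of "0::real"] by eventually_elim simp
qed

text \<open>Used by contradiction: if all tuples with small distances were singular, there could be
  no more of them than integer points on the singular locus.\<close>

lemma multi_count_le_count_int_points:
  fixes \<Lambda> :: "(nat \<Rightarrow> int ^ 'n::finite) \<Rightarrow> 'n \<Rightarrow> real"
  assumes "M \<subseteq> {1..c} \<rightarrow>\<^sub>E UNIV"
    and "\<And>h. h \<in> {1..c} \<rightarrow>\<^sub>E int_cube H \<Longrightarrow> \<forall>i. dist_int (\<Lambda> h i) \<le> w \<Longrightarrow> (\<lambda>k\<in>{1..c}. cvec (h k)) \<in> M"
  shows "multi_count {1..c} \<Lambda> (\<lambda>k. H) w \<le> real (count_int_points c M H)"
proof -
  let ?S = "{h \<in> {1..c} \<rightarrow>\<^sub>E int_cube H. \<forall>i. dist_int (\<Lambda> h i) \<le> w}"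
  let ?N = "{x \<in> M. \<forall>k\<in>{1..c}. \<forall>i. x k $ i \<in> \<int> \<and> norm (x k $ i) \<le> H}"
  let ?f = "\<lambda>h. \<lambda>k\<in>{1..c}. cvec (h k)"
  have "card ?S \<le> card ?N"
  proof (rule card_inj_on_le[of ?f])
    show "inj_on ?f ?S"
    proof (rule inj_onI)
      fix h h' assume hh: "h \<in> ?S" "h' \<in> ?S" "?f h = ?f h'"
      show "h = h'"
      proof (rule PiE_ext[where k = "{1..c}" and s = "\<lambda>_. int_cube H"])
        fix k assume k: "k \<in> {1..c}"
        have "cvec (h k) = cvec (h' k)" using fun_cong[OF hh(3), of k] k by simp
        then show "h k = h' k" by (rule injD[OF inj_cvec])
      qed (use hh in blast)+
    qed
    show "?f ` ?S \<subseteq> ?N"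
    proof (rule image_subsetI)
      fix h assume h: "h \<in> ?S"
      then have "?f h \<in> M" using assms(2) by blast
      moreover have "?f h k $ i \<in> \<int> \<and> norm (?f h k $ i) \<le> H" if k: "k \<in> {1..c}" for k i
      proof -
        have "h k \<in> int_cube H" using h k by blast
        then show ?thesis using k by (simp add: cvec_def int_cube_def)
      qed
      ultimately show "?f h \<in> ?N" by blast
    qed
    show "finite ?N" by (rule finite_subset[OF integer_points_subset[OF assms(1)]]) (auto intro!: finite_PiE)
  qed
  then show ?thesis by (simp add: multi_count_def count_int_points_def)
qed

text \<open>The locus is defined by \<open>Gam\<close> of the leading forms. By
  \<open>mixed_diff_hom_part\<close> these values are the integers that occur in
  \<open>polar_coeff\<close>, so a tuple off the locus gives the rank needed for Cramer's
  rule.\<close>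

lemma full_rank_off_sing_locus:
  fixes u :: "nat \<Rightarrow> nat \<Rightarrow> 'n::finite int_mpoly" and h :: "nat \<Rightarrow> int ^ 'n"
  assumes deg: "\<And>s. s \<in> {1..r} \<Longrightarrow> mpoly_degree (u l s) = l" and l: "1 \<le> l"
    and h: "(\<lambda>k\<in>{1..l - 1}. cvec (h k)) \<notin> sing_locus l r (lead_forms u l)"
  shows "r \<le> vec.dim ((\<lambda>s. \<chi> i. complex_of_int ((\<chi> i. mixed_diff {1..l} (h(l := axis i 1)) (mpoly_eval (u l s)) 0) $ i)) ` {1..r})"
proof -
  let ?x = "\<lambda>k\<in>{1..l - 1}. cvec (h k)"
  have "Gam l (mpoly_eval (lead_forms u l s)) (?x(l := axis i 1)) = of_int (mixed_diff {1..l} (h(l := axis i 1)) (mpoly_eval (u l s)) 0)"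
    if s: "s \<in> {1..r}" for s i
  proof -
    have "Gam l (mpoly_eval (lead_forms u l s)) (?x(l := axis i 1)) = of_int (mixed_diff {1..l} (h(l := axis i 1)) (mpoly_eval (lead_forms u l s)) 0)"
    proof (rule Gam_eq_mixed_diff)
      fix k assume "k \<in> {1..l}"
      then show "(?x(l := axis i 1)) k = cvec ((h(l := axis i 1)) k)"
        by (cases "k = l") (auto simp: cvec_axis)
    qed
    also have "mixed_diff {1..l} (h(l := axis i 1)) (mpoly_eval (lead_forms u l s)) 0 = (mixed_diff {1..l} (h(l := axis i 1)) (mpoly_eval (u l s)) 0 :: int)"
      unfolding lead_forms_def by (rule mixed_diff_hom_part[OF deg[OF s] l])
    finally show ?thesis .
  qed
  then have "(\<lambda>s. \<chi> i. Gam l (mpoly_eval (lead_forms u l s)) (?x(l := axis i 1))) ` {1..r}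
      = (\<lambda>s. \<chi> i. complex_of_int ((\<chi> i. mixed_diff {1..l} (h(l := axis i 1)) (mpoly_eval (u l s)) 0) $ i)) ` {1..r}"
    by (intro image_cong refl) (simp add: vec_eq_iff)
  moreover have "?x \<in> {1..l - 1} \<rightarrow>\<^sub>E UNIV" by simp
  ultimately show ?thesis using h unfolding sing_locus_def mem_Collect_eq by (metis not_le)
qed

text \<open>The assumption that all counted tuples are singular is played off against Weyl's
  inequality. Half of the spare \<epsilon> pushes \<eta> beyond its critical value, the other half
  absorbs constants. The quantifiers over \<alpha> and q stand inside the eventuality, so the
  threshold for P does not depend on them.\<close>

lemma differencing_stage:
  fixes u :: "nat \<Rightarrow> nat \<Rightarrow> 'n::finite int_mpoly"
  assumes sys: "is_system d r u" and l: "2 \<le> l" "l \<le> d" and rl: "1 \<le> r l"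
    and g: "0 < g_inv l (r l) (lead_forms u l)"
    and \<gamma>: "\<gamma> = 2 ^ (l - 1) * real (l - 1) * real (r l) / g_inv l (r l) (lead_forms u l)"
    and \<theta>: "0 \<le> \<theta>" and Q: "0 \<le> Q" and \<epsilon>: "0 < \<epsilon>" and \<theta>': "\<theta>' = 4 * \<theta> + Q * \<gamma> + \<epsilon>" "\<theta>' < 1"
  shows "\<forall>\<^sub>F P::real in at_top. \<forall>\<alpha>. \<forall>q::nat. 1 \<le> q \<longrightarrow> real q \<le> P powr \<theta> \<longrightarrow>
    (approximates r \<alpha> P {l<..d} \<theta> q) \<longrightarrow>
    P powr (real CARD('n) - Q) < norm (exp_sum d r u P \<alpha>) \<longrightarrow>
    (\<exists>q'::nat. 1 \<le> q' \<and> real q' \<le> P powr \<theta>' \<and>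
      (approximates r \<alpha> P {l..d} \<theta>' q'))"
proof -
  let ?n = "CARD('n)"
  let ?N = "real CARD('n)"
  define c where "c = l - 1"
  define G where "G = g_inv l (r l) (lead_forms u l)"
  define cR where "cR = real c * real (r l)"
  \<comment> \<open>A minor of order r l has size about (H^c)^(r l) with H = P^\<eta>; this choice
    makes it P^(Q * \<gamma> + \<epsilon> / 2).\<close>
  define \<eta> where "\<eta> = (Q * \<gamma> + \<epsilon> / 2) / cR"
  \<comment> \<open>Half of the surplus of \<eta> * G over 2^c * Q. Of the surplus 2 \<kappa>, one
    \<kappa> pays for the \<epsilon> in the definition of \<open>g_inv\<close>, \<kappa> / 2 for the
    harmonic sums, and \<kappa> / 2 is left to beat the constants.\<close>
  define \<kappa> where "\<kappa> = \<epsilon> * G / (4 * cR)"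
  define K where "K = 4 * ?N ^ 2 + 2"
  have n1: "1 \<le> ?N" by (simp add: Suc_leI)
  have c: "1 \<le> c" "l = c + 1" using l by (auto simp: c_def)
  have cR: "1 \<le> cR" unfolding cR_def using c rl mult_mono[of 1 "real c" 1 "real (r l)"] by simp
  have G: "0 < G" "Q * \<gamma> * G = 2 ^ c * Q * cR" using g by (auto simp: G_def \<gamma> c_def cR_def)
  have Q\<gamma>: "0 \<le> Q * \<gamma>" unfolding \<gamma> using Q g by simp
  have \<eta>cR: "\<eta> * cR = Q * \<gamma> + \<epsilon> / 2" using cR by (simp add: \<eta>_def)
  have \<eta>: "0 < \<eta>" "\<eta> \<le> Q * \<gamma> + \<epsilon> / 2"
  proof -
    show "0 < \<eta>" using Q\<gamma> \<epsilon> cR by (simp add: \<eta>_def)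
    then have "\<eta> * 1 \<le> \<eta> * cR" using cR by (intro mult_left_mono) auto
    then show "\<eta> \<le> Q * \<gamma> + \<epsilon> / 2" by (simp add: \<eta>cR)
  qed
  have \<kappa>: "0 < \<kappa>" using \<epsilon> G cR by (simp add: \<kappa>_def)
  have \<eta>G: "\<eta> * G = 2 ^ c * Q + 2 * \<kappa>"
  proof -
    have "\<eta> * G = (Q * \<gamma> * G + \<epsilon> / 2 * G) / cR" by (simp add: \<eta>_def algebra_simps)
    also have "\<dots> = 2 ^ c * Q + 2 * \<kappa>" unfolding G(2) using cR by (simp add: \<kappa>_def field_simps)
    finally show ?thesis .
  qed
  have room: "4 * \<theta> + \<eta> < 1" "\<theta> \<le> 1 / 2" using \<theta>' \<theta> \<eta> \<epsilon> Q\<gamma> by linarith+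
  obtain E where E: "E > 0" and inner: "\<And>P \<theta> \<alpha> q T (h :: nat \<Rightarrow> int ^ 'n) a b. 1 \<le> P \<Longrightarrow> 1 \<le> q \<Longrightarrow> 1 \<le> T \<Longrightarrow>
      real q * real T \<le> P powr (1 - \<theta>) \<Longrightarrow> 0 \<le> \<theta> \<Longrightarrow>
      (approximates r \<alpha> P {l<..d} \<theta> q) \<Longrightarrow>
      (\<forall>k\<in>{1..l - 1}. \<forall>i. \<bar>real_of_int (h k $ i)\<bar> \<le> P) \<Longrightarrow> {a..b} \<subseteq> {0..\<chi> i. \<lfloor>P\<rfloor>} \<Longrightarrow>
      norm (\<Sum>x\<in>{a..b}. e_fun (mixed_diff {1..l - 1} h (phase d r u \<alpha>) x))
        \<le> E * (\<Prod>i\<in>UNIV. P / T * geom_bound T (real q * polar_coeff r u \<alpha> l h i))"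
    using inner_sum_bound[OF sys order.trans[OF one_le_numeral l(1)] l(2)] by blast
  define cnt where "cnt H = real (count_int_points (l - 1) (sing_locus l (r l) (lead_forms u l)) H)" for H
  have "cnt \<in> O[at_top](\<lambda>H. H powr (?N * real c - G + \<kappa> / \<eta>))"
    using g_inv_bound[OF l(1) rl, of "\<kappa> / \<eta>" "lead_forms u l"] \<kappa> \<eta>
    unfolding cnt_def[abs_def] G_def c_def of_nat_mult by simp
  from landau_o.bigE[OF this] obtain C1 where C1: "0 < C1"
    "\<forall>\<^sub>F H in at_top. norm (cnt H) \<le> C1 * norm (H powr (?N * real c - G + \<kappa> / \<eta>))" by blast
  have count: "\<forall>\<^sub>F H in at_top. cnt H \<le> C1 * H powr (?N * real c - G + \<kappa> / \<eta>)"
    using C1(2) by (rule eventually_mono) simp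
  have deg: "mpoly_degree (u l s) = l" if "s \<in> {1..r l}" for s using sys l that by (simp add: is_system_def)
  define \<Gamma> where "\<Gamma> h s i = mixed_diff {1..l} (h(l := axis i 1)) (mpoly_eval (u l s)) (0 :: int ^ 'n)" for h :: "nat \<Rightarrow> int ^ 'n" and s i
  obtain C2 where C2: "1 \<le> C2" and size: "\<And>A h s i. 0 \<le> A \<Longrightarrow> s \<in> {1..r l} \<Longrightarrow> (\<And>k. k \<in> {1..c} \<Longrightarrow> h k \<in> int_cube A) \<Longrightarrow>
      \<bar>real_of_int (\<Gamma> h s i)\<bar> \<le> C2 * A ^ c"
  proof -
    have "\<exists>C\<ge>0. \<forall>A\<ge>0. \<forall>h. (\<forall>k\<in>{1..c}. h k \<in> int_cube A) \<longrightarrow> (\<forall>k\<in>{1..l} - {1..c}. h k \<in> range (\<lambda>j. axis j 1)) \<longrightarrow>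
      \<bar>real_of_int (mixed_diff {1..l} h (mpoly_eval (u l s)) (0 :: int ^ 'n))\<bar> \<le> C * A ^ card {1..c}" if s: "s \<in> {1..r l}" for s
      using deg[OF s] poly_deg_le_mpoly_eval[of "u l s"] by (intro mixed_diff_size) (auto simp: c)
    then have "\<forall>s\<in>{1..r l}. \<exists>C. C \<ge> 0 \<and> (\<forall>A\<ge>0. \<forall>h. (\<forall>k\<in>{1..c}. h k \<in> int_cube A) \<longrightarrow> (\<forall>k\<in>{1..l} - {1..c}. h k \<in> range (\<lambda>j. axis j 1)) \<longrightarrow>
      \<bar>real_of_int (mixed_diff {1..l} h (mpoly_eval (u l s)) (0 :: int ^ 'n))\<bar> \<le> C * A ^ card {1..c})" by blast
    from bchoice[OF this] obtain C where C: "\<And>s. s \<in> {1..r l} \<Longrightarrow> 0 \<le> C s" and bound: "\<And>s A h. s \<in> {1..r l} \<Longrightarrow> 0 \<le> A \<Longrightarrow> (\<forall>k\<in>{1..c}. h k \<in> int_cube A) \<Longrightarrow>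
       (\<forall>k\<in>{1..l} - {1..c}. h k \<in> range (\<lambda>j. axis j 1)) \<Longrightarrow>
       \<bar>real_of_int (mixed_diff {1..l} h (mpoly_eval (u l s)) (0 :: int ^ 'n))\<bar> \<le> C s * A ^ card {1..c}" by blast
    show ?thesis
    proof (rule that[of "1 + (\<Sum>s=1..r l. C s)"])
      show "1 \<le> 1 + (\<Sum>s=1..r l. C s)" using sum_nonneg[of "{1..r l}" C] C by simp
      fix A :: real and h :: "nat \<Rightarrow> int ^ 'n" and s i assume A: "0 \<le> A" and s: "s \<in> {1..r l}" and h: "\<And>k. k \<in> {1..c} \<Longrightarrow> h k \<in> int_cube A"
      have "\<bar>real_of_int (\<Gamma> h s i)\<bar> \<le> C s * A ^ card {1..c}" unfolding \<Gamma>_def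
        by (rule bound[OF s A]) (use h c in auto)
      also have "\<dots> \<le> (1 + (\<Sum>s=1..r l. C s)) * A ^ card {1..c}"
      proof (rule mult_right_mono)
        have "C s \<le> (\<Sum>s=1..r l. C s)" by (rule member_le_sum) (use C s in auto)
        then show "C s \<le> 1 + (\<Sum>s=1..r l. C s)" by simp
      qed (use A in simp)
      finally show "\<bar>real_of_int (\<Gamma> h s i)\<bar> \<le> (1 + (\<Sum>s=1..r l. C s)) * A ^ c" by simp
    qed
  qed
  define a where "a = \<kappa> / (2 * ?N)"
  have a: "0 < a" using \<kappa> n1 by (simp add: a_def)
  define C3 where "C3 = E * (8 * K ^ c * (1 + 1 / a)) ^ ?n * C1"
  define F where "F = fact ?n * C2 ^ r l * (16 * ?N)"
  \<comment> \<open>This condition and the next one give 4 n H \<le> T and 16 n^2 P H \<le> T^2, by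
    T \<ge> P^(1 - 2 \<theta>) / 2; both hold because 4 \<theta> + \<eta> < 1.\<close>
  have "\<forall>\<^sub>F P::real in at_top. 8 * ?N * P powr \<eta> \<le> P powr (1 - 2 * \<theta>)"
    by (rule eventually_const_powr_le) (use room \<theta> in linarith)
  moreover have "\<forall>\<^sub>F P::real in at_top. 64 * ?N ^ 2 * P powr (1 + \<eta>) \<le> P powr (2 - 4 * \<theta>)"
    by (rule eventually_const_powr_le) (use room \<theta> in linarith)
  moreover have "\<forall>\<^sub>F P::real in at_top. cnt (P powr \<eta>) \<le> C1 * (P powr \<eta>) powr (?N * real c - G + \<kappa> / \<eta>)"
    by (rule eventually_compose_filterlim[OF count]) (rule filterlim_powr_at_top[OF \<eta>(1)])
  moreover have "\<forall>\<^sub>F P::real in at_top. 2 * (3 ^ ?n) ^ (2 ^ c) * C3 * P powr (- \<kappa> / 2) \<le> P powr 0"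
    by (rule eventually_const_powr_le) (use \<kappa> in linarith)
  moreover have "\<forall>\<^sub>F P::real in at_top. F * P powr (\<epsilon> / 2) \<le> P powr \<epsilon>"
    by (rule eventually_const_powr_le) (use \<epsilon> in linarith)
  ultimately show ?thesis using eventually_ge_at_top[of "1::real"]
  proof eventually_elim
    case (elim P)
    note P = elim(6)
    show ?case
    proof (intro allI impI)
      fix \<alpha> :: "nat \<Rightarrow> nat \<Rightarrow> real" and q :: nat
      assume q: "1 \<le> q" "real q \<le> P powr \<theta>"
        and maj: "approximates r \<alpha> P {l<..d} \<theta> q"
        and big: "P powr (?N - Q) < norm (exp_sum d r u P \<alpha>)"
      define T where "T = nat \<lfloor>P powr (1 - \<theta>) / q\<rfloor>"
      note T = block_length[OF P \<theta> room(2) q, folded T_def]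
      define H where "H = P powr \<eta>"
      define \<Lambda> where "\<Lambda> h i = real q * polar_coeff r u \<alpha> l h i" for h i
      define w where "w = (H / P) ^ (c - 1) * (4 * ?N * H / (real T)\<^sup>2)"
      define MC where "MC = multi_count {1..c} \<Lambda> (\<lambda>k. H) w"
      have H: "1 \<le> H" "0 < H" using P \<eta> by (auto simp: H_def intro!: ge_one_powr_ge_zero)
      have T2: "P powr (2 - 4 * \<theta>) \<le> 4 * (real T)\<^sup>2"
      proof -
        have "(P powr (1 - 2 * \<theta>))\<^sup>2 \<le> (2 * real T)\<^sup>2" using T by (intro power_mono) auto
        also have "(P powr (1 - 2 * \<theta>))\<^sup>2 = P powr (2 - 4 * \<theta>)"
          using P by (simp add: powr_power algebra_simps)
        finally show ?thesis by (simp add: power_mult_distrib)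
      qed
      have \<Lambda>sym: "\<exists>m. (\<forall>i j. m i j = m j i) \<and> (\<forall>y i. \<Lambda> (h(k := y)) i = (\<Sum>j\<in>UNIV. m i j * of_int (y $ j)))"
        if "k \<in> {1..c}" for k h
        unfolding \<Lambda>_def by (rule polar_coeff_symmetric) (use deg that in \<open>auto simp: c_def\<close>)
      obtain h where h: "h \<in> {1..c} \<rightarrow>\<^sub>E int_cube H" "\<And>i. dist_int (\<Lambda> h i) \<le> w"
        and off: "(\<lambda>k\<in>{1..l - 1}. cvec (h k)) \<notin> sing_locus l (r l) (lead_forms u l)"
      proof (rule ccontr)
        assume none: "\<not> thesis"
        have MC: "MC \<le> C1 * P powr (\<eta> * ?N * real c - 2 ^ c * Q - \<kappa>)"
        proof -
          have "MC \<le> real (count_int_points c (sing_locus l (r l) (lead_forms u l)) H)"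
            unfolding MC_def
          proof (rule multi_count_le_count_int_points)
            show "sing_locus l (r l) (lead_forms u l) \<subseteq> {1..c} \<rightarrow>\<^sub>E UNIV" by (auto simp: sing_locus_def c_def)
          qed (use none that in \<open>auto simp: c_def\<close>)
          also have "\<dots> \<le> C1 * (P powr \<eta>) powr (?N * real c - G + \<kappa> / \<eta>)" using elim(3) by (simp add: cnt_def H_def c_def)
          also have "(P powr \<eta>) powr (?N * real c - G + \<kappa> / \<eta>) = P powr (\<eta> * ?N * real c - 2 ^ c * Q - \<kappa>)"
          proof -
            have "\<eta> * (?N * real c - G + \<kappa> / \<eta>) = \<eta> * ?N * real c - \<eta> * G + \<kappa>" using \<eta> by (simp add: algebra_simps)
            then show ?thesis by (simp add: powr_powr \<eta>G)
          qed
          finally show ?thesis .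
        qed
        \<comment> \<open>The normalising cube has between P^n and (3 P)^n points: the lower bound
          serves the right-hand side of Weyl's inequality, the upper bound the left-hand
          side.\<close>
        define V where "V = real (card (int_cube P :: (int ^ 'n) set))"
        have V: "P ^ ?n \<le> V" "V \<le> (3 * P) ^ ?n" "0 < V"
        proof -
          have V: "V = (2 * of_int \<lfloor>P\<rfloor> + 1) ^ ?n" unfolding V_def using P by (intro card_int_cube) auto
          have f: "P \<le> 2 * of_int \<lfloor>P\<rfloor> + 1" "2 * of_int \<lfloor>P\<rfloor> + 1 \<le> 3 * P" using P by linarith+
          show "P ^ ?n \<le> V" unfolding V using f P by (intro power_mono) auto
          show "V \<le> (3 * P) ^ ?n" unfolding V using f P by (intro power_mono) auto
          show "0 < V" unfolding V using f P by (intro zero_less_power) linarith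
        qed
        have "(norm (\<Sum>x\<in>{0..\<chi> i. \<lfloor>P\<rfloor>}. e_fun (phase d r u \<alpha> x)) / V) ^ (2 ^ card {1..c})
          \<le> (\<Sum>h\<in>{1..c} \<rightarrow>\<^sub>E int_cube P. E * (\<Prod>i\<in>UNIV. P / T * geom_bound T (\<Lambda> h i))) / V ^ (card {1..c} + 1)"
          unfolding V_def
        proof (rule weyl_differencing)
          fix x y :: "int ^ 'n" assume "x \<in> {0..\<chi> i. \<lfloor>P\<rfloor>}" "y \<in> {0..\<chi> i. \<lfloor>P\<rfloor>}"
          then have xy: "0 \<le> x $ i" "x $ i \<le> \<lfloor>P\<rfloor>" "0 \<le> y $ i" "y $ i \<le> \<lfloor>P\<rfloor>" for i by (auto simp: less_eq_vec_def)
          have "\<bar>real_of_int ((y - x) $ i)\<bar> \<le> P" for i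
            using xy[of i] by (simp add: le_floor_iff)
          then show "y - x \<in> int_cube P" by (simp add: int_cube_def)
        next
          fix h :: "nat \<Rightarrow> int ^ 'n" and a' b' :: "int ^ 'n" assume h: "h \<in> {1..c} \<rightarrow>\<^sub>E int_cube P" and ab: "{a'..b'} \<subseteq> {0..\<chi> i. \<lfloor>P\<rfloor>}"
          have "\<forall>k\<in>{1..l - 1}. \<forall>i. \<bar>real_of_int (h k $ i)\<bar> \<le> P"
          proof
            fix k assume "k \<in> {1..l - 1}"
            then have "h k \<in> int_cube P" using h by (auto simp: c_def)
            then show "\<forall>i. \<bar>real_of_int (h k $ i)\<bar> \<le> P" by (simp add: int_cube_def)
          qed
          from inner[OF P q(1) T(1,2) \<theta> maj this ab]
          show "norm (\<Sum>x\<in>{a'..b'}. e_fun (mixed_diff {1..c} h (phase d r u \<alpha>) x)) \<le> E * (\<Prod>i\<in>UNIV. P / T * geom_bound T (\<Lambda> h i))"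
            by (simp only: c_def \<Lambda>_def)
        qed simp_all
        then have weyl: "(norm (exp_sum d r u P \<alpha>) / V) ^ (2 ^ c)
          \<le> (\<Sum>h\<in>{1..c} \<rightarrow>\<^sub>E int_cube P. E * (\<Prod>i\<in>UNIV. P / T * geom_bound T (\<Lambda> h i))) / V ^ (c + 1)"
          using P by (simp add: exp_sum_eq)
        have "(\<Sum>h\<in>{1..c} \<rightarrow>\<^sub>E int_cube P. E * (\<Prod>i\<in>UNIV. P / T * geom_bound T (\<Lambda> h i)))
          = E * (P / T) ^ ?n * (\<Sum>h\<in>{1..c} \<rightarrow>\<^sub>E int_cube P. \<Prod>i\<in>UNIV. geom_bound T (\<Lambda> h i))"
          by (simp only: prod.distrib prod_constant sum_distrib_left mult.assoc)
        also have "\<dots> \<le> E * (P / T) ^ ?n * ((8 * real T * harm T * K ^ c * (P / H) ^ c) ^ ?n * MC)"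
          unfolding K_def MC_def w_def
        proof (intro mult_left_mono sum_geom_bound_le_multi_count)
          show "4 * ?N * H \<le> real T" using elim(1) T by (simp add: H_def)
          have "16 * ?N ^ 2 * P * H = 16 * ?N ^ 2 * P powr (1 + \<eta>)" using P by (simp add: H_def powr_add)
          then show "16 * ?N ^ 2 * P * H \<le> (real T)\<^sup>2" using elim(2) T2 by linarith
          show "0 \<le> E * (P / real T) ^ ?n" using E P by simp
        qed (use c \<Lambda>sym T H in auto)
        also have "\<dots> = E * (8 * P * harm T * K ^ c * (P / H) ^ c) ^ ?n * MC"
        proof -
          have "(P / T) ^ ?n * (8 * real T * harm T * K ^ c * (P / H) ^ c) ^ ?n = (P / T * (8 * real T * harm T * K ^ c * (P / H) ^ c)) ^ ?n"
            by (rule power_mult_distrib[symmetric])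
          also have "P / T * (8 * real T * harm T * K ^ c * (P / H) ^ c) = 8 * P * harm T * K ^ c * (P / H) ^ c" using T by simp
          finally have f: "(P / T) ^ ?n * (8 * real T * harm T * K ^ c * (P / H) ^ c) ^ ?n = (8 * P * harm T * K ^ c * (P / H) ^ c) ^ ?n" .
          show ?thesis unfolding f[symmetric] by (simp only: mult_ac)
        qed
        also have "\<dots> \<le> E * (8 * P * ((1 + 1 / a) * P powr a) * K ^ c * (P / H) ^ c) ^ ?n * MC"
          using P E H harm_nonneg[where ?'a = real] T(4)
          by (intro mult_right_mono mult_left_mono power_mono harm_le_powr a T mult_nonneg_nonneg)
             (auto simp: MC_def multi_count_def K_def intro!: mult_nonneg_nonneg)
        also have "\<dots> = E * (8 * K ^ c * (1 + 1 / a)) ^ ?n * ((P powr a) ^ ?n * ((P ^ ?n) ^ (c + 1) / (H ^ c) ^ ?n)) * MC"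
        proof -
          have 1: "8 * P * ((1 + 1 / a) * P powr a) * K ^ c * (P / H) ^ c = (8 * K ^ c * (1 + 1 / a)) * (P powr a * (P ^ (c + 1) / H ^ c))"
            by (simp add: power_divide)
          have 2: "(P ^ (c + 1)) ^ ?n = (P ^ ?n) ^ (c + 1)" by (simp only: power_mult[symmetric] mult.commute)
          have "E * (x * (y * (v / t))) ^ k * MC = E * x ^ k * (y ^ k * (v ^ k / t ^ k)) * MC" for x y v t :: real and k
            by (simp add: power_mult_distrib power_divide)
          then show ?thesis unfolding 1 2[symmetric] .
        qed
        also have "(P powr a) ^ ?n = P powr (\<kappa> / 2)" using P n1 by (simp add: powr_power a_def)
        also have "(H ^ c) ^ ?n = P powr (\<eta> * ?N * real c)" using P by (simp add: H_def powr_power mult_ac)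
        finally have sum_le: "(\<Sum>h\<in>{1..c} \<rightarrow>\<^sub>E int_cube P. E * (\<Prod>i\<in>UNIV. P / T * geom_bound T (\<Lambda> h i)))
          \<le> E * (8 * K ^ c * (1 + 1 / a)) ^ ?n * (P powr (\<kappa> / 2) * ((P ^ ?n) ^ (c + 1) / P powr (\<eta> * ?N * real c))) * MC" .
        have pos: "0 \<le> E * (8 * K ^ c * (1 + 1 / a)) ^ ?n" using E a by (simp add: K_def)
        have "(norm (exp_sum d r u P \<alpha>) / V) ^ (2 ^ c)
          \<le> E * (8 * K ^ c * (1 + 1 / a)) ^ ?n * (P powr (\<kappa> / 2) * ((P ^ ?n) ^ (c + 1) / P powr (\<eta> * ?N * real c))) * MC / V ^ (c + 1)"
          by (rule order.trans[OF weyl divide_right_mono[OF sum_le]]) (use V in simp)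
        also have "\<dots> \<le> E * (8 * K ^ c * (1 + 1 / a)) ^ ?n * (P powr (\<kappa> / 2) * ((P ^ ?n) ^ (c + 1) / P powr (\<eta> * ?N * real c))) * MC / (P ^ ?n) ^ (c + 1)"
        proof (intro divide_left_mono power_mono)
          show "0 \<le> E * (8 * K ^ c * (1 + 1 / a)) ^ ?n * (P powr (\<kappa> / 2) * ((P ^ ?n) ^ (c + 1) / P powr (\<eta> * ?N * real c))) * MC"
            by (intro mult_nonneg_nonneg[OF mult_nonneg_nonneg[OF pos]]) (use P in \<open>auto simp: MC_def multi_count_def\<close>)
        qed (use V P in auto)
        also have "\<dots> = E * (8 * K ^ c * (1 + 1 / a)) ^ ?n * (P powr (\<kappa> / 2) / P powr (\<eta> * ?N * real c)) * MC"
          using P by simp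
        also have "\<dots> \<le> E * (8 * K ^ c * (1 + 1 / a)) ^ ?n * (P powr (\<kappa> / 2) / P powr (\<eta> * ?N * real c)) * (C1 * P powr (\<eta> * ?N * real c - 2 ^ c * Q - \<kappa>))"
          using MC pos by (intro mult_left_mono) auto
        also have "\<dots> = C3 * (P powr (\<kappa> / 2) / P powr (\<eta> * ?N * real c) * P powr (\<eta> * ?N * real c - 2 ^ c * Q - \<kappa>))"
          by (simp add: C3_def)
        also have "P powr (\<kappa> / 2) / P powr (\<eta> * ?N * real c) * P powr (\<eta> * ?N * real c - 2 ^ c * Q - \<kappa>) = P powr (- \<kappa> / 2) * P powr (- (2 ^ c * Q))"
          by (simp add: algebra_simps flip: powr_add powr_diff)
        finally have upper: "(norm (exp_sum d r u P \<alpha>) / V) ^ (2 ^ c) \<le> C3 * P powr (- \<kappa> / 2) * P powr (- (2 ^ c * Q))" by simp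
        have "P powr (- Q) / 3 ^ ?n \<le> norm (exp_sum d r u P \<alpha>) / V"
        proof -
          have "P powr (- Q) / 3 ^ ?n = P powr (?N - Q) / (3 * P) ^ ?n"
            using P by (simp add: powr_diff powr_realpow powr_minus_divide power_mult_distrib)
          also have "\<dots> \<le> P powr (?N - Q) / V" using V P by (intro divide_left_mono) auto
          also have "\<dots> \<le> norm (exp_sum d r u P \<alpha>) / V" using big V by (intro divide_right_mono) auto
          finally show ?thesis .
        qed
        then have "(P powr (- Q) / 3 ^ ?n) ^ (2 ^ c) \<le> (norm (exp_sum d r u P \<alpha>) / V) ^ (2 ^ c)" by (intro power_mono) auto
        moreover have "(P powr (- Q) / 3 ^ ?n) ^ (2 ^ c) = P powr (- (2 ^ c * Q)) / (3 ^ ?n) ^ (2 ^ c)"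
          using P by (simp add: power_divide powr_power mult.commute)
        ultimately have "P powr (- (2 ^ c * Q)) / (3 ^ ?n) ^ (2 ^ c) \<le> C3 * P powr (- \<kappa> / 2) * P powr (- (2 ^ c * Q))" using upper by linarith
        \<comment> \<open>The power P^(- 2^c * Q) cancels, which leaves a constant against a
          negative power of P.\<close>
        then have "1 \<le> (3 ^ ?n) ^ (2 ^ c) * C3 * P powr (- \<kappa> / 2)" using P by (simp add: field_simps)
        then show False using elim(4) P by simp
      qed
      define X where "X = C2 * H ^ c"
      have X1: "1 \<le> X" unfolding X_def using C2 one_le_power[OF H(1), of c] mult_mono[of 1 C2 1 "H ^ c"] by simp
      have hcube: "h k \<in> int_cube H" if "k \<in> {1..c}" for k using h(1) that by blast
      have rank: "r l \<le> vec.dim ((\<lambda>s. \<chi> i. complex_of_int ((\<chi> i. \<Gamma> h s i) $ i)) ` {1..r l})"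
        unfolding \<Gamma>_def by (rule full_rank_off_sing_locus) (use deg off l in auto)
      obtain q1 :: nat where q1: "1 \<le> q1" "real q1 \<le> fact ?n * X ^ r l"
        "\<And>s. s \<in> {1..r l} \<Longrightarrow> dist_int (real q1 * (real q * \<alpha> l s)) \<le> fact ?n * X ^ (r l - 1) * w"
      proof (rule cramer_approximation[OF rank X1])
        show "\<bar>real_of_int ((\<chi> i. \<Gamma> h s i) $ i)\<bar> \<le> X" if "s \<in> {1..r l}" for s i
          unfolding X_def vec_lambda_beta by (rule size) (use H that hcube in auto)
        show "dist_int (\<Sum>s=1..r l. real q * \<alpha> l s * of_int ((\<chi> i. \<Gamma> h s i) $ i)) \<le> w" for i
        proof -
          have "(\<Sum>s=1..r l. real q * \<alpha> l s * of_int ((\<chi> i. \<Gamma> h s i) $ i)) = \<Lambda> h i"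
            by (simp add: \<Lambda>_def polar_coeff_def \<Gamma>_def sum_distrib_left mult.assoc)
          then show ?thesis using h(2)[of i] by simp
        qed
      qed blast
      have HcR: "(H ^ c) ^ r l = P powr (Q * \<gamma> + \<epsilon> / 2)"
        unfolding \<eta>cR[symmetric] cR_def H_def using P by (simp add: powr_power mult_ac)
      have XR: "X ^ r l = C2 ^ r l * P powr (Q * \<gamma> + \<epsilon> / 2)" by (simp add: X_def power_mult_distrib HcR)
      have F1: "fact ?n * C2 ^ r l \<le> F"
      proof -
        have "1 \<le> 16 * ?N" using n1 by linarith
        from mult_left_mono[OF this, of "fact ?n * C2 ^ r l"] show ?thesis using C2 by (simp add: F_def)
      qed
      have FP: "F * P powr (b + \<epsilon> / 2) \<le> P powr (b + \<epsilon>)" for b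
        using mult_right_mono[OF elim(5), of "P powr b"] by (simp add: powr_add mult_ac)
      have q1F: "real q1 \<le> F * P powr (Q * \<gamma> + \<epsilon> / 2)"
        using q1(2) mult_right_mono[OF F1, of "P powr (Q * \<gamma> + \<epsilon> / 2)"] by (simp add: XR mult.assoc)
      have qb: "real q1 * P powr (b + \<theta>) \<le> P powr (b + \<theta>')" for b
      proof -
        have "real q1 * P powr (b + \<theta>) \<le> F * P powr (Q * \<gamma> + \<epsilon> / 2) * P powr (b + \<theta>)"
          using q1F by (intro mult_right_mono) auto
        also have "\<dots> = F * P powr (Q * \<gamma> + b + \<theta> + \<epsilon> / 2)" by (simp add: mult.assoc algebra_simps flip: powr_add)
        also have "\<dots> \<le> P powr (Q * \<gamma> + b + \<theta> + \<epsilon>)" by (rule FP)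
        also have "\<dots> \<le> P powr (b + \<theta>')" using P \<theta> by (intro powr_mono) (auto simp: \<theta>')
        finally show ?thesis .
      qed
      \<comment> \<open>One factor H^c comes from w and r l - 1 of them from the minors, in total
        P^(Q * \<gamma> + \<epsilon> / 2). The remaining powers of P in w are P^(1 - c) and T^(-2),
        at most about P^(4 \<theta> - 2), which gives the exponent - l + 4 \<theta>.\<close>
      have wX: "fact ?n * X ^ (r l - 1) * w \<le> P powr (- real l + \<theta>')"
      proof -
        have "w \<le> (H / P) ^ (c - 1) * (4 * ?N * H / (P powr (2 - 4 * \<theta>) / 4))"
          unfolding w_def using T2 P H T(1) by (intro mult_left_mono divide_left_mono) auto
        also have "\<dots> = 16 * ?N * (H ^ c * (P / P ^ c / P powr (2 - 4 * \<theta>)))"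
        proof -
          obtain e where e: "c = Suc e" using c by (cases c) auto
          show ?thesis using P unfolding e by (simp add: power_divide)
        qed
        also have "P / P ^ c / P powr (2 - 4 * \<theta>) = P powr (- real l + 4 * \<theta>)"
        proof -
          have "P / P ^ c / P powr (2 - 4 * \<theta>) = P powr 1 / P powr real c / P powr (2 - 4 * \<theta>)" using P by (simp add: powr_realpow)
          also have "\<dots> = P powr (1 - real c - (2 - 4 * \<theta>))" by (simp only: powr_diff)
          finally show ?thesis by (simp add: c algebra_simps)
        qed
        finally have "w \<le> 16 * ?N * (H ^ c * P powr (- real l + 4 * \<theta>))" by simp
        then have "fact ?n * X ^ (r l - 1) * w \<le> fact ?n * X ^ (r l - 1) * (16 * ?N * (H ^ c * P powr (- real l + 4 * \<theta>)))"
          using X1 by (intro mult_left_mono) auto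
        also have "\<dots> = fact ?n * (16 * ?N) * P powr (- real l + 4 * \<theta>) * (C2 ^ (r l - 1) * (H ^ c) ^ r l)"
        proof -
          obtain e where e: "r l = Suc e" using rl by (cases "r l") auto
          show ?thesis unfolding e by (simp add: X_def power_mult_distrib)
        qed
        also have "\<dots> \<le> fact ?n * (16 * ?N) * P powr (- real l + 4 * \<theta>) * (C2 ^ r l * (H ^ c) ^ r l)"
          using C2 n1 H by (intro mult_left_mono mult_right_mono power_increasing) auto
        also have "\<dots> = F * P powr ((- real l + 4 * \<theta> + Q * \<gamma>) + \<epsilon> / 2)"
          unfolding HcR F_def by (simp add: powr_add mult_ac)
        also have "\<dots> \<le> P powr ((- real l + 4 * \<theta> + Q * \<gamma>) + \<epsilon>)" by (rule FP)
        finally show ?thesis by (simp add: \<theta>' algebra_simps)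
      qed
      show "\<exists>q'::nat. 1 \<le> q' \<and> real q' \<le> P powr \<theta>' \<and>
        (approximates r \<alpha> P {l..d} \<theta>' q')"
      proof (intro exI[of _ "q1 * q"] conjI ballI)
        show "1 \<le> q1 * q" using q q1 by simp
        have "real (q1 * q) \<le> real q1 * P powr (0 + \<theta>)" using q by (simp add: mult_left_mono)
        then show "real (q1 * q) \<le> P powr \<theta>'" using qb[of 0] by simp
      next
        fix j s assume js: "j \<in> {l..d}" "s \<in> {1..r j}"
        show "dist_int (real (q1 * q) * \<alpha> j s) \<le> P powr (- real j + \<theta>')"
        proof (cases "j = l")
          case True
          then show ?thesis using q1(3)[of s] wX js by (simp add: mult.assoc)
        next
          case False
          have "dist_int (of_int (int q1) * (real q * \<alpha> j s)) \<le> \<bar>of_int (int q1)\<bar> * dist_int (real q * \<alpha> j s)"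
            by (rule dist_int_mult_le)
          then have "dist_int (real (q1 * q) * \<alpha> j s) \<le> real q1 * dist_int (real q * \<alpha> j s)" by (simp add: mult.assoc)
          also have "\<dots> \<le> real q1 * P powr (- real j + \<theta>)" using maj js False by (intro mult_left_mono) auto
          also have "\<dots> \<le> P powr (- real j + \<theta>')" by (rule qb)
          finally show ?thesis .
        qed
      qed
    qed
  qed
qed

subsection \<open>Descent on the degree\<close>

lemma gamma_inv_nonneg: "0 \<le> gamma_inv l k U"
  by (auto simp: gamma_inv_def intro!: divide_nonneg_pos)

lemma gamma_inv_finite:
  assumes "gamma_inv l k U \<noteq> \<infinity>" "1 \<le> k"
  shows "0 < g_inv l k U" "gamma_inv l k U = ereal (2 ^ (l - 1) * real (l - 1) * real k / g_inv l k U)"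
  using assms by (auto simp: gamma_inv_def split: if_splits)

lemma gamma_sum_finite:
  assumes "gamma_sum d r u \<noteq> \<infinity>" "j \<in> {2..d}"
  shows "gamma_inv j (r j) (lead_forms u j) \<noteq> \<infinity>"
proof
  assume "gamma_inv j (r j) (lead_forms u j) = \<infinity>"
  then have "ereal (4 ^ (j - 2)) * gamma_inv j (r j) (lead_forms u j) = \<infinity>" by simp
  with assms show False unfolding gamma_sum_def by (auto simp: sum_Pinfty)
qed

lemma dist_int_vec_le:
  "0 \<le> y \<Longrightarrow> (\<And>s. s \<in> {1..k} \<Longrightarrow> dist_int (a s) \<le> y) \<Longrightarrow> dist_int_vec k a \<le> y"
  by (simp add: dist_int_vec_def)

theorem theorem1p1:
  fixes d :: nat and r :: "nat \<Rightarrow> nat"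
    and u :: "nat \<Rightarrow> nat \<Rightarrow> 'n::finite int_mpoly"
    and \<Delta> \<Omega> :: real and R :: nat
  assumes "1 \<le> d"
    and "is_system d r u"
    and "R = (\<Sum>l=1..d. r l)"
    and "B1_inv (r 1) (lead_forms u 1) >
      ereal (2 * real (r 1)) *
        inverse (max (ereal (4 * (real (r 1) + 1)) * gamma_sum d r u)
                     (ereal (1 / (4 * (real R + 1)))))"
    and "0 < \<Omega>"
    and "ereal \<Omega> <
      min (ereal (1 / (8 * real (r 1) + 9)) * inverse (gamma_sum d r u))
          (inverse (ereal (1 / (2 * (real R + 1))) + gamma_sum d r u))"
    and "0 < \<Delta>" and "\<Delta> \<le> 1"
  shows "\<forall>\<^sub>F P :: real in at_top. \<forall>\<alpha> :: nat \<Rightarrow> nat \<Rightarrow> real.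
    norm (exp_sum d r u P \<alpha>) \<le> P powr (real CARD('n) - \<Delta> * \<Omega>) \<or>
    (\<exists>q::nat. 1 \<le> q \<and> real q \<le> P powr \<Delta> \<and>
      (\<forall>l\<in>{1..d}. dist_int_vec (r l) (\<lambda>s. real q * \<alpha> l s) \<le> P powr (- real l + \<Delta>)))"
proof -
  define r1 where "r1 = real (r 1)"
  define Q where "Q = \<Delta> * \<Omega>"
  define \<gamma> where "\<gamma> j = real_of_ereal (gamma_inv j (r j) (lead_forms u j))" for j
  define S where "S = (\<Sum>j=2..d. 4 ^ (j - 2) * \<gamma> j)"
  have r1: "0 \<le> r1" by (simp add: r1_def)
  \<comment> \<open>An infinite sum has inverse 0 and would force \<Omega> < 0.\<close>
  have fin: "gamma_sum d r u \<noteq> \<infinity>"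
  proof
    assume "gamma_sum d r u = \<infinity>"
    then have "ereal \<Omega> < 0" using assms(6) by simp
    then show False using assms(5) by simp
  qed
  have \<gamma>: "gamma_inv j (r j) (lead_forms u j) = ereal (\<gamma> j)" "0 \<le> \<gamma> j" if "j \<in> {2..d}" for j
    using gamma_sum_finite[OF fin that] gamma_inv_nonneg[of j "r j" "lead_forms u j"]
    by (auto simp: \<gamma>_def ereal_real real_of_ereal_pos)
  have S: "gamma_sum d r u = ereal S"
    unfolding gamma_sum_def S_def by (simp add: \<gamma> flip: sum_ereal)
  have S0: "0 \<le> S" unfolding S_def by (intro sum_nonneg mult_nonneg_nonneg) (auto simp: \<gamma>)
  \<comment> \<open>For S = 0 the extended inverse is infinite and yields no bound, but then the
    claim is trivial.\<close>
  have \<Omega>S: "\<Omega> * S < 1 / (8 * r1 + 9)"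
  proof (cases "S = 0")
    case True
    then show ?thesis using r1 by simp
  next
    case False
    then have "\<Omega> < 1 / (8 * r1 + 9) * inverse S" using assms(6) by (simp add: S r1_def)
    then have "\<Omega> * S < 1 / (8 * r1 + 9) * inverse S * S" using False S0 by (intro mult_strict_right_mono) auto
    then show ?thesis using False by simp
  qed
  have \<Omega>R: "\<Omega> < 2 * (real R + 1)"
  proof -
    have pos: "0 < 1 / (2 * (real R + 1)) + S" using S0 by (intro add_pos_nonneg) auto
    then have "\<Omega> < inverse (1 / (2 * (real R + 1)) + S)" using assms(6) by (simp add: S)
    also have "\<dots> \<le> inverse (1 / (2 * (real R + 1)))" using S0 by (intro le_imp_inverse_le) auto
    finally show ?thesis by simp
  qed
  \<comment> \<open>In both cases of the maximum m the bounds on \<Omega> give \<Omega> * m < 1 / 2.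
    With the lower bound for \<open>B1_inv\<close> and r 1 \<ge> 1 this becomes 4 * \<Omega> < b, as
    a saving of P^(\<Delta> / 4) per bad coordinate requires.\<close>
  have B1: "Q < \<Delta> / 4 * real b" if r1pos: "1 \<le> r 1" and b: "B1_inv (r 1) (lead_forms u 1) \<le> ereal (real b)" for b :: nat
  proof -
    define m where "m = max (4 * (r1 + 1) * S) (1 / (4 * (real R + 1)))"
    have m: "0 < m" unfolding m_def by (simp add: less_max_iff_disj)
    have "max (ereal (4 * (real (r 1) + 1)) * gamma_sum d r u) (ereal (1 / (4 * (real R + 1)))) = ereal m"
      by (simp add: S m_def r1_def ereal_max)
    then have "ereal (2 * r1 * inverse m) < ereal (real b)"
      using order.strict_trans2[OF assms(4) b] m by (simp add: r1_def)
    then have lt: "2 * r1 * inverse m < real b" by simp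
    have "\<Omega> * m < 1 / 2"
    proof (cases "4 * (r1 + 1) * S \<le> 1 / (4 * (real R + 1))")
      case True
      then have meq: "m = 1 / (4 * (real R + 1))" by (simp add: m_def)
      have "\<Omega> * m < 2 * (real R + 1) * m" using \<Omega>R m by (rule mult_strict_right_mono)
      also have "\<dots> = 1 / 2" unfolding meq by (simp add: field_simps)
      finally show ?thesis .
    next
      case False
      then have "\<Omega> * m = 4 * (r1 + 1) * (\<Omega> * S)" by (simp add: m_def)
      also have "\<dots> < 4 * (r1 + 1) * (1 / (8 * r1 + 9))" using \<Omega>S r1 by (intro mult_strict_left_mono) auto
      \<comment> \<open>The origin of 8 r_1 + 9: it exceeds 8 (r_1 + 1).\<close>
      also have "\<dots> < 1 / 2" using r1 by (simp add: field_simps)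
      finally show ?thesis .
    qed
    then have "4 * \<Omega> < 2 * inverse m" using m by (simp add: field_simps)
    also have "\<dots> \<le> 2 * r1 * inverse m" using m r1pos by (intro mult_right_mono) (auto simp: r1_def)
    finally have "4 * \<Omega> < real b" using lt by simp
    then show ?thesis using assms(7) by (simp add: Q_def)
  qed
  \<comment> \<open>Small enough that the \<epsilon> of all stages, amplified by powers of 4, add up
    to at most \<Delta> / 100.\<close>
  define \<epsilon> where "\<epsilon> = \<Delta> / (100 * 4 ^ d)"
  have \<epsilon>: "0 < \<epsilon>" using assms(7) by (simp add: \<epsilon>_def)
  have Q: "0 \<le> Q" using assms by (simp add: Q_def)
  \<comment> \<open>The solution of \<theta> l = 4 * \<theta> (l + 1) + Q * \<gamma> l + \<epsilon>
    with \<theta> (d + 1) = 0.\<close>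
  define \<theta> where "\<theta> l = (\<Sum>j=l..d. 4 ^ (j - l) * (Q * \<gamma> j + \<epsilon>))" for l
  have nn: "0 \<le> Q * \<gamma> j + \<epsilon>" if "j \<in> {2..d}" for j using \<gamma>(2)[OF that] Q \<epsilon> by simp
  have \<theta>0: "0 \<le> \<theta> l" if "2 \<le> l" for l
    unfolding \<theta>_def using that by (intro sum_nonneg mult_nonneg_nonneg nn) auto
  have \<theta>_rec: "\<theta> l = 4 * \<theta> (Suc l) + Q * \<gamma> l + \<epsilon>" if "l \<le> d" for l
  proof -
    have "\<theta> l = (Q * \<gamma> l + \<epsilon>) + (\<Sum>j=Suc l..d. 4 ^ (j - l) * (Q * \<gamma> j + \<epsilon>))"
      unfolding \<theta>_def using that by (simp add: sum.atLeast_Suc_atMost)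
    also have "(\<Sum>j=Suc l..d. 4 ^ (j - l) * (Q * \<gamma> j + \<epsilon>)) = 4 * \<theta> (Suc l)"
      unfolding \<theta>_def sum_distrib_left
    proof (rule sum.cong[OF refl])
      fix j assume "j \<in> {Suc l..d}"
      then have "j - l = Suc (j - Suc l)" by auto
      then show "4 ^ (j - l) * (Q * \<gamma> j + \<epsilon>) = 4 * (4 ^ (j - Suc l) * (Q * \<gamma> j + \<epsilon>))" by simp
    qed
    finally show ?thesis by simp
  qed
  have \<theta>_le: "\<theta> l \<le> \<theta> 2" if "2 \<le> l" for l
  proof -
    have "\<theta> l \<le> (\<Sum>j=l..d. 4 ^ (j - 2) * (Q * \<gamma> j + \<epsilon>))"
      unfolding \<theta>_def using that by (intro sum_mono mult_right_mono power_increasing nn) auto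
    also have "\<dots> \<le> (\<Sum>j=2..d. 4 ^ (j - 2) * (Q * \<gamma> j + \<epsilon>))"
      using that by (intro sum_mono2 mult_nonneg_nonneg nn) auto
    finally show ?thesis by (simp add: \<theta>_def)
  qed
  \<comment> \<open>The budget: 2 * \<theta> 2 + \<Delta> / 4 has to stay below \<Delta>, and every
    \<theta> l with l \<ge> 2 below 1.\<close>
  have \<theta>2: "\<theta> 2 < \<Delta> / 8"
  proof -
    have "\<theta> 2 = Q * S + \<epsilon> * (\<Sum>j=2..d. 4 ^ (j - 2))"
      by (simp add: \<theta>_def S_def sum.distrib sum_distrib_left algebra_simps)
    also have "(\<Sum>j=2..d. 4 ^ (j - 2)) \<le> (4 :: real) ^ d"
    proof -
      have "(\<Sum>j=2..d. 4 ^ (j - 2)) \<le> (\<Sum>j<d. (4 :: real) ^ j)"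
        by (rule sum_le_included[where i = "\<lambda>j. j + 2"]) (auto intro!: bexI[of _ "_ - 2"])
      also have "\<dots> = (4 ^ d - 1) / 3" by (simp add: geometric_sum)
      also have "\<dots> \<le> 4 ^ d"
      proof -
        have shrink: "(x - 1) / 3 \<le> x" if "1 \<le> x" for x :: real using that by simp
        show ?thesis by (rule shrink) simp
      qed
      finally show ?thesis .
    qed
    also have "Q * S + \<epsilon> * 4 ^ d = \<Delta> * (\<Omega> * S) + \<Delta> / 100" by (simp add: \<epsilon>_def Q_def)
    also have "\<Omega> * S < 1 / 9" by (rule less_le_trans[OF \<Omega>S]) (use r1 in \<open>simp add: field_simps\<close>)
    also have "\<Delta> * (1 / 9) + \<Delta> / 100 < \<Delta> / 8" using assms(7) by simp
    finally show ?thesis using \<epsilon> assms(7) by simp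
  qed
  let ?big = "\<lambda>P \<alpha>. P powr (real CARD('n) - Q) < norm (exp_sum d r u P \<alpha>)"
  have stage: "\<forall>\<^sub>F P::real in at_top. \<forall>\<alpha>. ?big P \<alpha> \<longrightarrow> (\<exists>q::nat. 1 \<le> q \<and> real q \<le> P powr \<theta> 2 \<and>
    (approximates r \<alpha> P {2..d} (\<theta> 2) q))"
  proof (rule inc_induct[of 2 "Suc d"])
    show "2 \<le> Suc d" using assms(1) by simp
    \<comment> \<open>Start of the downward induction: above degree d there is nothing to
      approximate, \<theta> (d + 1) = 0, and q = 1 will do.\<close>
    show "\<forall>\<^sub>F P::real in at_top. \<forall>\<alpha>. ?big P \<alpha> \<longrightarrow> (\<exists>q::nat. 1 \<le> q \<and> real q \<le> P powr \<theta> (Suc d) \<and>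
      (approximates r \<alpha> P {Suc d..d} (\<theta> (Suc d)) q))"
      using eventually_gt_at_top[of "0::real"]
      by eventually_elim (auto simp: \<theta>_def intro!: exI[of _ "1::nat"])
  next
    fix l assume l: "2 \<le> l" "l < Suc d"
      and IH: "\<forall>\<^sub>F P::real in at_top. \<forall>\<alpha>. ?big P \<alpha> \<longrightarrow> (\<exists>q::nat. 1 \<le> q \<and> real q \<le> P powr \<theta> (Suc l) \<and>
        (approximates r \<alpha> P {Suc l..d} (\<theta> (Suc l)) q))"
    have ld: "l \<in> {2..d}" using l by simp
    have set: "{Suc l..d} = {l<..d}" by auto
    show "\<forall>\<^sub>F P::real in at_top. \<forall>\<alpha>. ?big P \<alpha> \<longrightarrow> (\<exists>q::nat. 1 \<le> q \<and> real q \<le> P powr \<theta> l \<and>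
        (approximates r \<alpha> P {l..d} (\<theta> l) q))"
    proof (cases "r l = 0")
      case True
      \<comment> \<open>Without forms of degree l the old q serves; only the exponent is enlarged,
        to keep the recursion uniform.\<close>
      have le: "\<theta> (Suc l) \<le> \<theta> l" using \<theta>_rec[of l] \<theta>0[of "Suc l"] nn[OF ld] l by simp
      show ?thesis using IH eventually_ge_at_top[of "1::real"]
      proof eventually_elim
        case (elim P)
        show ?case
        proof (intro allI impI)
          fix \<alpha> assume "?big P \<alpha>"
          then obtain q :: nat where q: "1 \<le> q" "real q \<le> P powr \<theta> (Suc l)"
            "approximates r \<alpha> P {Suc l..d} (\<theta> (Suc l)) q"
            using elim(1) by blast
          have mono: "P powr (b + \<theta> (Suc l)) \<le> P powr (b + \<theta> l)" for b using elim(2) le by (intro powr_mono) auto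
          have "dist_int (real q * \<alpha> j s) \<le> P powr (- real j + \<theta> l)" if "j \<in> {l..d}" "s \<in> {1..r j}" for j s
          proof -
            have "j \<noteq> l" using that True by auto
            then have "dist_int (real q * \<alpha> j s) \<le> P powr (- real j + \<theta> (Suc l))" using q(3) that by auto
            then show ?thesis using mono by (rule order.trans)
          qed
          moreover have "real q \<le> P powr \<theta> l" using q(2) mono[of 0] by simp
          ultimately show "\<exists>q::nat. 1 \<le> q \<and> real q \<le> P powr \<theta> l \<and>
            (approximates r \<alpha> P {l..d} (\<theta> l) q)" using q(1) by blast
        qed
      qed
    next
      case False
      then have rl: "1 \<le> r l" by simp
      note gi = gamma_inv_finite[OF gamma_sum_finite[OF fin ld] rl]
      have "\<forall>\<^sub>F P::real in at_top. \<forall>\<alpha>. \<forall>q::nat. 1 \<le> q \<longrightarrow> real q \<le> P powr \<theta> (Suc l) \<longrightarrow>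
        (approximates r \<alpha> P {l<..d} (\<theta> (Suc l)) q) \<longrightarrow>
        ?big P \<alpha> \<longrightarrow> (\<exists>q'::nat. 1 \<le> q' \<and> real q' \<le> P powr \<theta> l \<and>
          (approximates r \<alpha> P {l..d} (\<theta> l) q'))"
      proof (rule differencing_stage[OF assms(2) _ _ rl gi(1)])
        show "\<gamma> l = 2 ^ (l - 1) * real (l - 1) * real (r l) / g_inv l (r l) (lead_forms u l)"
          using gi(2) by (simp add: \<gamma>_def)
        show "\<theta> l = 4 * \<theta> (Suc l) + Q * \<gamma> l + \<epsilon>" by (rule \<theta>_rec) (use l in simp)
        show "\<theta> l < 1" using \<theta>_le[OF l(1)] \<theta>2 assms(8) by linarith
        show "0 \<le> \<theta> (Suc l)" by (rule \<theta>0) (use l in simp)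
      qed (use l Q \<epsilon> in auto)
      with IH show ?thesis unfolding set by eventually_elim blast
    qed
  qed
  have final: "\<forall>\<^sub>F P::real in at_top. \<forall>\<alpha>. ?big P \<alpha> \<longrightarrow> (\<exists>q::nat. 1 \<le> q \<and> real q \<le> P powr \<Delta> \<and>
    (approximates r \<alpha> P {1..d} \<Delta> q))"
  proof (cases "r 1 = 0")
    case True
    have le: "\<theta> 2 \<le> \<Delta>" using \<theta>2 assms(7) by linarith
    show ?thesis using stage eventually_ge_at_top[of "1::real"]
    proof eventually_elim
      case (elim P)
      show ?case
      proof (intro allI impI)
        fix \<alpha> assume "?big P \<alpha>"
        then obtain q :: nat where q: "1 \<le> q" "real q \<le> P powr \<theta> 2"
          "approximates r \<alpha> P {2..d} (\<theta> 2) q"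
          using elim(1) by blast
        have mono: "P powr (b + \<theta> 2) \<le> P powr (b + \<Delta>)" for b using elim(2) le by (intro powr_mono) auto
        have "dist_int (real q * \<alpha> j s) \<le> P powr (- real j + \<Delta>)" if "j \<in> {1..d}" "s \<in> {1..r j}" for j s
        proof -
          have "j \<noteq> 1" using that True by auto
          then have "dist_int (real q * \<alpha> j s) \<le> P powr (- real j + \<theta> 2)" using q(3) that by auto
          then show ?thesis using mono by (rule order.trans)
        qed
        moreover have "real q \<le> P powr \<Delta>" using q(2) mono[of 0] by simp
        ultimately show "\<exists>q::nat. 1 \<le> q \<and> real q \<le> P powr \<Delta> \<and>
          (approximates r \<alpha> P {1..d} \<Delta> q)" using q(1) by blast
      qed
    qed
  next
    case False
    then have r1': "1 \<le> r 1" by simp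
    have set: "{2..d} = {1<..d}" by auto
    have "\<forall>\<^sub>F P::real in at_top. \<forall>\<alpha>. \<forall>q::nat. 1 \<le> q \<longrightarrow> real q \<le> P powr \<theta> 2 \<longrightarrow>
      (approximates r \<alpha> P {1<..d} (\<theta> 2) q) \<longrightarrow>
      ?big P \<alpha> \<longrightarrow> (\<exists>q'::nat. 1 \<le> q' \<and> real q' \<le> P powr \<Delta> \<and>
        (approximates r \<alpha> P {1..d} \<Delta> q'))"
    proof (rule linear_stage[OF assms(2,1) r1'])
      show "Q < \<Delta> / 4 * real b" if "B1_inv (r 1) (lead_forms u 1) \<le> ereal (real b)" for b
        using B1[OF r1' that] .
      show "2 * \<theta> 2 + \<Delta> / 4 < \<Delta>" using \<theta>2 assms(7) by linarith
      show "\<theta> 2 \<le> 1 / 2" using \<theta>2 assms(8) by linarith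
    qed (use \<theta>0 assms(7) in auto)
    with stage show ?thesis unfolding set by eventually_elim blast
  qed
  then show ?thesis
  proof eventually_elim
    case (elim P)
    show ?case
    proof (rule allI)
      fix \<alpha>
      show "norm (exp_sum d r u P \<alpha>) \<le> P powr (real CARD('n) - \<Delta> * \<Omega>) \<or>
        (\<exists>q::nat. 1 \<le> q \<and> real q \<le> P powr \<Delta> \<and>
          (\<forall>l\<in>{1..d}. dist_int_vec (r l) (\<lambda>s. real q * \<alpha> l s) \<le> P powr (- real l + \<Delta>)))"
      proof (cases "?big P \<alpha>")
        case True
        then obtain q :: nat where q: "1 \<le> q" "real q \<le> P powr \<Delta>"
          "approximates r \<alpha> P {1..d} \<Delta> q"
          using elim by blast
        have "dist_int_vec (r l) (\<lambda>s. real q * \<alpha> l s) \<le> P powr (- real l + \<Delta>)" if "l \<in> {1..d}" for l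
          by (rule dist_int_vec_le) (use q(3) that in auto)
        then show ?thesis using q(1,2) by blast
      next
        case False
        then show ?thesis by (simp add: Q_def not_less)
      qed
    qed
  qed
qed

end
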